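(* Fix $\gamma>1/2$, $\mathfrak{d}\in\mathbb{N}$, $\alpha_0>1/2$ and $\alpha_\ell\in(0,1]$ for $\ell\in\{1,\dots,\mathfrak{d}\}$. For each $\ell\in\{0,1,\dots,\mathfrak{d}\}$ let $f_\ell:[0,1]\to\mathbb{C}$ be an $\alpha_\ell$-H\"older continuous function, and let $D_N^{(\ell)}$ be the $N\times N$ diagonal matrix with entries $\{f_\ell(i/N)\}_{i=1}^N$. Let $J$ be the $N\times N$ matrix with $J_{ij}=\mathbf{1}_{j=i+1}$, set $M_N:=\sum_{\ell=0}^{\mathfrak{d}}D_N^{(\ell)}J^\ell$ and $\mathcal{M}_N:=M_N+N^{-\gamma}G_N$, where $G_N$ is an $N\times N$ matrix with i.i.d. standard complex Gaussian entries, and let $L_N$ be the empirical measure of the eigenvalues of $\mathcal{M}_N$. Then, as $N\to\infty$, $L_N$ converges weakly in probability to $\mu_{\mathfrak{d},\mathbf{f}}$, the law of $\sum_{\ell=0}^{\mathfrak{d}}f_\ell(X)U^\ell$, where $X\sim\mathrm{Unif}(0,1)$, $U$ is uniformly distributed on the unit circle in $\mathbb{C}$, and $X$ and $U$ are independent of each other.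
   Context: The empirical measure is $L_N=N^{-1}\sum_{i=1}^N\delta_{\lambda_i}$ with $\lambda_1,\dots,\lambda_N$ the eigenvalues of $\mathcal{M}_N$. Random probability measures $L_N$ converge weakly in probability to $\mu$ if $\int f\,dL_N\to\int f\,d\mu$ in probability for every bounded continuous $f:\mathbb{C}\to\mathbb{R}$. *)

theory Defs
  imports "HOL-Probability.Probability" "Jordan_Normal_Form.Char_Poly"
begin

definition holder_on :: "real \<Rightarrow> real set \<Rightarrow> (real \<Rightarrow> complex) \<Rightarrow> bool" where
  "holder_on \<alpha> S f \<longleftrightarrow>
     (\<exists>C\<ge>0. \<forall>x\<in>S. \<forall>y\<in>S. cmod (f x - f y) \<le> C * \<bar>x - y\<bar> powr \<alpha>)"

text \<open>Matrix indices run over \<open>0, \<dots>, N - 1\<close>, so the \<open>i\<close>-th diagonal entry is \<open>g ((i + 1) / N)\<close>.\<close>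

definition sample_diag :: "nat \<Rightarrow> (real \<Rightarrow> complex) \<Rightarrow> complex mat" where
  "sample_diag N g = mat_diag N (\<lambda>i. g (real (i + 1) / real N))"

definition shift_mat :: "nat \<Rightarrow> complex mat" where
  "shift_mat N = Matrix.mat N N (\<lambda>(i, j). if j = i + 1 then 1 else 0)"

text \<open>The sum of matrices is taken entrywise, since the type \<^typ>\<open>complex mat\<close>, which comprises
  matrices of all dimensions, is not an instance of \<^class>\<open>comm_monoid_add\<close>.\<close>

definition banded_mat :: "nat \<Rightarrow> (nat \<Rightarrow> real \<Rightarrow> complex) \<Rightarrow> nat \<Rightarrow> complex mat" where
  "banded_mat d f N =
     Matrix.mat N N (\<lambda>(i, j). \<Sum>l\<le>d. (sample_diag N (f l) * shift_mat N ^\<^sub>m l) $$ (i, j))"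

text \<open>Standard complex Gaussian: \<open>E Z = 0\<close>, \<open>E (Z\<^sup>2) = 0\<close>, \<open>E \<bar>Z\<bar>\<^sup>2 = 1\<close>; that is, the real and imaginary
  parts are independent real Gaussians of variance \<open>1/2\<close>.\<close>

definition std_complex_normal_density :: "complex \<Rightarrow> real" where
  "std_complex_normal_density z = exp (- (cmod z)\<^sup>2) / pi"

lemma std_complex_normal_density_eq:
  "std_complex_normal_density z =
     normal_density 0 (sqrt (1 / 2)) (Re z) * normal_density 0 (sqrt (1 / 2)) (Im z)"
proof -
  have s: "sqrt (2 * pi * (sqrt (1 / 2))\<^sup>2) = sqrt pi" by simp
  show ?thesis
    unfolding std_complex_normal_density_def normal_density_def s
    by (simp add: cmod_power2 mult_exp_exp add.commute)
qed

definition complex_gaussian_matrix :: "'w measure \<Rightarrow> nat \<Rightarrow> ('w \<Rightarrow> complex mat) \<Rightarrow> bool" where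
  "complex_gaussian_matrix P N G \<longleftrightarrow>
     (\<forall>\<omega>\<in>space P. G \<omega> \<in> carrier_mat N N) \<and>
     prob_space.indep_vars P (\<lambda>_. borel) (\<lambda>(i, j) \<omega>. G \<omega> $$ (i, j)) ({..<N} \<times> {..<N}) \<and>
     (\<forall>i<N. \<forall>j<N. distributed P lborel (\<lambda>\<omega>. G \<omega> $$ (i, j))
        (\<lambda>z. ennreal (std_complex_normal_density z)))"

text \<open>\<^const>\<open>proots\<close> lists each eigenvalue with its algebraic multiplicity, so an \<open>N \<times> N\<close> matrix has
  exactly \<open>N\<close> eigenvalues in this sense.\<close>

definition eigenvalue_mset :: "complex mat \<Rightarrow> complex multiset" where
  "eigenvalue_mset A = proots (char_poly A)"

definition empirical_measure :: "complex mat \<Rightarrow> complex measure" where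
  "empirical_measure A = distr (measure_pmf (pmf_of_multiset (eigenvalue_mset A))) borel (\<lambda>z. z)"

lemma size_eigenvalue_mset:
  assumes "A \<in> carrier_mat N N"
  shows "size (eigenvalue_mset A) = N"
  using degree_monic_char_poly[OF assms] by (simp add: eigenvalue_mset_def size_proots_complex)

lemma sum_mset_eq_sum_count:
  fixes g :: "complex \<Rightarrow> real"
  assumes "finite S" "set_mset M \<subseteq> S"
  shows "(\<Sum>z\<in>#M. g z) = (\<Sum>z\<in>S. g z * count M z)"
  using assms(2)
proof (induction M)
  case (add x M)
  have "(\<Sum>z\<in>S. g z * count (add_mset x M) z)
      = (\<Sum>z\<in>S. g z * count M z + (if z = x then g z else 0))"
    by (rule sum.cong) (auto simp: algebra_simps)
  also have "\<dots> = (\<Sum>z\<in>S. g z * count M z) + g x"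
    using assms(1) add.prems by (simp add: sum.distrib)
  finally show ?case using add by simp
qed simp

lemma integral_empirical_measure:
  fixes g :: "complex \<Rightarrow> real"
  assumes A: "A \<in> carrier_mat N N" and "0 < N" and g: "g \<in> borel_measurable borel"
  shows "(\<integral>z. g z \<partial>empirical_measure A) = (\<Sum>z\<in>#eigenvalue_mset A. g z) / real N"
proof -
  let ?M = "eigenvalue_mset A"
  have s: "size ?M = N" using size_eigenvalue_mset[OF A] .
  then have ne: "?M \<noteq> {#}" using assms(2) by auto
  have "(\<integral>z. g z \<partial>empirical_measure A) = (\<integral>z. g z \<partial>measure_pmf (pmf_of_multiset ?M))"
    unfolding empirical_measure_def by (subst integral_distr) (use g in auto)
  also have "\<dots> = (\<Sum>z\<in>set_mset ?M. g z * pmf (pmf_of_multiset ?M) z)"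
    by (rule integral_measure_pmf_real) (use ne in auto)
  also have "\<dots> = (\<Sum>z\<in>#?M. g z) / real N"
    using ne s by (simp add: sum_mset_eq_sum_count[of "set_mset ?M"] sum_divide_distrib)
  finally show ?thesis .
qed

text \<open>The probability space may vary with \<open>n\<close>, which is harmless because the limit is a constant.
  Measurability is required explicitly because \<^const>\<open>measure\<close> vanishes on non-measurable sets.\<close>

definition tendsto_in_prob ::
    "(nat \<Rightarrow> 'w measure) \<Rightarrow> (nat \<Rightarrow> 'w \<Rightarrow> real) \<Rightarrow> real \<Rightarrow> bool" where
  "tendsto_in_prob P X c \<longleftrightarrow>
     (\<forall>n. X n \<in> borel_measurable (P n)) \<and>
     (\<forall>\<epsilon>>0. (\<lambda>n. measure (P n) {\<omega> \<in> space (P n). \<bar>X n \<omega> - c\<bar> > \<epsilon>}) \<longlonglongrightarrow> 0)"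

definition weakly_tendsto_in_prob ::
    "(nat \<Rightarrow> 'w measure) \<Rightarrow> (nat \<Rightarrow> 'w \<Rightarrow> complex measure) \<Rightarrow> complex measure \<Rightarrow> bool" where
  "weakly_tendsto_in_prob P L \<mu> \<longleftrightarrow>
     (\<forall>g :: complex \<Rightarrow> real. continuous_on UNIV g \<and> bounded (range g) \<longrightarrow>
        tendsto_in_prob P (\<lambda>n \<omega>. \<integral>z. g z \<partial>L n \<omega>) (\<integral>z. g z \<partial>\<mu>))"

text \<open>The underlying space of \<open>unif01\<close> is the interval itself, not the whole line: the functions \<open>f l\<close>
  below are constrained only on the unit interval and need not be measurable outside it.\<close>

definition unif01 :: "real measure" where
  "unif01 = restrict_space lborel {0<..<1}"

definition unif_circle :: "complex measure" where
  "unif_circle = distr unif01 borel (\<lambda>t. cis (2 * pi * t))"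

text \<open>The coordinates \<open>X = fst\<close>, \<open>U = snd\<close> on the product space are independent with laws
  \<open>unif01\<close> and \<open>unif_circle\<close>.\<close>

definition limit_law :: "nat \<Rightarrow> (nat \<Rightarrow> real \<Rightarrow> complex) \<Rightarrow> complex measure" where
  "limit_law d f = distr (unif01 \<Otimes>\<^sub>M unif_circle) borel (\<lambda>(x, u). \<Sum>l\<le>d. f l x * u ^ l)"

end

theory Submission
  imports Defs "HOL-Complex_Analysis.Complex_Analysis" "Jordan_Normal_Form.Schur_Decomposition" "HOL-Real_Asymp.Real_Asymp"
begin

text \<open>Write \<open>M\<close> for the band matrix, \<open>\<delta> = N powr (- \<gamma>)\<close>, and
  \<open>X z = ln \<bar>det (z - M - \<delta> G)\<bar> / N\<close>. The function \<open>X\<close> is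
  the logarithmic potential of the empirical eigenvalue measure, and it determines that measure: a
  mean of \<open>X\<close> over a circle of radius \<open>r\<close> turns each \<open>ln \<bar>z -
  x\<bar>\<close> into \<open>ln (max \<bar>z - x\<bar> r)\<close>, and the difference of two such
  truncated logarithms is a compactly supported bump around \<open>x\<close>. Hence an integral
  against the eigenvalue measure is, up to a small mollification error, an integral against
  \<open>X\<close>, and two root multisets are close as soon as their potentials are close in
  \<open>L\<^sup>1\<close> on discs (\<open>root_sum_diff_le\<close>,
  \<open>root_sums_close\<close>).

The potential \<open>X\<close> is compared with that of an explicit normal matrix \<open>C\<close>.
  Cut the indices into blocks of length \<open>m\<close>, freeze the coefficients \<open>f l\<close>
  on each block and close every block up cyclically. The result is block-circulant: the discrete
  Fourier basis diagonalises it, with eigenvalues \<open>\<Sum>l\<le>d. f l x * \<omega> ^ l\<close>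
  where \<open>x\<close> runs over the left ends of the blocks and \<open>\<omega>\<close> over the
  \<open>m\<close>-th roots of unity. The average of a test function over these eigenvalues is a
  Riemann sum for its integral against the limit law (\<open>node_average_error\<close>,
  \<open>integral_limit_law\<close>). It remains to bound the expected \<open>L\<^sup>1\<close>
  distance of the two potentials on a disc (\<open>potential_deviation\<close>).

The upper bound on \<open>X\<close> is pathwise (\<open>ndet_perturb_normal_le\<close>). Hadamard's
  inequality, applied to the columns of \<open>z - M - \<delta> G\<close> in the Fourier basis,
  loses only a constant multiple of \<open>sqrt N\<close> times the Frobenius norm of \<open>M - C + \<delta> G\<close>.
  The noise contributes \<open>\<delta> * sqrt N\<close> after division by \<open>N\<close>, which
  tends to 0 precisely because \<open>\<gamma> > 1/2\<close>.

The lower bound holds in expectation (\<open>noisy_ndet_lower\<close>). The determinant is affine in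
  each entry and the Gaussian law is rotation invariant, so by subharmonicity of \<open>ln \<bar>a +
  b g\<bar>\<close> removing the noise can only decrease the expectation. Moreover, as long as an
  entry carries noise, its deterministic part may be altered by a bounded amount at the price of a
  term of order \<open>ln N\<close>. This lets one replace \<open>z - M\<close> by a matrix that is
  well conditioned: the wrap-around rows are made cyclic, and the blocks having an eigenvalue within
  \<open>s\<close> of \<open>z\<close> are replaced by the identity. On the remaining blocks
  \<open>z - C\<close> has an inverse of norm at most \<open>1 / s\<close>, which absorbs the
  Hoelder error of freezing the coefficients (\<open>ndet_comp_ge\<close>). For a given
  \<open>z\<close> many blocks may have to be replaced, but every eigenvalue is within
  \<open>s\<close> of \<open>z\<close> only for \<open>z\<close> in a disc of area of order
  \<open>s\<^sup>2\<close>, so after integration over \<open>z\<close> few are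
  (\<open>log_det_deviation_integrated\<close>).

A pathwise upper bound and a matching lower bound for the expectation together give closeness in
  \<open>L\<^sup>1\<close> (\<open>log_deviation_le\<close>), and Markov's inequality turns this
  into convergence in probability.\<close>

section \<open>Planar Lebesgue measure and the complex Gaussian law\<close>

text \<open>Identifies the plane with the product of two lines, so that Fubini's theorem is
  available for integrals over complex variables.\<close>

lemma lborel_complex_eq_distr:
  "(lborel :: complex measure) = distr (lborel \<Otimes>\<^sub>M lborel) borel (\<lambda>(x, y). Complex x y)"
proof (rule lborel_eqI)
  fix l u :: complex
  assume lu: "\<And>b. b \<in> Basis \<Longrightarrow> inner l b \<le> inner u b"
  have lu': "Re l \<le> Re u" "Im l \<le> Im u"
    using lu[of 1] lu[of \<i>] by (auto simp: Basis_complex_def)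
  have m: "(\<lambda>(x, y). Complex x y) \<in> borel_measurable (lborel \<Otimes>\<^sub>M lborel)"
    by (simp add: Complex_eq split_beta)
  have "emeasure (distr (lborel \<Otimes>\<^sub>M lborel) borel (\<lambda>(x, y). Complex x y)) (box l u)
     = emeasure (lborel \<Otimes>\<^sub>M lborel) ({Re l <..< Re u} \<times> {Im l <..< Im u})"
    using m by (subst emeasure_distr) (auto simp: in_box_complex_iff space_pair_measure intro!: arg_cong2[where f=emeasure])
  also have "\<dots> = ennreal (Re u - Re l) * ennreal (Im u - Im l)"
    using lu' by (subst lborel.emeasure_pair_measure_Times) auto
  also have "\<dots> = (\<Prod>b\<in>Basis. inner (u - l) b)"
    using lu' by (simp add: Basis_complex_def ennreal_mult)
  finally show "emeasure (distr (lborel \<Otimes>\<^sub>M lborel) borel (\<lambda>(x, y). Complex x y)) (box l u)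
     = (\<Prod>b\<in>Basis. inner (u - l) b)" .
qed simp

lemma nn_integral_lborel_complex:
  fixes f :: "complex \<Rightarrow> ennreal"
  assumes [measurable]: "f \<in> borel_measurable borel"
  shows "(\<integral>\<^sup>+z. f z \<partial>lborel) = (\<integral>\<^sup>+x. \<integral>\<^sup>+y. f (Complex x y) \<partial>lborel \<partial>lborel)"
proof -
  have m[measurable]: "(\<lambda>(x, y). Complex x y) \<in> borel_measurable (lborel \<Otimes>\<^sub>M lborel)"
    by (simp add: Complex_eq split_beta)
  have "(\<integral>\<^sup>+z. f z \<partial>lborel) = (\<integral>\<^sup>+p. f (case p of (x, y) \<Rightarrow> Complex x y) \<partial>(lborel \<Otimes>\<^sub>M lborel))"
    by (subst lborel_complex_eq_distr, subst nn_integral_distr) auto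
  also have "\<dots> = (\<integral>\<^sup>+x. \<integral>\<^sup>+y. f (Complex x y) \<partial>lborel \<partial>lborel)"
    by (subst lborel.nn_integral_fst[symmetric]) auto
  finally show ?thesis .
qed

lemma nn_integral_lborel_shift:
  fixes f :: "real \<Rightarrow> ennreal"
  assumes [measurable]: "f \<in> borel_measurable borel"
  shows "(\<integral>\<^sup>+x. f (x + c) \<partial>lborel) = (\<integral>\<^sup>+x. f x \<partial>lborel)"
  using nn_integral_real_affine[of f 1 c] by (simp add: add.commute)

lemma nn_integral_lborel_shear:
  fixes f :: "complex \<Rightarrow> ennreal"
  assumes [measurable]: "f \<in> borel_measurable borel"
  shows "(\<integral>\<^sup>+z. f (Complex (Re z + t * Im z) (Im z)) \<partial>lborel) = (\<integral>\<^sup>+z. f z \<partial>lborel)"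
    and "(\<integral>\<^sup>+z. f (Complex (Re z) (Im z + t * Re z)) \<partial>lborel) = (\<integral>\<^sup>+z. f z \<partial>lborel)"
proof -
  have [measurable]: "(\<lambda>(x, y). Complex x y) \<in> borel_measurable (lborel \<Otimes>\<^sub>M lborel)"
    by (simp add: Complex_eq split_beta)
  have [measurable]: "(\<lambda>(x, y). f (Complex (x + t * y) y)) \<in> borel_measurable (lborel \<Otimes>\<^sub>M lborel)"
    "(\<lambda>z. f (Complex (Re z + t * Im z) (Im z))) \<in> borel_measurable borel"
    "(\<lambda>z. f (Complex (Re z) (Im z + t * Re z))) \<in> borel_measurable borel"
    "\<And>x. (\<lambda>y. f (Complex x y)) \<in> borel_measurable borel"
    "\<And>y. (\<lambda>x. f (Complex x y)) \<in> borel_measurable borel"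
    "(\<lambda>(x, y). f (Complex x y)) \<in> borel_measurable (lborel \<Otimes>\<^sub>M lborel)"
    by (simp_all add: Complex_eq split_beta)
  have "(\<integral>\<^sup>+z. f (Complex (Re z + t * Im z) (Im z)) \<partial>lborel)
     = (\<integral>\<^sup>+x. \<integral>\<^sup>+y. f (Complex (x + t * y) y) \<partial>lborel \<partial>lborel)"
    by (subst nn_integral_lborel_complex) auto
  also have "\<dots> = (\<integral>\<^sup>+y. \<integral>\<^sup>+x. f (Complex (x + t * y) y) \<partial>lborel \<partial>lborel)"
    by (rule lborel_pair.Fubini') simp
  also have "\<dots> = (\<integral>\<^sup>+y. \<integral>\<^sup>+x. f (Complex x y) \<partial>lborel \<partial>lborel)"
    by (intro nn_integral_cong nn_integral_lborel_shift) auto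
  also have "\<dots> = (\<integral>\<^sup>+x. \<integral>\<^sup>+y. f (Complex x y) \<partial>lborel \<partial>lborel)"
    by (rule lborel_pair.Fubini'[symmetric]) simp
  finally show "(\<integral>\<^sup>+z. f (Complex (Re z + t * Im z) (Im z)) \<partial>lborel) = (\<integral>\<^sup>+z. f z \<partial>lborel)"
    by (simp add: nn_integral_lborel_complex[of f])
  have "(\<integral>\<^sup>+z. f (Complex (Re z) (Im z + t * Re z)) \<partial>lborel)
     = (\<integral>\<^sup>+x. \<integral>\<^sup>+y. f (Complex x (y + t * x)) \<partial>lborel \<partial>lborel)"
    by (subst nn_integral_lborel_complex) auto
  also have "\<dots> = (\<integral>\<^sup>+x. \<integral>\<^sup>+y. f (Complex x y) \<partial>lborel \<partial>lborel)"
    by (intro nn_integral_cong nn_integral_lborel_shift) auto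
  finally show "(\<integral>\<^sup>+z. f (Complex (Re z) (Im z + t * Re z)) \<partial>lborel) = (\<integral>\<^sup>+z. f z \<partial>lborel)"
    by (simp add: nn_integral_lborel_complex[of f])
qed

text \<open>A rotation is a product of three shears, with parameters \<open>- tan (\<theta> /
  2)\<close>, \<open>sin \<theta>\<close> and \<open>- tan (\<theta> / 2)\<close>; each shear
  preserves planar measure by Fubini and translation invariance on a line.\<close>

lemma nn_integral_lborel_rotate_by_shears:
  fixes f :: "complex \<Rightarrow> ennreal"
  assumes [measurable]: "f \<in> borel_measurable borel" and c: "cos (\<theta> / 2) \<noteq> 0"
  shows "(\<integral>\<^sup>+z. f (cis \<theta> * z) \<partial>lborel) = (\<integral>\<^sup>+z. f z \<partial>lborel)"
proof -
  define t where "t = - tan (\<theta> / 2)"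
  define s where "s = sin \<theta>"
  let ?A = "\<lambda>z. Complex (Re z + t * Im z) (Im z)" and ?B = "\<lambda>z. Complex (Re z) (Im z + s * Re z)"
  have s: "s = 2 * sin (\<theta>/2) * cos (\<theta>/2)" using sin_double[of "\<theta>/2"] by (simp add: s_def)
  have co: "cos \<theta> = 1 - 2 * (sin (\<theta>/2))\<^sup>2" using cos_double_sin[of "\<theta>/2"] by simp
  have a: "1 + t * s = cos \<theta>"
    using c by (simp add: t_def tan_def s co power2_eq_square field_simps)
  have b: "2 * t + t * t * s = - sin \<theta>"
  proof -
    have "2 * t + t * t * s = t * (1 + (1 + t * s))" by (simp add: algebra_simps)
    also have "\<dots> = t * (2 * (cos (\<theta>/2))\<^sup>2)"
      using cos_double_cos[of "\<theta>/2"] by (simp only: a) simp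
    also have "\<dots> = - sin \<theta>"
      using c by (simp add: t_def tan_def s_def[symmetric] s power2_eq_square field_simps)
    finally show ?thesis .
  qed
  have "cis \<theta> * z = ?A (?B (?A z))" for z
  proof (rule complex_eqI)
    have "Re (?A (?B (?A z))) = (1 + t * s) * Re z + (2 * t + t * t * s) * Im z"
      by (simp add: algebra_simps)
    then show "Re (cis \<theta> * z) = Re (?A (?B (?A z)))" by (simp add: a b)
    have "Im (?A (?B (?A z))) = (1 + t * s) * Im z + s * Re z"
      by (simp add: algebra_simps)
    then show "Im (cis \<theta> * z) = Im (?A (?B (?A z)))" by (simp only: a) (simp add: s_def)
  qed
  then have "(\<integral>\<^sup>+z. f (cis \<theta> * z) \<partial>lborel) = (\<integral>\<^sup>+z. f (?A (?B (?A z))) \<partial>lborel)" by simp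
  also have "\<dots> = (\<integral>\<^sup>+z. f (?A (?B z)) \<partial>lborel)"
    by (rule nn_integral_lborel_shear(1)[of "\<lambda>z. f (?A (?B z))"]) (simp add: Complex_eq)
  also have "\<dots> = (\<integral>\<^sup>+z. f (?A z) \<partial>lborel)"
    by (rule nn_integral_lborel_shear(2)[of "\<lambda>z. f (?A z)"]) (simp add: Complex_eq)
  also have "\<dots> = (\<integral>\<^sup>+z. f z \<partial>lborel)"
    by (rule nn_integral_lborel_shear(1)) simp
  finally show ?thesis .
qed

text \<open>The shear decomposition degenerates only for rotations by an odd multiple of
  \<open>\<pi>\<close>, which are performed as two rotations by half the angle.\<close>

lemma nn_integral_lborel_rotate:
  fixes f :: "complex \<Rightarrow> ennreal"
  assumes [measurable]: "f \<in> borel_measurable borel"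
  shows "(\<integral>\<^sup>+z. f (cis \<theta> * z) \<partial>lborel) = (\<integral>\<^sup>+z. f z \<partial>lborel)"
proof (cases "cos (\<theta> / 2) = 0")
  case True
  then have "cos (\<theta> / 2 / 2) \<noteq> 0"
    using cos_double_cos[of "\<theta>/2/2"] by auto
  note half = nn_integral_lborel_rotate_by_shears[OF _ this]
  have "(\<integral>\<^sup>+z. f (cis \<theta> * z) \<partial>lborel) = (\<integral>\<^sup>+z. f (cis (\<theta>/2) * (cis (\<theta>/2) * z)) \<partial>lborel)"
    by (simp add: mult.assoc[symmetric] cis_mult)
  also have "\<dots> = (\<integral>\<^sup>+z. f (cis (\<theta>/2) * z) \<partial>lborel)"
    by (rule half[of "\<lambda>z. f (cis (\<theta>/2) * z)"]) simp
  also have "\<dots> = (\<integral>\<^sup>+z. f z \<partial>lborel)" by (rule half) simp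
  finally show ?thesis .
qed (rule nn_integral_lborel_rotate_by_shears; simp)

definition cgauss :: "complex measure" where
  "cgauss = density lborel (\<lambda>z. ennreal (std_complex_normal_density z))"

lemma std_complex_normal_density_measurable [measurable]:
  "std_complex_normal_density \<in> borel_measurable borel"
  unfolding std_complex_normal_density_def[abs_def] by measurable

lemma sets_cgauss [simp, measurable_cong]: "sets cgauss = sets borel"
  and space_cgauss [simp]: "space cgauss = UNIV"
  by (simp_all add: cgauss_def)

lemma std_complex_normal_density_nonneg [simp]: "0 \<le> std_complex_normal_density z"
  by (simp add: std_complex_normal_density_def)

lemma nn_integral_normal_density: "0 < \<sigma> \<Longrightarrow> (\<integral>\<^sup>+x. ennreal (normal_density \<mu> \<sigma> x) \<partial>lborel) = 1"
  by (subst nn_integral_eq_integral) (auto simp: integral_normal_density)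

lemma nn_integral_normal_density_prod:
  assumes "0 < \<sigma>"
  shows "(\<integral>\<^sup>+z. ennreal (normal_density 0 \<sigma> (Re z) * normal_density 0 \<sigma> (Im z)) \<partial>lborel) = 1"
  using assms
  by (subst nn_integral_lborel_complex)
     (simp_all add: ennreal_mult nn_integral_cmult nn_integral_normal_density nn_integral_multc)

lemma prob_space_cgauss: "prob_space cgauss"
proof
  have "emeasure cgauss (space cgauss) = (\<integral>\<^sup>+z. ennreal (std_complex_normal_density z) \<partial>lborel)"
    unfolding cgauss_def by (subst emeasure_density) auto
  also have "\<dots> = 1"
    unfolding std_complex_normal_density_eq by (rule nn_integral_normal_density_prod) simp
  finally show "emeasure cgauss (space cgauss) = 1" .
qed

lemma nn_integral_cgauss:
  assumes [measurable]: "f \<in> borel_measurable borel"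
  shows "(\<integral>\<^sup>+z. f z \<partial>cgauss) = (\<integral>\<^sup>+z. ennreal (std_complex_normal_density z) * f z \<partial>lborel)"
  unfolding cgauss_def by (subst nn_integral_density) auto

lemma nn_integral_cgauss_rotate:
  fixes f :: "complex \<Rightarrow> ennreal"
  assumes [measurable]: "f \<in> borel_measurable borel"
  shows "(\<integral>\<^sup>+z. f (cis \<theta> * z) \<partial>cgauss) = (\<integral>\<^sup>+z. f z \<partial>cgauss)"
proof -
  have "(\<integral>\<^sup>+z. f (cis \<theta> * z) \<partial>cgauss)
      = (\<integral>\<^sup>+z. ennreal (std_complex_normal_density (cis \<theta> * z)) * f (cis \<theta> * z) \<partial>lborel)"
    by (subst nn_integral_cgauss) (simp_all add: std_complex_normal_density_def norm_mult)
  also have "\<dots> = (\<integral>\<^sup>+z. f z \<partial>cgauss)"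
    by (subst nn_integral_lborel_rotate[of "\<lambda>z. ennreal (std_complex_normal_density z) * f z"])
       (simp_all add: nn_integral_cgauss)
  finally show ?thesis .
qed

text \<open>The true value is 1; the crude constant 4 comes from comparing the density with that of
  a wider Gaussian, using \<open>x * exp (- x) \<le> 2 * exp (- x / 2)\<close>, and avoids computing
  a moment.\<close>

lemma nn_integral_cgauss_norm_square: "(\<integral>\<^sup>+z. ennreal ((cmod z)\<^sup>2) \<partial>cgauss) \<le> 4"
proof -
  have "std_complex_normal_density z * (cmod z)\<^sup>2
      \<le> 4 * (normal_density 0 1 (Re z) * normal_density 0 1 (Im z))" for z
  proof -
    define x where "x = (cmod z)\<^sup>2"
    have nd: "normal_density 0 1 (Re z) * normal_density 0 1 (Im z) = exp (- x / 2) / (2 * pi)"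
      by (simp add: normal_density_def x_def cmod_power2 mult_exp_exp field_simps
          flip: power2_eq_square real_sqrt_mult)
    have "x \<le> 2 * exp (x / 2)" using exp_ge_add_one_self[of "x/2"] by linarith
    then have "exp (- x / 2) * x \<le> exp (- x / 2) * (2 * exp (x / 2))" by simp
    then have "exp (- x / 2) * x \<le> 2" by (simp add: mult.left_commute flip: exp_add)
    then have "exp (- x / 2) * (exp (- x / 2) * x) \<le> exp (- x / 2) * 2" by (intro mult_left_mono) auto
    moreover have "exp (- x) = exp (- x / 2) * exp (- x / 2)" by (simp flip: exp_add)
    ultimately have "exp (- x) * x \<le> 2 * exp (- x / 2)" by simp
    then show ?thesis unfolding nd
      by (simp add: std_complex_normal_density_def x_def[symmetric] field_simps)
  qed
  then have "(\<integral>\<^sup>+z. ennreal ((cmod z)\<^sup>2) \<partial>cgauss)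
     \<le> (\<integral>\<^sup>+z. 4 * ennreal (normal_density 0 1 (Re z) * normal_density 0 1 (Im z)) \<partial>lborel)"
    by (subst nn_integral_cgauss) (auto intro!: nn_integral_mono simp flip: ennreal_mult'' ennreal_numeral)
  also have "\<dots> = 4"
    by (subst nn_integral_cmult) (simp_all add: nn_integral_normal_density_prod)
  finally show ?thesis .
qed

text \<open>Since \<open>\<bar>z\<bar> \<ge> \<bar>Re z\<bar>\<close>, the integral is at most that
  of \<open>\<bar>x\<bar> powr (-1/2)\<close> over a square, which is a one-dimensional integral.
  The inverse square root serves as an integrable majorant of logarithmic singularities.\<close>

lemma nn_integral_inv_sqrt_finite:
  "(\<integral>\<^sup>+z. ennreal (cmod z powr (-1/2)) * indicator (cball 0 1) z \<partial>lborel) < \<infinity>"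
proof -
  have [measurable]: "cball (0::complex) 1 \<in> sets borel" by simp
  have I: "(\<integral>\<^sup>+x. ennreal (x powr (-1/2)) * indicator {0..1} x \<partial>lborel) = ennreal 2"
  proof -
    have "((\<lambda>x::real. x powr (-1/2)) has_integral 2) {0..1}"
      using has_integral_powr_from_0[of "-1/2" 1] by simp
    then show ?thesis
      by (intro nn_integral_has_integral_lebesgue') auto
  qed
  have I': "(\<integral>\<^sup>+x. ennreal (\<bar>x\<bar> powr (-1/2)) * indicator {-1..1} x \<partial>lborel) \<le> 4"
  proof -
    have "(\<integral>\<^sup>+x. ennreal (\<bar>x\<bar> powr (-1/2)) * indicator {-1..1} x \<partial>lborel)
      \<le> (\<integral>\<^sup>+x. ennreal (x powr (-1/2)) * indicator {0..1} x
             + ennreal ((- x) powr (-1/2)) * indicator {0..1} (- x) \<partial>lborel)"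
      by (intro nn_integral_mono) (auto simp: indicator_def abs_if)
    also have "\<dots> = 2 + (\<integral>\<^sup>+x. ennreal ((- x) powr (-1/2)) * indicator {0..1} (- x) \<partial>lborel)"
      by (subst nn_integral_add) (auto simp: I[simplified])
    also have "(\<integral>\<^sup>+x. ennreal ((- x) powr (-1/2)) * indicator {0..1} (- x) \<partial>lborel) = 2"
      using nn_integral_real_affine[of "\<lambda>x. ennreal (x powr (-1/2)) * indicator {0..1} x" "-1" 0]
      using I by simp
    finally show ?thesis by simp
  qed
  have "(\<integral>\<^sup>+z. ennreal (cmod z powr (-1/2)) * indicator (cball 0 1) z \<partial>lborel)
     = (\<integral>\<^sup>+x. \<integral>\<^sup>+y. ennreal (cmod (Complex x y) powr (-1/2)) * indicator (cball 0 1) (Complex x y) \<partial>lborel \<partial>lborel)"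
    by (rule nn_integral_lborel_complex) measurable
  also have "\<dots> \<le> (\<integral>\<^sup>+x. \<integral>\<^sup>+y. (ennreal (\<bar>x\<bar> powr (-1/2)) * indicator {-1..1} x) * indicator {-1..1::real} y \<partial>lborel \<partial>lborel)"
  proof (rule nn_integral_mono_AE)
    have "AE x in lborel. x \<noteq> (0::real)" by (rule AE_lborel_singleton)
    then show "AE x in (lborel :: real measure). (\<integral>\<^sup>+y. ennreal (cmod (Complex x y) powr (-1/2)) * indicator (cball 0 1) (Complex x y) \<partial>lborel)
      \<le> (\<integral>\<^sup>+y. (ennreal (\<bar>x\<bar> powr (-1/2)) * indicator {-1..1} x) * indicator {-1..1::real} y \<partial>lborel)"
    proof eventually_elim
      case (elim x)
      show ?case
      proof (rule nn_integral_mono)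
      fix y :: real
      have x: "x \<noteq> 0" by fact
      have 1: "\<bar>x\<bar> \<le> cmod (Complex x y)" "\<bar>y\<bar> \<le> cmod (Complex x y)"
        using abs_Re_le_cmod[of "Complex x y"] abs_Im_le_cmod[of "Complex x y"] by auto
      have "cmod (Complex x y) powr (-1/2) \<le> \<bar>x\<bar> powr (-1/2)"
        using x 1 by (intro powr_mono2') auto
      then show "ennreal (cmod (Complex x y) powr (-1/2)) * indicator (cball 0 1) (Complex x y)
        \<le> (ennreal (\<bar>x\<bar> powr (-1/2)) * indicator {-1..1} x) * indicator {-1..1::real} y"
        using 1 by (auto simp: indicator_def ennreal_leI)
      qed
    qed
  qed
  also have "\<dots> = (\<integral>\<^sup>+x. (ennreal (\<bar>x\<bar> powr (-1/2)) * indicator {-1..1} x) * 2 \<partial>lborel)"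
    by (intro nn_integral_cong, subst nn_integral_cmult) auto
  also have "\<dots> = (\<integral>\<^sup>+x. (ennreal (\<bar>x\<bar> powr (-1/2)) * indicator {-1..1} x) \<partial>lborel) * 2"
    by (rule nn_integral_multc) simp
  also have "\<dots> \<le> 4 * 2" using I' by (intro mult_right_mono) auto
  also have "\<dots> < \<infinity>" by (simp add: ennreal_mult_less_top)
  finally show ?thesis .
qed

definition inv_sqrt_mass :: real where
  "inv_sqrt_mass = enn2real (\<integral>\<^sup>+z. ennreal (cmod z powr (-1/2)) * indicator (cball 0 1) z \<partial>lborel)"

lemma nn_integral_inv_sqrt_mass:
  "(\<integral>\<^sup>+z. ennreal (cmod z powr (-1/2)) * indicator (cball 0 1) z \<partial>lborel) = ennreal inv_sqrt_mass"
  unfolding inv_sqrt_mass_def using nn_integral_inv_sqrt_finite by simp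

lemma nn_integral_lborel_complex_shift:
  fixes f :: "complex \<Rightarrow> ennreal"
  assumes [measurable]: "f \<in> borel_measurable borel"
  shows "(\<integral>\<^sup>+z. f (z + c) \<partial>lborel) = (\<integral>\<^sup>+z. f z \<partial>lborel)"
proof -
  have "(\<integral>\<^sup>+z. f z \<partial>lborel) = (\<integral>\<^sup>+z. f z \<partial>distr lborel borel ((+) c))"
    by (simp add: lborel_distr_plus)
  also have "\<dots> = (\<integral>\<^sup>+z. f (z + c) \<partial>lborel)" by (subst nn_integral_distr) (auto simp: add.commute)
  finally show ?thesis by simp
qed

text \<open>The bound is uniform in the position \<open>a\<close> of the singularity: it applies to
  all eigenvalues at once.\<close>

lemma nn_integral_inv_sqrt_le:
  fixes S :: "complex set"
  assumes [measurable]: "S \<in> sets borel"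
  shows "(\<integral>\<^sup>+z. ennreal (cmod (z - a) powr (-1/2)) * indicator S z \<partial>lborel)
    \<le> emeasure lborel S + ennreal inv_sqrt_mass"
proof -
  have [measurable]: "cball (0::complex) 1 \<in> sets borel" by simp
  have [measurable]: "(\<lambda>z. indicator (cball 0 1) (z - a) :: ennreal) \<in> borel_measurable borel"
    by (rule measurable_compose[of "\<lambda>z. z - a" borel borel "indicator (cball 0 1)"])
       (simp, intro borel_measurable_indicator, simp)
  have "(\<integral>\<^sup>+z. ennreal (cmod (z - a) powr (-1/2)) * indicator S z \<partial>lborel)
     \<le> (\<integral>\<^sup>+z. indicator S z + ennreal (cmod (z - a) powr (-1/2)) * indicator (cball 0 1) (z - a) \<partial>lborel)"
  proof (rule nn_integral_mono)
    fix z
    show "ennreal (cmod (z - a) powr (-1/2)) * indicator S z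
      \<le> indicator S z + ennreal (cmod (z - a) powr (-1/2)) * indicator (cball 0 1) (z - a)"
    proof (cases "cmod (z - a) \<le> 1")
      case False
      then have "cmod (z - a) powr (-1/2) \<le> 1"
        using powr_mono2'[of "-1/2" 1 "cmod (z - a)"] by simp
      then have "ennreal (cmod (z - a) powr (-1/2)) * indicator S z \<le> 1 * indicator S z"
        by (intro mult_right_mono) auto
      then show ?thesis by (simp add: add_increasing2)
    qed (auto simp: indicator_def add_increasing)
  qed
  also have "\<dots> = emeasure lborel S + (\<integral>\<^sup>+z. ennreal (cmod (z - a) powr (-1/2)) * indicator (cball 0 1) (z - a) \<partial>lborel)"
    by (subst nn_integral_add) auto
  also have "(\<integral>\<^sup>+z. ennreal (cmod (z - a) powr (-1/2)) * indicator (cball 0 1) (z - a) \<partial>lborel)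
     = ennreal inv_sqrt_mass"
    using nn_integral_lborel_complex_shift[of "\<lambda>z. ennreal (cmod z powr (-1/2)) * indicator (cball 0 1) z" "- a"]
    using nn_integral_inv_sqrt_mass by simp
  finally show ?thesis .
qed

section \<open>Circle means of logarithms and subharmonicity\<close>

text \<open>The real part of the mean value property, in the form of Cauchy's integral formula, for
  the holomorphic function \<open>Ln (1 - w * z)\<close> on the closed unit disc.\<close>

lemma circle_mean_ln_one_minus:
  assumes w: "cmod w < 1"
  shows "((\<lambda>t. ln (cmod (1 - w * cis (2 * pi * t)))) has_integral 0) {0..1}"
proof -
  let ?h = "\<lambda>z. Ln (1 - w * z)"
  have pos: "Re (1 - w * z) > 0" if "cmod z \<le> 1" for z
  proof -
    have "cmod (w * z) < 1" using that w by (simp add: norm_mult) (smt (verit) mult_left_le norm_ge_zero)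
    then have "Re (w * z) < 1" using complex_Re_le_cmod[of "w * z"] by linarith
    then show ?thesis by simp
  qed
  have "?h holomorphic_on cball 0 1"
    using pos by (intro holomorphic_intros) (fastforce simp: complex_nonpos_Reals_iff)
  then have "((\<lambda>u. ?h u / (u - 0)) has_contour_integral (2 * of_real pi * \<i> * ?h 0)) (circlepath 0 1)"
    by (rule Cauchy_integral_circlepath_simple) simp
  then have "((\<lambda>x. ?h (circlepath 0 1 x) / circlepath 0 1 x * vector_derivative (circlepath 0 1) (at x within {0..1}))
     has_integral 0) {0..1}"
    by (simp add: has_contour_integral_def)
  then have "((\<lambda>x. 2 * of_real pi * \<i> * ?h (cis (2 * pi * x))) has_integral 0) {0..1}"
  proof (rule has_integral_eq[rotated])
    fix x :: real assume "x \<in> {0..1}"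
    then have "vector_derivative (circlepath 0 1) (at x within {0..1}) = 2 * of_real pi * \<i> * cis (2 * pi * x)"
      by (simp add: vector_derivative_circlepath01 cis_conv_exp mult_ac)
    moreover have "circlepath 0 1 x = cis (2 * pi * x)" by (simp add: circlepath cis_conv_exp mult_ac)
    ultimately show "?h (circlepath 0 1 x) / circlepath 0 1 x * vector_derivative (circlepath 0 1) (at x within {0..1})
      = 2 * of_real pi * \<i> * ?h (cis (2 * pi * x))" by simp
  qed
  then have "((\<lambda>x. (1 / (2 * of_real pi * \<i>)) * (2 * of_real pi * \<i> * ?h (cis (2 * pi * x)))) has_integral
      (1 / (2 * of_real pi * \<i>)) * 0) {0..1}"
    by (rule has_integral_mult_right)
  then have "((\<lambda>x. ?h (cis (2 * pi * x))) has_integral 0) {0..1}" by simp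
  then have "((Re \<circ> (\<lambda>x. ?h (cis (2 * pi * x)))) has_integral Re 0) {0..1}"
    by (rule has_integral_linear) (rule bounded_linear_Re)
  moreover have "(Re \<circ> (\<lambda>x. ?h (cis (2 * pi * x)))) = (\<lambda>t. ln (cmod (1 - w * cis (2 * pi * t))))"
  proof
    fix t :: real
    have "1 - w * cis (2 * pi * t) \<noteq> 0"
      using pos[of "cis (2 * pi * t)"] norm_cis by (metis less_irrefl order_refl zero_complex.simps(1))
    then show "(Re \<circ> (\<lambda>x. ?h (cis (2 * pi * x)))) t = ln (cmod (1 - w * cis (2 * pi * t)))"
      by (simp add: Re_Ln)
  qed
  ultimately show ?thesis by simp
qed

text \<open>Jensen's formula for a linear polynomial: factor out the larger of \<open>a\<close> and
  \<open>b * cis t\<close>; the other factor has the form \<open>1 - w * cis t\<close> up to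
  conjugation and a unimodular factor.\<close>

lemma circle_mean_ln:
  assumes "cmod a \<noteq> cmod b"
  shows "((\<lambda>t. ln (cmod (a + b * cis (2 * pi * t)))) has_integral ln (max (cmod a) (cmod b))) {0..1}"
proof (cases "cmod b < cmod a")
  case True
  then have a: "a \<noteq> 0" by auto
  let ?w = "- b / a"
  have w: "cmod ?w < 1" using True by (simp add: norm_divide divide_less_eq)
  have "((\<lambda>t. ln (cmod a) + ln (cmod (1 - ?w * cis (2 * pi * t)))) has_integral ln (cmod a) + 0) {0..1}"
    using circle_mean_ln_one_minus[OF w] has_integral_const_real[of "ln (cmod a)" 0 1] by (intro has_integral_add) simp_all
  moreover have "ln (cmod a) + ln (cmod (1 - ?w * cis (2 * pi * t))) = ln (cmod (a + b * cis (2 * pi * t)))" for t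
  proof -
    have "cmod (?w * cis (2 * pi * t)) < 1" using w by (simp only: norm_mult norm_cis mult_1_right)
    then have "1 - ?w * cis (2 * pi * t) \<noteq> 0" by (metis eq_iff_diff_eq_0 less_irrefl norm_one)
    moreover have "a + b * cis (2 * pi * t) = a * (1 - ?w * cis (2 * pi * t))" using a by (simp add: field_simps)
    ultimately show ?thesis using a by (simp only: norm_mult) (simp add: ln_mult)
  qed
  ultimately show ?thesis using True by (simp add: max_def)
next
  case False
  with assms have lt: "cmod a < cmod b" by simp
  then have b: "b \<noteq> 0" by auto
  \<comment> \<open>Here \<open>a + b * c = b * c * (1 + (a / b) * cnj c)\<close> for
    \<open>\<bar>c\<bar> = 1\<close>, and conjugation does not affect the modulus.\<close>
  let ?w = "- cnj (a / b)"
  have w: "cmod ?w < 1" using lt by (simp add: norm_divide divide_less_eq)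
  have "((\<lambda>t. ln (cmod b) + ln (cmod (1 - ?w * cis (2 * pi * t)))) has_integral ln (cmod b) + 0) {0..1}"
    using circle_mean_ln_one_minus[OF w] has_integral_const_real[of "ln (cmod b)" 0 1] by (intro has_integral_add) simp_all
  moreover have "ln (cmod b) + ln (cmod (1 - ?w * cis (2 * pi * t))) = ln (cmod (a + b * cis (2 * pi * t)))" for t
  proof -
    let ?c = "cis (2 * pi * t)"
    have "cmod (?w * ?c) < 1" using w by (simp only: norm_mult norm_cis mult_1_right)
    then have nz: "1 - ?w * ?c \<noteq> 0" by (metis eq_iff_diff_eq_0 less_irrefl norm_one)
    have "cmod (1 - ?w * ?c) = cmod (cnj (1 - ?w * ?c))" by (rule complex_mod_cnj[symmetric])
    also have "cnj (1 - ?w * ?c) = 1 + a / b * cnj ?c" by simp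
    also have "cmod (1 + a / b * cnj ?c) = cmod (?c * (1 + a / b * cnj ?c))" by (simp add: norm_mult)
    also have "?c * (1 + a / b * cnj ?c) = ?c + a / b"
      by (simp add: algebra_simps cis_cnj cis_mult)
    finally have "cmod b * cmod (1 - ?w * ?c) = cmod (b * (?c + a / b))" by (simp add: norm_mult)
    also have "b * (?c + a / b) = a + b * ?c" using b by (simp add: field_simps)
    finally have "ln (cmod b * cmod (1 - ?w * ?c)) = ln (cmod (a + b * ?c))" by (rule arg_cong)
    moreover have "ln (cmod b * cmod (1 - ?w * ?c)) = ln (cmod b) + ln (cmod (1 - ?w * ?c))"
      using b nz by (intro ln_mult_pos) (simp_all only: zero_less_norm_iff, simp_all)
    ultimately show ?thesis by simp
  qed
  ultimately show ?thesis using lt by (simp add: max_def)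
qed

text \<open>The positive part of the logarithm. Being nonnegative and finite it has an expectation
  in \<open>[0, \<infinity>]\<close> without any integrability assumption, and it differs from
  \<open>ln\<close> only where its argument is below 1; multiplying the argument by \<open>exp
  k\<close> with \<open>k\<close> large moves that region to a neighbourhood of 0.\<close>

definition lnp :: "real \<Rightarrow> real" where "lnp x = ln (max 1 x)"

lemma lnp_nonneg [simp]: "0 \<le> lnp x"
  by (simp add: lnp_def)

lemma lnp_mono: "x \<le> y \<Longrightarrow> lnp x \<le> lnp y"
  by (simp add: lnp_def)

lemma lnp_measurable [measurable]: "lnp \<in> borel_measurable borel"
  unfolding lnp_def[abs_def] by measurable

lemma lnp_mult_le: "1 \<le> y \<Longrightarrow> 0 \<le> x \<Longrightarrow> lnp (x * y) \<le> lnp x + ln y"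
proof -
  assume y: "1 \<le> y" and x: "0 \<le> x"
  have "max 1 (x * y) \<le> max 1 x * y"
    using x y by (auto simp: max_def intro: order.trans[OF y])
  then have "lnp (x * y) \<le> ln (max 1 x * y)" unfolding lnp_def using y by (subst ln_le_cancel_iff) auto
  also have "\<dots> = lnp x + ln y" unfolding lnp_def using y by (subst ln_mult) auto
  finally show ?thesis .
qed

lemma lnp_lipschitz: "lnp x \<le> lnp y + \<bar>x - y\<bar>"
proof -
  let ?a = "max 1 x" and ?b = "max 1 y"
  have "ln ?a - ln ?b = ln (?a / ?b)" by (subst ln_div) auto
  also have "\<dots> \<le> ?a / ?b - 1" by (rule ln_le_minus_one) auto
  also have "\<dots> = (?a - ?b) / ?b" by (simp add: field_simps max_def)
  also have "\<dots> \<le> \<bar>?a - ?b\<bar> / 1" by (intro frac_le) auto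
  also have "\<dots> \<le> \<bar>x - y\<bar>" by (auto simp: max_def)
  finally show ?thesis by (simp add: lnp_def)
qed

lemma lnp_continuous_on [continuous_intros]:
  "continuous_on S f \<Longrightarrow> continuous_on S (\<lambda>x. lnp (f x))"
  unfolding lnp_def by (intro continuous_intros) auto

text \<open>The mean dominates both 0 and the mean of \<open>ln\<close>.\<close>

lemma circle_mean_lnp_off_circle:
  assumes "cmod a \<noteq> cmod b"
  shows "lnp (max (cmod a) (cmod b)) \<le> integral {0..1} (\<lambda>t. lnp (cmod (a + b * cis (2 * pi * t))))"
    (is "_ \<le> integral _ ?f")
proof -
  have c: "continuous_on {0..1} ?f" by (intro continuous_intros)
  have i: "?f integrable_on {0..1}" by (rule integrable_continuous_interval[OF c])
  have m: "max (cmod a) (cmod b) > 0" using assms by (metis less_max_iff_disj norm_eq_zero zero_less_norm_iff)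
  have "ln (max (cmod a) (cmod b)) \<le> integral {0..1} ?f"
  proof (rule has_integral_le[OF circle_mean_ln[OF assms] integrable_integral[OF i]])
    fix t
    show "ln (cmod (a + b * cis (2 * pi * t))) \<le> ?f t"
      by (cases "a + b * cis (2 * pi * t) = 0") (auto simp: lnp_def ln_le_cancel_iff)
  qed
  moreover have "0 \<le> integral {0..1} ?f" by (rule integral_nonneg[OF i]) simp
  ultimately show ?thesis using m by (auto simp: lnp_def max_def[of 1])
qed

text \<open>In contrast to \<open>ln\<close>, the function \<open>lnp\<close> is Lipschitz, so the
  case \<open>\<bar>a\<bar> = \<bar>b\<bar>\<close>, in which \<open>a + b * cis t\<close> may
  vanish, follows by shrinking \<open>b\<close> slightly.\<close>

lemma circle_mean_lnp:
  "ennreal (lnp (max (cmod a) (cmod b)))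
     \<le> (\<integral>\<^sup>+t. ennreal (lnp (cmod (a + b * cis (2 * pi * t)))) * indicator {0..1} t \<partial>lborel)"
proof -
  let ?f = "\<lambda>b t. lnp (cmod (a + b * cis (2 * pi * t)))"
  have i: "?f b integrable_on {0..1}" for b
    by (intro integrable_continuous_interval continuous_intros)
  have "lnp (max (cmod a) (cmod b)) \<le> integral {0..1} (?f b)"
  proof (cases "cmod a = cmod b \<and> b \<noteq> 0")
    case True
    show ?thesis
    proof (rule field_le_epsilon)
      fix e :: real assume e: "e > 0"
      \<comment> \<open>Shrinking \<open>b\<close> by the factor \<open>1 - s\<close> changes the
        integrand by at most \<open>e\<close>.\<close>
      define s where "s = min (1/2) (e / cmod b)"
      have s: "0 < s" "s < 1" "s * cmod b \<le> e" using True e by (auto simp: s_def min_def field_simps)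
      let ?b = "of_real (1 - s) * b"
      have nb: "cmod ?b = (1 - s) * cmod b" using s by (simp only: norm_mult norm_of_real)
      have ne: "cmod a \<noteq> cmod ?b" unfolding nb using True s by simp
      have "lnp (max (cmod a) (cmod b)) \<le> lnp (max (cmod a) (cmod ?b))"
        using True by (intro lnp_mono) auto
      also have "\<dots> \<le> integral {0..1} (?f ?b)" by (rule circle_mean_lnp_off_circle[OF ne])
      also have "\<dots> \<le> integral {0..1} (\<lambda>t. ?f b t + s * cmod b)"
      proof (rule integral_le[OF i integrable_add[OF i integrable_const_ivl]])
        fix t
        let ?c = "cis (2 * pi * t)"
        have "?f ?b t \<le> ?f b t + \<bar>cmod (a + ?b * ?c) - cmod (a + b * ?c)\<bar>" by (rule lnp_lipschitz)
        also have "\<bar>cmod (a + ?b * ?c) - cmod (a + b * ?c)\<bar> \<le> cmod ((a + ?b * ?c) - (a + b * ?c))"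
          by (rule norm_triangle_ineq3)
        also have "(a + ?b * ?c) - (a + b * ?c) = - of_real s * b * ?c" by (simp add: algebra_simps)
        also have "cmod \<dots> = s * cmod b" using s by (simp add: norm_mult)
        finally show "?f ?b t \<le> ?f b t + s * cmod b" by simp
      qed
      also have "\<dots> = integral {0..1} (?f b) + s * cmod b"
        by (subst integral_add[OF i integrable_const_ivl]) simp
      finally show "lnp (max (cmod a) (cmod b)) \<le> integral {0..1} (?f b) + e" using s by simp
    qed
  next
    case False
    show ?thesis
    proof (cases "cmod a = cmod b")
      case True
      with False show ?thesis by (simp add: lnp_def)
    qed (rule circle_mean_lnp_off_circle)
  qed
  then have "ennreal (lnp (max (cmod a) (cmod b))) \<le> ennreal (integral {0..1} (?f b))" by (rule ennreal_leI)
  also have "\<dots> = (\<integral>\<^sup>+t. ennreal (?f b t) * indicator {0..1} t \<partial>lborel)"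
    by (rule nn_integral_has_integral_lebesgue'[symmetric]) (simp_all add: integrable_integral[OF i])
  finally show ?thesis .
qed

lemma borel_measurable_cis_comp [measurable]: "(\<lambda>t. cis (2 * pi * t)) \<in> borel_measurable borel"
  by (intro borel_measurable_continuous_onI continuous_intros)

text \<open>By rotation invariance \<open>g\<close> may be replaced by \<open>cis t * g\<close>;
  averaging over \<open>t\<close> first brings in the circle mean.\<close>

lemma cgauss_lnp_max_le:
  "(\<integral>\<^sup>+g. ennreal (lnp (max (cmod a) (cmod (b * g)))) \<partial>cgauss)
    \<le> (\<integral>\<^sup>+g. ennreal (lnp (cmod (a + b * g))) \<partial>cgauss)"
proof -
  interpret G: prob_space cgauss by (rule prob_space_cgauss)
  interpret pair_sigma_finite lborel cgauss ..
  let ?F = "\<lambda>t g. ennreal (lnp (cmod (a + b * (cis (2 * pi * t) * g)))) * indicator {0..1} t"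
  have "(\<integral>\<^sup>+g. ennreal (lnp (max (cmod a) (cmod (b * g)))) \<partial>cgauss) \<le> (\<integral>\<^sup>+g. \<integral>\<^sup>+t. ?F t g \<partial>lborel \<partial>cgauss)"
  proof (rule nn_integral_mono)
    fix g
    show "ennreal (lnp (max (cmod a) (cmod (b * g)))) \<le> (\<integral>\<^sup>+t. ?F t g \<partial>lborel)"
      using circle_mean_lnp[of a "b * g"] by (simp add: mult_ac)
  qed
  also have "\<dots> = (\<integral>\<^sup>+t. \<integral>\<^sup>+g. ?F t g \<partial>cgauss \<partial>lborel)"
    by (rule Fubini') measurable
  also have "\<dots> = (\<integral>\<^sup>+t. (\<integral>\<^sup>+g. ennreal (lnp (cmod (a + b * g))) \<partial>cgauss) * indicator {0..1::real} t \<partial>lborel)"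
  proof (rule nn_integral_cong)
    fix t :: real
    have "(\<integral>\<^sup>+g. ?F t g \<partial>cgauss)
       = (\<integral>\<^sup>+g. ennreal (lnp (cmod (a + b * (cis (2 * pi * t) * g)))) \<partial>cgauss) * indicator {0..1::real} t"
      by (rule nn_integral_multc) measurable
    also have "(\<integral>\<^sup>+g. ennreal (lnp (cmod (a + b * (cis (2 * pi * t) * g)))) \<partial>cgauss)
       = (\<integral>\<^sup>+g. ennreal (lnp (cmod (a + b * g))) \<partial>cgauss)"
      by (rule nn_integral_cgauss_rotate) measurable
    finally show "(\<integral>\<^sup>+g. ?F t g \<partial>cgauss)
       = (\<integral>\<^sup>+g. ennreal (lnp (cmod (a + b * g))) \<partial>cgauss) * indicator {0..1::real} t" .
  qed
  also have "\<dots> = (\<integral>\<^sup>+g. ennreal (lnp (cmod (a + b * g))) \<partial>cgauss)"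
    by (simp add: nn_integral_cmult)
  finally show ?thesis .
qed

text \<open>Subharmonicity: adding centred rotation invariant noise does not decrease the
  expectation.\<close>

lemma cgauss_lnp_ge:
  "ennreal (lnp (cmod a)) \<le> (\<integral>\<^sup>+g. ennreal (lnp (cmod (a + b * g))) \<partial>cgauss)"
proof -
  interpret G: prob_space cgauss by (rule prob_space_cgauss)
  have "ennreal (lnp (cmod a)) = (\<integral>\<^sup>+g. ennreal (lnp (cmod a)) \<partial>cgauss)"
    using G.emeasure_space_1 by simp
  also have "\<dots> \<le> (\<integral>\<^sup>+g. ennreal (lnp (max (cmod a) (cmod (b * g)))) \<partial>cgauss)"
    by (intro nn_integral_mono ennreal_leI lnp_mono) simp
  also note cgauss_lnp_max_le
  finally show ?thesis .
qed

lemma AE_cgauss_nonzero: "AE g in cgauss. g \<noteq> 0"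
  unfolding cgauss_def by (subst AE_density) (auto intro: AE_mp[OF AE_lborel_singleton[of 0]])

definition entry_cost :: "real \<Rightarrow> real \<Rightarrow> ennreal" where
  "entry_cost D \<delta> = (\<integral>\<^sup>+g. ennreal (ln (2 + D / (\<delta> * cmod g))) \<partial>cgauss)"

text \<open>The shift \<open>\<Delta> * c\<close> and the noise \<open>c * \<delta> * g\<close>
  carry the same coefficient \<open>c\<close>. The shift is therefore at most \<open>D /
  (\<bar>\<delta>\<bar> * \<bar>g\<bar>)\<close> times the noise, and its logarithmic effect is
  bounded independently of \<open>a\<close> and \<open>c\<close>.\<close>

lemma cgauss_lnp_change:
  assumes D: "cmod \<Delta> \<le> D" and \<delta>: "\<delta> \<noteq> 0"
  shows "(\<integral>\<^sup>+g. ennreal (lnp (cmod (a + \<Delta> * c + c * \<delta> * g))) \<partial>cgauss)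
     \<le> (\<integral>\<^sup>+g. ennreal (lnp (cmod (a + c * \<delta> * g))) \<partial>cgauss) + entry_cost D (cmod \<delta>)"
proof -
  let ?K = "\<lambda>g. 2 + D / (cmod \<delta> * cmod g)"
  have D0: "D \<ge> 0" using D norm_ge_zero order.trans by blast
  have K1: "?K g \<ge> 1" for g using D0 by (simp add: add_increasing2)
  have "(\<integral>\<^sup>+g. ennreal (lnp (cmod (a + \<Delta> * c + c * \<delta> * g))) \<partial>cgauss)
     \<le> (\<integral>\<^sup>+g. ennreal (lnp (max (cmod a) (cmod (c * \<delta> * g)))) + ennreal (ln (?K g)) \<partial>cgauss)"
  proof (rule nn_integral_mono_AE, rule AE_mp[OF AE_cgauss_nonzero], intro AE_I2 impI)
    fix g :: complex assume g: "g \<noteq> 0"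
    let ?m = "max (cmod a) (cmod (c * \<delta> * g))"
    \<comment> \<open>The maximum \<open>?m\<close> dominates the noise, so the shift is at most
      \<open>?m * (?K g - 2)\<close>.\<close>
    have "cmod (\<Delta> * c) \<le> D * cmod c" using D by (simp add: norm_mult mult_right_mono)
    also have "\<dots> = cmod (c * \<delta> * g) * (D / (cmod \<delta> * cmod g))" using g \<delta> by (simp add: norm_mult)
    also have "\<dots> \<le> ?m * (D / (cmod \<delta> * cmod g))" using D0 by (intro mult_right_mono) auto
    finally have "cmod (\<Delta> * c) \<le> ?m * (D / (cmod \<delta> * cmod g))" .
    moreover have "cmod (a + \<Delta> * c + c * \<delta> * g) \<le> cmod a + cmod (\<Delta> * c) + cmod (c * \<delta> * g)"
      by (intro norm_triangle_le add_right_mono norm_triangle_ineq)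
    ultimately have "cmod (a + \<Delta> * c + c * \<delta> * g) \<le> ?m * ?K g" by (simp add: distrib_left)
    then have "lnp (cmod (a + \<Delta> * c + c * \<delta> * g)) \<le> lnp (?m * ?K g)" by (rule lnp_mono)
    also have "\<dots> \<le> lnp ?m + ln (?K g)" by (intro lnp_mult_le K1) (simp add: le_max_iff_disj)
    finally show "ennreal (lnp (cmod (a + \<Delta> * c + c * \<delta> * g))) \<le> ennreal (lnp ?m) + ennreal (ln (?K g))"
      using K1[of g] by (simp flip: ennreal_plus add: ennreal_leI)
  qed
  also have "\<dots> = (\<integral>\<^sup>+g. ennreal (lnp (max (cmod a) (cmod (c * \<delta> * g)))) \<partial>cgauss) + entry_cost D (cmod \<delta>)"
    unfolding entry_cost_def by (rule nn_integral_add) measurable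
  also have "\<dots> \<le> (\<integral>\<^sup>+g. ennreal (lnp (cmod (a + c * \<delta> * g))) \<partial>cgauss) + entry_cost D (cmod \<delta>)"
    by (intro add_right_mono cgauss_lnp_max_le)
  finally show ?thesis .
qed

text \<open>The singularity at \<open>g = 0\<close> enters only through \<open>ln (1 /
  \<bar>g\<bar>) \<le> 2 * \<bar>g\<bar> powr (-1/2)\<close>, which is integrable. The cost of a
  change is thus logarithmic in the ratio of the size of the change to the size of the
  noise.\<close>

lemma entry_cost_le:
  assumes D: "D \<ge> 0" and \<delta>: "\<delta> > 0"
  shows "entry_cost D \<delta> \<le> ennreal (ln (2 + D / \<delta>) + 2 * inv_sqrt_mass)"
proof -
  interpret G: prob_space cgauss by (rule prob_space_cgauss)
  let ?s = "\<lambda>g. ennreal (cmod g powr (-1/2)) * indicator (cball 0 1) g"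
  have [measurable]: "cball (0::complex) 1 \<in> sets borel" by simp
  have p: "2 + D / \<delta> > 0" using D \<delta> by (simp add: add_pos_nonneg)
  have l0: "ln (2 + D / \<delta>) \<ge> 0" using D \<delta> by (intro ln_ge_zero) (simp add: add_increasing2)
  have "entry_cost D \<delta> \<le> (\<integral>\<^sup>+g. ennreal (ln (2 + D / \<delta>)) + 2 * ?s g \<partial>cgauss)"
    unfolding entry_cost_def
  proof (rule nn_integral_mono_AE, rule AE_mp[OF AE_cgauss_nonzero], intro AE_I2 impI)
    fix g :: complex assume g: "g \<noteq> 0"
    let ?r = "cmod g"
    have r: "?r > 0" using g by simp
    show "ennreal (ln (2 + D / (\<delta> * ?r))) \<le> ennreal (ln (2 + D / \<delta>)) + 2 * ?s g"
    proof (cases "?r \<le> 1")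
      case True
      have "2 + D / (\<delta> * ?r) \<le> (2 + D / \<delta>) * (1 / ?r)"
        using r True by (simp add: field_simps)
      then have "ln (2 + D / (\<delta> * ?r)) \<le> ln ((2 + D / \<delta>) * (1 / ?r))"
        using D \<delta> r by (subst ln_le_cancel_iff) (auto intro!: add_pos_nonneg mult_pos_pos divide_pos_pos)
      also have "\<dots> = ln (2 + D / \<delta>) + ln (1 / ?r)"
        using p r by (intro ln_mult_pos) auto
      also have "ln (1 / ?r) = 2 * ln (?r powr (-1/2))"
        using r by (simp add: ln_div ln_powr)
      also have "ln (?r powr (-1/2)) \<le> ?r powr (-1/2)" using r ln_bound[of "?r powr (-1/2)"] by simp
      finally have "ln (2 + D / (\<delta> * ?r)) \<le> ln (2 + D / \<delta>) + 2 * ?r powr (-1/2)" by simp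
      then have "ennreal (ln (2 + D / (\<delta> * ?r))) \<le> ennreal (ln (2 + D / \<delta>)) + ennreal (2 * ?r powr (-1/2))"
        using l0 by (simp add: ennreal_leI flip: ennreal_plus)
      then show ?thesis using True by (simp add: ennreal_mult)
    next
      case False
      then have "D / (\<delta> * ?r) \<le> D / \<delta>"
        using D \<delta> r by (intro divide_left_mono mult_pos_pos) auto
      then have "ln (2 + D / (\<delta> * ?r)) \<le> ln (2 + D / \<delta>)"
        using D \<delta> by (subst ln_le_cancel_iff) (auto intro!: add_pos_nonneg)
      then show ?thesis by (simp add: add_increasing2 ennreal_leI)
    qed
  qed
  also have "\<dots> = ennreal (ln (2 + D / \<delta>)) + 2 * (\<integral>\<^sup>+g. ?s g \<partial>cgauss)"
    using G.emeasure_space_1 by (subst nn_integral_add) (auto simp: nn_integral_cmult)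
  also have "(\<integral>\<^sup>+g. ?s g \<partial>cgauss) \<le> (\<integral>\<^sup>+g. ?s g \<partial>lborel)"
  proof (subst nn_integral_cgauss, measurable, rule nn_integral_mono)
    fix g :: complex
    have "std_complex_normal_density g \<le> 1"
    proof -
      have "exp (- (cmod g)\<^sup>2) \<le> 1" by simp
      then have "exp (- (cmod g)\<^sup>2) \<le> pi" using pi_gt3 by linarith
      then show ?thesis by (simp add: std_complex_normal_density_def divide_le_eq)
    qed
    then have "ennreal (std_complex_normal_density g) * ?s g \<le> 1 * ?s g"
      by (intro mult_right_mono) (auto simp: ennreal_le_1)
    then show "ennreal (std_complex_normal_density g) * ?s g \<le> ?s g" by simp
  qed
  also have "\<dots> = ennreal inv_sqrt_mass" by (rule nn_integral_inv_sqrt_mass)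
  finally have "entry_cost D \<delta> \<le> ennreal (ln (2 + D / \<delta>)) + 2 * ennreal inv_sqrt_mass"
    by (simp add: add_left_mono mult_left_mono)
  also have "\<dots> = ennreal (ln (2 + D / \<delta>) + 2 * inv_sqrt_mass)"
    using l0 by (subst ennreal_plus) (auto simp: ennreal_mult inv_sqrt_mass_def)
  finally show ?thesis .
qed

text \<open>Functions of complex coordinates that are affine in each one separately; the determinant
  as a function of the matrix entries is the example of interest. Measurability is required along
  arbitrary measurable families of points, because some coordinates will be random and others
  fixed.\<close>

locale multiaffine =
  fixes F :: "('i \<Rightarrow> complex) \<Rightarrow> complex" and \<delta> :: complex
  assumes affine: "\<And>y i. \<exists>u c. \<forall>t. F (y(i := t)) = u + c * t"
    and meas: "\<And>(M :: ('i \<Rightarrow> complex) measure) h.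
      (\<And>i. (\<lambda>y. h y i) \<in> borel_measurable M) \<Longrightarrow> (\<lambda>y. F (h y)) \<in> borel_measurable M"
    and \<delta>: "\<delta> \<noteq> 0"
begin

definition noisy :: "'i set \<Rightarrow> ('i \<Rightarrow> complex) \<Rightarrow> ('i \<Rightarrow> complex) \<Rightarrow> 'i \<Rightarrow> complex" where
  "noisy J x y i = (if i \<in> J then x i + \<delta> * y i else x i)"

definition elnp :: "'i set \<Rightarrow> ('i \<Rightarrow> complex) \<Rightarrow> ennreal" where
  "elnp J x = (\<integral>\<^sup>+y. ennreal (lnp (cmod (F (noisy J x y)))) \<partial>PiM J (\<lambda>_. cgauss))"

lemma measurable_noisy: "(\<lambda>y. ennreal (lnp (cmod (F (noisy J x y))))) \<in> borel_measurable (PiM J (\<lambda>_. cgauss))"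
proof -
  have "(\<lambda>y. noisy J x y i) \<in> borel_measurable (PiM J (\<lambda>_. cgauss))" for i
  proof (cases "i \<in> J")
    case True
    then have [measurable]: "(\<lambda>y. y i) \<in> borel_measurable (PiM J (\<lambda>_. cgauss))"
      using measurable_component_singleton[of i J "\<lambda>_. cgauss"] by simp
    show ?thesis using True by (simp add: noisy_def)
  qed (simp add: noisy_def)
  then have "(\<lambda>y. F (noisy J x y)) \<in> borel_measurable (PiM J (\<lambda>_. cgauss))" by (rule meas)
  then show ?thesis by measurable
qed

lemma elnp_insert:
  assumes "finite J" "i \<notin> J"
  shows "elnp (insert i J) x
    = (\<integral>\<^sup>+y. \<integral>\<^sup>+g. ennreal (lnp (cmod (F ((noisy J x y)(i := x i + \<delta> * g))))) \<partial>cgauss \<partial>PiM J (\<lambda>_. cgauss))"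
proof -
  interpret G: prob_space cgauss by (rule prob_space_cgauss)
  interpret product_sigma_finite "\<lambda>_::'i. cgauss" ..
  have "noisy (insert i J) x (y(i := g)) = (noisy J x y)(i := x i + \<delta> * g)" for y g
    using assms by (auto simp: noisy_def fun_eq_iff)
  then show ?thesis
    unfolding elnp_def by (subst product_nn_integral_insert[OF assms measurable_noisy]) simp
qed

text \<open>The noise is switched on one coordinate at a time, and subharmonicity applies at each
  step.\<close>

lemma lnp_le_elnp:
  assumes "finite J"
  shows "ennreal (lnp (cmod (F x))) \<le> elnp J x"
  using assms
proof (induction J)
  case empty
  have "noisy {} x y = x" for y by (simp add: noisy_def fun_eq_iff)
  then show ?case by (simp add: elnp_def PiM_empty nn_integral_count_space_finite)
next
  case (insert i J)
  note insert.IH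
  also have "elnp J x \<le> elnp (insert i J) x"
    unfolding elnp_insert[OF insert.hyps] elnp_def[of J]
  proof (rule nn_integral_mono)
    fix y
    obtain u c where uc: "\<And>t. F ((noisy J x y)(i := t)) = u + c * t" using affine by blast
    have "noisy J x y = (noisy J x y)(i := x i)" using insert.hyps by (auto simp: noisy_def)
    then have "F (noisy J x y) = u + c * x i" using uc by metis
    moreover have "F ((noisy J x y)(i := x i + \<delta> * g)) = (u + c * x i) + (c * \<delta>) * g" for g
      by (simp add: uc algebra_simps)
    ultimately show "ennreal (lnp (cmod (F (noisy J x y))))
       \<le> (\<integral>\<^sup>+g. ennreal (lnp (cmod (F ((noisy J x y)(i := x i + \<delta> * g))))) \<partial>cgauss)"
      by (simp add: cgauss_lnp_ge)
  qed
  finally show ?case .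
qed

text \<open>Integrate over the noise in coordinate \<open>i\<close> first. The other coordinates
  being fixed, \<open>F\<close> is affine in the \<open>i\<close>-th one, with a slope about which
  nothing is known; the one-variable bound is uniform in that slope.\<close>

lemma elnp_change_entry:
  assumes J: "finite J" "i \<in> J" and D: "cmod (v - x i) \<le> D"
  shows "elnp J (x(i := v)) \<le> elnp J x + entry_cost D (cmod \<delta>)"
proof -
  interpret G: prob_space cgauss by (rule prob_space_cgauss)
  define J' where "J' = J - {i}"
  have J': "finite J'" "i \<notin> J'" "J = insert i J'" using J by (auto simp: J'_def)
  interpret P: prob_space "PiM J' (\<lambda>_. cgauss)" by (intro prob_space_PiM G.prob_space_axioms)
  let ?f = "\<lambda>w y. \<integral>\<^sup>+g. ennreal (lnp (cmod (F ((noisy J' x y)(i := w + \<delta> * g))))) \<partial>cgauss"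
  have eq: "elnp J (x(i := w)) = (\<integral>\<^sup>+y. ?f w y \<partial>PiM J' (\<lambda>_. cgauss))" for w
  proof -
    have "(noisy J' (x(i := w)) y)(i := (x(i := w)) i + \<delta> * g) = (noisy J' x y)(i := w + \<delta> * g)" for y g
      by (auto simp: noisy_def fun_eq_iff)
    then show ?thesis unfolding J'(3) elnp_insert[OF J'(1,2)] by simp
  qed
  have "elnp J (x(i := v)) = (\<integral>\<^sup>+y. ?f v y \<partial>PiM J' (\<lambda>_. cgauss))" by (rule eq)
  also have "\<dots> \<le> (\<integral>\<^sup>+y. ?f (x i) y + entry_cost D (cmod \<delta>) \<partial>PiM J' (\<lambda>_. cgauss))"
  proof (rule nn_integral_mono)
    fix y
    obtain u c where uc: "\<And>t. F ((noisy J' x y)(i := t)) = u + c * t" using affine by blast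
    have "F ((noisy J' x y)(i := v + \<delta> * g)) = (u + c * x i) + (v - x i) * c + c * \<delta> * g" for g
      by (simp add: uc algebra_simps)
    moreover have "F ((noisy J' x y)(i := x i + \<delta> * g)) = (u + c * x i) + c * \<delta> * g" for g
      by (simp add: uc algebra_simps)
    ultimately show "?f v y \<le> ?f (x i) y + entry_cost D (cmod \<delta>)"
      using cgauss_lnp_change[OF D \<delta>] by simp
  qed
  also have "\<dots> \<le> (\<integral>\<^sup>+y. ?f (x i) y \<partial>PiM J' (\<lambda>_. cgauss)) + entry_cost D (cmod \<delta>)"
  proof -
    have "?f (x i) \<in> borel_measurable (PiM J' (\<lambda>_. cgauss))"
    proof -
      have "(\<lambda>p. (fst p)(i := snd p)) \<in> PiM J' (\<lambda>_. cgauss) \<Otimes>\<^sub>M cgauss \<rightarrow>\<^sub>M PiM J (\<lambda>_. cgauss)"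
        using measurable_add_dim[of i J' "\<lambda>_. cgauss"] by (simp add: J'(3) split_beta')
      from measurable_compose[OF this measurable_noisy]
      have "(\<lambda>p. ennreal (lnp (cmod (F (noisy J x ((fst p)(i := snd p)))))))
        \<in> borel_measurable (PiM J' (\<lambda>_. cgauss) \<Otimes>\<^sub>M cgauss)" .
      moreover have "noisy J x (y(i := g)) = (noisy J' x y)(i := x i + \<delta> * g)" for y g
        using J' by (auto simp: noisy_def fun_eq_iff)
      ultimately have "(\<lambda>(y, g). ennreal (lnp (cmod (F ((noisy J' x y)(i := x i + \<delta> * g))))))
        \<in> borel_measurable (PiM J' (\<lambda>_. cgauss) \<Otimes>\<^sub>M cgauss)"
        by (simp add: split_beta')
      then show ?thesis by (rule G.borel_measurable_nn_integral)
    qed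
    then show ?thesis
      using P.emeasure_space_1 by (subst nn_integral_add) auto
  qed
  also have "(\<integral>\<^sup>+y. ?f (x i) y \<partial>PiM J' (\<lambda>_. cgauss)) = elnp J x"
    using eq[of "x i"] by simp
  finally show ?thesis .
qed

lemma elnp_change_entries:
  assumes J: "finite J" and S: "finite S" "S \<subseteq> J"
    and x': "\<And>i. i \<notin> S \<Longrightarrow> x' i = x i" "\<And>i. i \<in> S \<Longrightarrow> cmod (x' i - x i) \<le> D"
  shows "elnp J x' \<le> elnp J x + of_nat (card S) * entry_cost D (cmod \<delta>)"
  using S x'
proof (induction S arbitrary: x')
  case empty
  then have "x' = x" by auto
  then show ?case by simp
next
  case (insert i S)
  let ?y = "x'(i := x i)"
  have "elnp J (?y(i := x' i)) \<le> elnp J ?y + entry_cost D (cmod \<delta>)"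
    using insert.prems by (intro elnp_change_entry J) auto
  also have "elnp J ?y \<le> elnp J x + of_nat (card S) * entry_cost D (cmod \<delta>)"
    using insert.prems insert.hyps by (intro insert.IH) auto
  finally show ?case
    using insert.hyps by (simp add: distrib_right add_ac add_right_mono)
qed

lemma lnp_le_elnp_changed:
  assumes J: "finite J" and S: "finite S" "S \<subseteq> J"
    and x': "\<And>i. i \<notin> S \<Longrightarrow> x' i = x i" "\<And>i. i \<in> S \<Longrightarrow> cmod (x' i - x i) \<le> D"
  shows "ennreal (lnp (cmod (F x'))) \<le> elnp J x + of_nat (card S) * entry_cost D (cmod \<delta>)"
  using lnp_le_elnp[OF J] elnp_change_entries[OF assms] by (rule order.trans)

end

section \<open>Determinants near a normal matrix\<close>

text \<open>Determinants of arrays indexed by natural numbers below \<open>N\<close>. Working with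
  entries instead of matrices spares carrier conditions and makes the determinant a function of a
  family of complex variables.\<close>

definition ndet :: "nat \<Rightarrow> (nat \<Rightarrow> nat \<Rightarrow> complex) \<Rightarrow> complex" where
  "ndet N a = Determinant.det (Matrix.mat N N (\<lambda>(i, j). a i j))"

lemma ndet_cong:
  assumes "\<And>i j. i < N \<Longrightarrow> j < N \<Longrightarrow> a i j = b i j"
  shows "ndet N a = ndet N b"
  unfolding ndet_def by (rule arg_cong[where f = Determinant.det]) (auto intro!: eq_matI simp: assms)

lemma det_eq_ndet: "A \<in> carrier_mat N N \<Longrightarrow> Determinant.det A = ndet N (\<lambda>i j. A $$ (i, j))"
  unfolding ndet_def by (rule arg_cong[where f = Determinant.det]) (auto intro!: eq_matI)

lemma ndet_mult: "ndet N (\<lambda>i j. \<Sum>k<N. a i k * b k j) = ndet N a * ndet N b"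
proof -
  let ?A = "Matrix.mat N N (\<lambda>(i, j). a i j)" and ?B = "Matrix.mat N N (\<lambda>(i, j). b i j)"
  have "ndet N (\<lambda>i j. \<Sum>k<N. a i k * b k j) = Determinant.det (?A * ?B)"
    unfolding ndet_def by (rule arg_cong[where f = Determinant.det])
      (auto intro!: eq_matI simp: scalar_prod_def atLeast0LessThan)
  also have "\<dots> = ndet N a * ndet N b"
    unfolding ndet_def by (rule det_mult[of _ N]) auto
  finally show ?thesis .
qed

lemma ndet_leibniz:
  "ndet N a = (\<Sum>p | p permutes {0..<N}. signof p * (\<Prod>i = 0..<N. a i (p i)))"
proof -
  have "p permutes {0..<N} \<Longrightarrow> i \<in> {0..<N} \<Longrightarrow> p i < N" for p i
    using permutes_in_image[of p "{0..<N}" i] by auto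
  then show ?thesis
    unfolding ndet_def by (subst det_def'[of _ N]) (auto intro!: sum.cong prod.cong)
qed

lemma ndet_adjoint: "ndet N (\<lambda>i j. cnj (a j i)) = cnj (ndet N a)"
proof -
  have "ndet N (\<lambda>i j. cnj (a j i)) = ndet N (\<lambda>i j. cnj (a i j))"
    unfolding ndet_def
    by (subst det_transpose[of _ N, symmetric], simp, rule arg_cong[where f = Determinant.det])
      (auto intro!: eq_matI)
  also have "\<dots> = cnj (ndet N a)"
  proof -
    have "cnj (signof p) = signof p" for p :: "nat \<Rightarrow> nat" by (cases p rule: sign_cases) auto
    then show ?thesis unfolding ndet_leibniz by (simp add: cnj_sum cnj_prod)
  qed
  finally show ?thesis .
qed

lemma ndet_diag: "ndet N (\<lambda>i j. if i = j then c j else 0) = (\<Prod>j<N. c j)"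
  unfolding ndet_def
  by (subst det_upper_triangular[of _ N])
     (auto simp: upper_triangular_def diag_mat_def prod.list_conv_set_nth atLeast0LessThan)

lemma ndet_one: "ndet N (\<lambda>i j. if i = j then 1 else 0) = 1"
  by (simp add: ndet_diag)

lemma ndet_scale_columns: "ndet N (\<lambda>i j. a i j * c j) = ndet N a * (\<Prod>j<N. c j)"
proof -
  have "ndet N (\<lambda>i j. a i j * c j) = ndet N (\<lambda>i j. \<Sum>k<N. a i k * (if k = j then c j else 0))"
    by (rule ndet_cong) (simp add: if_distrib[of "\<lambda>x. _ * x"] cong: if_cong)
  then show ?thesis by (simp only: ndet_mult ndet_diag)
qed

lemma char_poly_eq_ndet:
  assumes "A \<in> carrier_mat N N"
  shows "poly (char_poly A) z = ndet N (\<lambda>i j. (if i = j then z else 0) - A $$ (i, j))"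
proof -
  have "poly (char_poly A) z = Determinant.det (- (char_matrix A z))" by (rule char_poly_matrix[OF assms])
  also have "\<dots> = ndet N (\<lambda>i j. (if i = j then z else 0) - A $$ (i, j))"
    using assms by (subst det_eq_ndet[of _ N]) (auto simp: char_matrix_def intro!: ndet_cong)
  finally show ?thesis .
qed

lemma mat_trace_commute:
  fixes A B :: "complex mat"
  assumes "A \<in> carrier_mat N N" "B \<in> carrier_mat N N"
  shows "(\<Sum>i<N. (A * B) $$ (i, i)) = (\<Sum>i<N. (B * A) $$ (i, i))"
proof -
  have "(\<Sum>i<N. (A * B) $$ (i, i)) = (\<Sum>i<N. \<Sum>k<N. A $$ (i, k) * B $$ (k, i))"
    using assms by (intro sum.cong refl) (simp add: scalar_prod_def atLeast0LessThan)
  also have "\<dots> = (\<Sum>k<N. \<Sum>i<N. A $$ (i, k) * B $$ (k, i))" by (rule sum.swap)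
  also have "\<dots> = (\<Sum>i<N. (B * A) $$ (i, i))"
    using assms by (intro sum.cong refl) (simp add: scalar_prod_def atLeast0LessThan mult.commute)
  finally show ?thesis .
qed

text \<open>The Schur decomposition provides the eigenvalues with multiplicity and, being a
  similarity, preserves the trace.\<close>

lemma ndet_spectrum:
  obtains e where
    "\<And>z. ndet N (\<lambda>i j. (if i = j then z else 0) - a i j) = (\<Prod>k<N. z - e k)"
    "(\<Sum>i<N. a i i) = (\<Sum>k<N. e k)"
    "\<And>k. k < N \<Longrightarrow> \<exists>v. (\<exists>i<N. v i \<noteq> 0) \<and> (\<forall>i<N. (\<Sum>j<N. a i j * v j) = e k * v i)"
proof -
  let ?A = "Matrix.mat N N (\<lambda>(i, j). a i j)"
  have A: "?A \<in> carrier_mat N N" by simp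
  obtain es where es: "char_poly ?A = (\<Prod>a\<leftarrow>es. [:- a, 1:])" and len: "length es = N"
    using char_poly_factorized[OF A] by blast
  obtain B P Q where sd: "schur_decomposition ?A es = (B, P, Q)"
    by (cases "schur_decomposition ?A es") auto
  from schur_decomposition[OF A es sd] have sim: "similar_mat_wit ?A B P Q" and dB: "diag_mat B = es"
    by auto
  note w = similar_mat_witD2[OF A sim]
  show thesis
  proof (rule that[of "\<lambda>k. es ! k"])
    show "ndet N (\<lambda>i j. (if i = j then z else 0) - a i j) = (\<Prod>k<N. z - es ! k)" for z
    proof -
      have "ndet N (\<lambda>i j. (if i = j then z else 0) - a i j) = poly (char_poly ?A) z"
        by (subst char_poly_eq_ndet[OF A]) (auto intro!: ndet_cong)
      also have "\<dots> = (\<Prod>k<N. z - es ! k)"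
        unfolding es by (simp add: poly_prod_list poly_prod prod.list_conv_set_nth len atLeast0LessThan o_def)
      finally show ?thesis .
    qed
    have "(\<Sum>i<N. a i i) = (\<Sum>i<N. ?A $$ (i, i))" by simp
    also have "\<dots> = (\<Sum>i<N. (P * (B * Q)) $$ (i, i))" using w by (simp add: assoc_mult_mat[of _ N N _ N _ N])
    also have "\<dots> = (\<Sum>i<N. ((B * Q) * P) $$ (i, i))" using w by (intro mat_trace_commute) auto
    also have "(B * Q) * P = B" using w by (simp add: assoc_mult_mat[of _ N N _ N _ N])
    also have "(\<Sum>i<N. B $$ (i, i)) = (\<Sum>k<N. es ! k)"
      using w unfolding dB[symmetric] by (auto simp: diag_mat_def intro!: sum.cong)
    finally show "(\<Sum>i<N. a i i) = (\<Sum>k<N. es ! k)" .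
    fix k assume "k < N"
    then have "poly (char_poly ?A) (es ! k) = 0"
      unfolding es using len by (auto simp: poly_prod_list o_def prod_list_zero_iff)
    then have "eigenvalue ?A (es ! k)" by (simp add: eigenvalue_root_char_poly[OF A])
    then obtain v where v: "v \<in> carrier_vec N" "v \<noteq> 0\<^sub>v N" "?A *\<^sub>v v = es ! k \<cdot>\<^sub>v v"
      unfolding eigenvalue_def eigenvector_def by auto
    have "\<exists>i<N. v $ i \<noteq> 0" using v(1,2) by (metis carrier_vecD eq_vecI index_zero_vec(1,2))
    moreover have "(\<Sum>j<N. a i j * v $ j) = es ! k * v $ i" if "i < N" for i
    proof -
      have "(?A *\<^sub>v v) $ i = (\<Sum>j<N. a i j * v $ j)"
        using that v(1) by (simp add: scalar_prod_def atLeast0LessThan)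
      then show ?thesis using v that by simp
    qed
    ultimately show "\<exists>v. (\<exists>i<N. v i \<noteq> 0) \<and> (\<forall>i<N. (\<Sum>j<N. a i j * v j) = es ! k * v i)"
      by (intro exI[of _ "\<lambda>i. v $ i"]) auto
  qed
qed

abbreviation sqnorm :: "nat \<Rightarrow> (nat \<Rightarrow> complex) \<Rightarrow> real" where
  "sqnorm N v \<equiv> \<Sum>i<N. (cmod (v i))\<^sup>2"

lemma sqnorm_cnj: "complex_of_real (sqnorm N v) = (\<Sum>i<N. cnj (v i) * v i)"
  unfolding of_real_sum by (intro sum.cong refl) (simp only: complex_norm_square mult.commute[of "cnj _"])

lemma sqnorm_pos: "i < N \<Longrightarrow> v i \<noteq> 0 \<Longrightarrow> sqnorm N v > 0"
  by (rule sum_pos2[of _ i]) auto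

lemma gram_form:
  "(\<Sum>i<N. cnj (u i) * (\<Sum>j<N. (\<Sum>k<N. cnj (b k i) * b k j) * v j))
     = (\<Sum>k<N. cnj (\<Sum>i<N. b k i * u i) * (\<Sum>j<N. b k j * v j))"
proof -
  have "(\<Sum>i<N. cnj (u i) * (\<Sum>j<N. (\<Sum>k<N. cnj (b k i) * b k j) * v j))
     = (\<Sum>i<N. \<Sum>j<N. \<Sum>k<N. cnj (b k i * u i) * (b k j * v j))"
    by (simp add: sum_distrib_left sum_distrib_right mult_ac)
  also have "\<dots> = (\<Sum>k<N. \<Sum>i<N. \<Sum>j<N. cnj (b k i * u i) * (b k j * v j))"
    by (rule trans[OF sum.cong[OF refl sum.swap] sum.swap])
  also have "\<dots> = (\<Sum>k<N. cnj (\<Sum>i<N. b k i * u i) * (\<Sum>j<N. b k j * v j))"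
    by (simp add: sum_product cnj_sum)
  finally show ?thesis .
qed

text \<open>The Gram matrix has nonnegative eigenvalues whose sum is its trace \<open>N\<close>; by
  the inequality between arithmetic and geometric mean their product, which is \<open>\<bar>det
  b\<bar>\<^sup>2\<close>, is at most 1.\<close>

lemma hadamard_unit_columns:
  assumes "\<And>j. j < N \<Longrightarrow> sqnorm N (\<lambda>i. b i j) = 1"
  shows "cmod (ndet N b) \<le> 1"
proof (cases "N = 0")
  case True
  then show ?thesis by (simp add: ndet_def)
next
  case False
  define H where "H = (\<lambda>i j. \<Sum>k<N. cnj (b k i) * b k j)"
  obtain e where e: "\<And>z. ndet N (\<lambda>i j. (if i = j then z else 0) - H i j) = (\<Prod>k<N. z - e k)"
    "(\<Sum>i<N. H i i) = (\<Sum>k<N. e k)"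
    "\<And>k. k < N \<Longrightarrow> \<exists>v. (\<exists>i<N. v i \<noteq> 0) \<and> (\<forall>i<N. (\<Sum>j<N. H i j * v j) = e k * v i)"
    by (rule ndet_spectrum[of N H]) blast
  \<comment> \<open>Each eigenvalue is a Rayleigh quotient of the Gram matrix, hence real and
    nonnegative.\<close>
  have ek: "e k = of_real (cmod (e k))" if k: "k < N" for k
  proof -
    obtain v i where i: "i < N" "v i \<noteq> 0" and v: "\<And>i. i < N \<Longrightarrow> (\<Sum>j<N. H i j * v j) = e k * v i"
      using e(3)[OF k] by blast
    have "e k * of_real (sqnorm N v) = (\<Sum>i<N. cnj (v i) * (\<Sum>j<N. H i j * v j))"
      unfolding sqnorm_cnj by (subst sum_distrib_left, intro sum.cong refl) (simp add: v)
    also have "\<dots> = of_real (sqnorm N (\<lambda>k. \<Sum>j<N. b k j * v j))"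
      unfolding H_def gram_form sqnorm_cnj ..
    finally have A: "e k = of_real (sqnorm N (\<lambda>k. \<Sum>j<N. b k j * v j) / sqnorm N v)"
    proof -
      assume a: "e k * of_real (sqnorm N v) = of_real (sqnorm N (\<lambda>k. \<Sum>j<N. b k j * v j))"
      have "sqnorm N v \<noteq> 0" using sqnorm_pos[OF i(1), of v] i(2) by linarith
      then have "of_real (sqnorm N v) \<noteq> (0 :: complex)" by (simp only: of_real_eq_0_iff not_False_eq_True)
      then show ?thesis unfolding of_real_divide a[symmetric] by (rule nonzero_mult_div_cancel_right[symmetric])
    qed
    have B: "sqnorm N (\<lambda>k. \<Sum>j<N. b k j * v j) / sqnorm N v \<ge> 0"
      by (intro divide_nonneg_nonneg sum_nonneg) auto
    show ?thesis unfolding A norm_of_real abs_of_nonneg[OF B] ..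
  qed
  have "(\<Sum>k<N. cmod (e k)) = N"
  proof -
    have "H j j = 1" if "j < N" for j
      unfolding H_def sqnorm_cnj[symmetric] using assms[OF that] by simp
    then have "(\<Sum>k<N. e k) = of_nat N" using e(2) by simp
    then have "of_real (\<Sum>k<N. cmod (e k)) = (of_real (real N) :: complex)"
      using ek by (simp add: of_real_sum)
    then show ?thesis by (simp only: of_real_eq_iff)
  qed
  moreover have "(\<Prod>k<N. cmod (e k)) powr (1 / card {..<N}) \<le> (\<Sum>k<N. cmod (e k) / card {..<N})"
    using False by (intro arith_geom_mean) auto
  ultimately have "(\<Prod>k<N. cmod (e k)) powr (1 / N) \<le> 1"
    using False by (simp flip: sum_divide_distrib)
  then have le: "(\<Prod>k<N. cmod (e k)) \<le> 1"
  proof (rule contrapos_pp)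
    assume "\<not> (\<Prod>k<N. cmod (e k)) \<le> 1"
    then have "1 < (\<Prod>k<N. cmod (e k)) powr (1 / N)" using False by (intro gr_one_powr) auto
    then show "\<not> (\<Prod>k<N. cmod (e k)) powr (1 / N) \<le> 1" by linarith
  qed
  have h1: "cmod (ndet N H) = (cmod (ndet N b))\<^sup>2"
    unfolding H_def by (subst ndet_mult[of N "\<lambda>i k. cnj (b k i)" b])
      (simp add: ndet_adjoint norm_mult power2_eq_square)
  have h2: "cmod (ndet N H) = cmod (ndet N (\<lambda>i j. (if i = j then 0 else 0) - H i j))"
  proof -
    have "ndet N (\<lambda>i j. H i j * (- 1)) = ndet N H * (\<Prod>j<N. - 1)" by (rule ndet_scale_columns)
    then show ?thesis by (simp add: norm_mult norm_power)
  qed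
  have h3: "cmod (ndet N (\<lambda>i j. (if i = j then 0 else 0) - H i j)) = (\<Prod>k<N. cmod (e k))"
    unfolding e(1) by (subst prod_norm[symmetric]) simp
  have "(cmod (ndet N b))\<^sup>2 \<le> 1\<^sup>2"
    using le unfolding h1[symmetric] h2 h3 by simp
  then show ?thesis by (rule power2_le_imp_le) simp
qed

lemma hadamard_columns: "cmod (ndet N b) \<le> (\<Prod>j<N. L2_set (\<lambda>i. cmod (b i j)) {..<N})"
proof (cases "\<exists>j<N. L2_set (\<lambda>i. cmod (b i j)) {..<N} = 0")
  case True
  then obtain j where j: "j < N" "\<And>i. i < N \<Longrightarrow> b i j = 0" by (auto simp: L2_set_eq_0_iff)
  have "(\<Prod>i = 0..<N. b i (p i)) = 0" if p: "p permutes {0..<N}" for p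
  proof -
    obtain i where "i < N" "p i = j"
      using permutes_image[OF p] j(1) by (metis atLeast0LessThan image_iff lessThan_iff)
    then show ?thesis using j by (intro prod_zero bexI[of _ i]) auto
  qed
  then have "ndet N b = 0" unfolding ndet_leibniz by (intro sum.neutral) simp
  then show ?thesis by (simp add: prod_nonneg L2_set_nonneg)
next
  case False
  define r where "r j = L2_set (\<lambda>i. cmod (b i j)) {..<N}" for j
  have r: "r j > 0" if "j < N" for j
    using False that L2_set_nonneg[of "\<lambda>i. cmod (b i j)" "{..<N}"] unfolding r_def by (auto simp: less_le)
  \<comment> \<open>Normalise the columns; the case of a zero column has been treated above.\<close>
  define c where "c i j = b i j / of_real (r j)" for i j
  have "cmod (ndet N c) \<le> 1"
  proof (rule hadamard_unit_columns)
    fix j assume j: "j < N"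
    have "sqnorm N (\<lambda>i. c i j) = sqnorm N (\<lambda>i. b i j) / (r j)\<^sup>2"
      by (simp add: c_def norm_divide power_divide sum_divide_distrib)
    also have "sqnorm N (\<lambda>i. b i j) = (r j)\<^sup>2"
      unfolding r_def L2_set_def by (simp add: sum_nonneg)
    finally show "sqnorm N (\<lambda>i. c i j) = 1" using r[OF j] by simp
  qed
  moreover have "ndet N b = ndet N c * (\<Prod>j<N. of_real (r j))"
    unfolding ndet_scale_columns[symmetric] using r by (intro ndet_cong) (auto simp: c_def less_le)
  moreover have "cmod (\<Prod>j<N. of_real (r j)) = (\<Prod>j<N. r j)"
    using r by (simp add: prod_norm[symmetric] less_imp_le)
  moreover have "(\<Prod>j<N. r j) \<ge> 0" using r by (intro prod_nonneg) (auto simp: less_imp_le)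
  ultimately show ?thesis
    unfolding r_def[symmetric] by (simp add: norm_mult mult_left_le_one_le)
qed

lemma unitary_sqnorm:
  assumes unit: "\<And>i j. i < N \<Longrightarrow> j < N \<Longrightarrow> (\<Sum>k<N. cnj (W k i) * W k j) = (if i = j then 1 else 0)"
  shows "sqnorm N (\<lambda>i. \<Sum>j<N. W i j * v j) = sqnorm N v"
proof -
  have "of_real (sqnorm N (\<lambda>i. \<Sum>j<N. W i j * v j)) = (\<Sum>k<N. cnj (\<Sum>i<N. W k i * v i) * (\<Sum>j<N. W k j * v j))"
    unfolding sqnorm_cnj ..
  also have "\<dots> = (\<Sum>i<N. cnj (v i) * (\<Sum>j<N. (\<Sum>k<N. cnj (W k i) * W k j) * v j))"
    by (rule gram_form[symmetric])
  also have "\<dots> = (\<Sum>i<N. cnj (v i) * (\<Sum>j<N. (if i = j then 1 else 0) * v j))"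
    using unit by (intro sum.cong refl arg_cong2[where f = "(*)"]) auto
  also have "\<dots> = of_real (sqnorm N v)"
    unfolding sqnorm_cnj by (simp add: if_distrib[of "\<lambda>x. x * _"] cong: if_cong)
  finally show ?thesis by (simp only: of_real_eq_iff)
qed

lemma unitary_ndet:
  assumes unit: "\<And>i j. i < N \<Longrightarrow> j < N \<Longrightarrow> (\<Sum>k<N. cnj (W k i) * W k j) = (if i = j then 1 else 0)"
  shows "cmod (ndet N W) = 1"
proof -
  have "cnj (ndet N W) * ndet N W = ndet N (\<lambda>i j. \<Sum>k<N. cnj (W k i) * W k j)"
    by (simp add: ndet_mult[of N "\<lambda>i k. cnj (W k i)" W] ndet_adjoint)
  also have "\<dots> = 1" using ndet_cong[of N, OF unit] by (simp add: ndet_one)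
  finally have "cmod (cnj (ndet N W) * ndet N W) = 1" by simp
  then have "(cmod (ndet N W))\<^sup>2 = 1" by (simp add: norm_mult power2_eq_square)
  then show ?thesis by (simp add: power2_eq_1_iff) (smt (verit) norm_ge_zero)
qed

text \<open>In the eigenbasis \<open>W\<close> of the normal matrix \<open>C\<close> the
  \<open>j\<close>-th column of \<open>C + Y\<close> is \<open>\<mu> j\<close> times a unit vector
  plus a perturbation of norm \<open>v j\<close>, so Hadamard's inequality applies with column norms
  \<open>\<bar>\<mu> j\<bar> + v j\<close>. The parameter \<open>\<sigma>\<close> keeps the
  resulting bound linear in \<open>v j\<close> even when \<open>\<mu> j\<close> is close to 0. By
  Cauchy--Schwarz over the columns only the Frobenius norm of \<open>Y\<close> enters, which does
  not depend on the basis.\<close>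

lemma ndet_perturb_normal_le:
  assumes unit: "\<And>i j. i < N \<Longrightarrow> j < N \<Longrightarrow> (\<Sum>k<N. cnj (W k i) * W k j) = (if i = j then 1 else 0)"
    and unit': "\<And>i j. i < N \<Longrightarrow> j < N \<Longrightarrow> (\<Sum>k<N. W i k * cnj (W j k)) = (if i = j then 1 else 0)"
    and diag: "\<And>i j. i < N \<Longrightarrow> j < N \<Longrightarrow> (\<Sum>k<N. C i k * W k j) = W i j * \<mu> j"
    and sig: "\<sigma> > 0" and nz: "ndet N (\<lambda>i j. C i j + Y i j) \<noteq> 0"
  shows "ln (cmod (ndet N (\<lambda>i j. C i j + Y i j)))
     \<le> (\<Sum>j<N. ln (cmod (\<mu> j) + \<sigma>)) + sqrt N / \<sigma> * sqrt (\<Sum>i<N. \<Sum>j<N. (cmod (Y i j))\<^sup>2)"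
proof -
  let ?I = "{..<N}"
  define Z where "Z i j = (\<Sum>k<N. Y i k * W k j)" for i j
  define v where "v j = L2_set (\<lambda>i. cmod (Z i j)) ?I" for j
  have v0: "v j \<ge> 0" for j by (simp add: v_def L2_set_nonneg)
  have "cmod (ndet N W) = 1" by (rule unitary_ndet[OF unit])
  then have "cmod (ndet N (\<lambda>i j. C i j + Y i j)) = cmod (ndet N (\<lambda>i j. \<Sum>k<N. (C i k + Y i k) * W k j))"
    by (simp add: ndet_mult norm_mult)
  also have "\<dots> = cmod (ndet N (\<lambda>i j. W i j * \<mu> j + Z i j))"
    by (rule arg_cong[where f = cmod], rule ndet_cong) (simp add: distrib_right sum.distrib diag Z_def)
  also have "\<dots> \<le> (\<Prod>j<N. L2_set (\<lambda>i. cmod (W i j * \<mu> j + Z i j)) ?I)" by (rule hadamard_columns)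
  also have "\<dots> \<le> (\<Prod>j<N. cmod (\<mu> j) + v j)"
  proof (intro prod_mono conjI L2_set_nonneg)
    fix j assume "j \<in> ?I"
    then have "complex_of_real (sqnorm N (\<lambda>k. W k j)) = complex_of_real 1"
      using unit[of j j] unfolding sqnorm_cnj by simp
    then have "sqnorm N (\<lambda>k. W k j) = 1" by (simp only: of_real_eq_iff)
    then have W1: "L2_set (\<lambda>i. cmod (W i j)) ?I = 1" by (simp add: L2_set_def)
    have "L2_set (\<lambda>i. cmod (W i j * \<mu> j + Z i j)) ?I \<le> L2_set (\<lambda>i. cmod (W i j) * cmod (\<mu> j) + cmod (Z i j)) ?I"
      by (intro L2_set_mono) (auto intro: norm_triangle_le simp: norm_mult)
    also have "\<dots> \<le> L2_set (\<lambda>i. cmod (W i j) * cmod (\<mu> j)) ?I + v j"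
      unfolding v_def by (rule L2_set_triangle_ineq)
    also have "L2_set (\<lambda>i. cmod (W i j) * cmod (\<mu> j)) ?I = cmod (\<mu> j)"
      by (subst L2_set_left_distrib[symmetric]) (simp_all add: W1)
    finally show "L2_set (\<lambda>i. cmod (W i j * \<mu> j + Z i j)) ?I \<le> cmod (\<mu> j) + v j" .
  qed
  also have "\<dots> \<le> (\<Prod>j<N. (cmod (\<mu> j) + \<sigma>) * exp (v j / \<sigma>))"
  proof (intro prod_mono conjI)
    fix j
    show "0 \<le> cmod (\<mu> j) + v j" using v0 by simp
    have "cmod (\<mu> j) + v j \<le> (cmod (\<mu> j) + \<sigma>) * (1 + v j / \<sigma>)"
      using sig v0[of j] by (simp add: field_simps)
    also have "\<dots> \<le> (cmod (\<mu> j) + \<sigma>) * exp (v j / \<sigma>)"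
      using sig by (intro mult_left_mono exp_ge_add_one_self) auto
    finally show "cmod (\<mu> j) + v j \<le> (cmod (\<mu> j) + \<sigma>) * exp (v j / \<sigma>)" .
  qed
  finally have le: "cmod (ndet N (\<lambda>i j. C i j + Y i j)) \<le> (\<Prod>j<N. (cmod (\<mu> j) + \<sigma>) * exp (v j / \<sigma>))" .
  have pos: "0 < cmod (ndet N (\<lambda>i j. C i j + Y i j))" using nz by simp
  have "ln (cmod (ndet N (\<lambda>i j. C i j + Y i j))) \<le> ln (\<Prod>j<N. (cmod (\<mu> j) + \<sigma>) * exp (v j / \<sigma>))"
    by (rule ln_le_cancel_iff[THEN iffD2, OF pos less_le_trans[OF pos le] le])
  also have "\<dots> = (\<Sum>j<N. ln (cmod (\<mu> j) + \<sigma>)) + (\<Sum>j<N. v j) / \<sigma>"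
  proof -
    have p: "cmod (\<mu> j) + \<sigma> > 0" for j using sig by (simp add: add_nonneg_pos)
    have "ln ((cmod (\<mu> j) + \<sigma>) * exp (v j / \<sigma>)) = ln (cmod (\<mu> j) + \<sigma>) + v j / \<sigma>" for j
      using ln_mult_pos[OF p, of "exp (v j / \<sigma>)"] by simp
    moreover have "(cmod (\<mu> j) + \<sigma>) * exp (v j / \<sigma>) \<noteq> 0" for j using p[of j] by simp
    ultimately show ?thesis
      by (subst ln_prod) (simp_all add: sum.distrib sum_divide_distrib)
  qed
  also have "(\<Sum>j<N. v j) \<le> sqrt N * sqrt (\<Sum>i<N. \<Sum>j<N. (cmod (Y i j))\<^sup>2)"
  proof -
    have "(\<Sum>j<N. v j) \<le> L2_set (\<lambda>_. 1) ?I * L2_set v ?I"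
      using L2_set_mult_ineq[of "\<lambda>_. 1" v ?I] v0 by simp
    also have "L2_set v ?I = sqrt (\<Sum>j<N. \<Sum>i<N. (cmod (Z i j))\<^sup>2)"
      unfolding L2_set_def v_def by (simp add: sum_nonneg)
    also have "(\<Sum>j<N. \<Sum>i<N. (cmod (Z i j))\<^sup>2) = (\<Sum>i<N. sqnorm N (\<lambda>j. Z i j))" by (rule sum.swap)
    also have "\<dots> = (\<Sum>i<N. sqnorm N (\<lambda>j. Y i j))"
    proof (rule sum.cong[OF refl])
      fix i
      show "sqnorm N (\<lambda>j. Z i j) = sqnorm N (\<lambda>j. Y i j)"
        using unitary_sqnorm[of N "\<lambda>j k. W k j" "Y i"] unit' by (simp add: Z_def mult.commute)
    qed
    finally show ?thesis by (simp add: L2_set_def)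
  qed
  finally show ?thesis using sig by (simp add: divide_right_mono)
qed

lemma ndet_one_minus_ge:
  assumes \<rho>: "\<rho> \<le> 1"
    and ev: "\<And>v \<kappa>. (\<exists>i<N. v i \<noteq> 0) \<Longrightarrow> (\<And>i. i < N \<Longrightarrow> (\<Sum>j<N. K i j * v j) = \<kappa> * v i) \<Longrightarrow> cmod \<kappa> \<le> \<rho>"
  shows "(1 - \<rho>) ^ N \<le> cmod (ndet N (\<lambda>i j. (if i = j then 1 else 0) - K i j))"
proof -
  obtain e where e: "\<And>z. ndet N (\<lambda>i j. (if i = j then z else 0) - K i j) = (\<Prod>k<N. z - e k)"
    "\<And>k. k < N \<Longrightarrow> \<exists>v. (\<exists>i<N. v i \<noteq> 0) \<and> (\<forall>i<N. (\<Sum>j<N. K i j * v j) = e k * v i)"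
    by (rule ndet_spectrum[of N K]) blast
  have "1 - \<rho> \<le> cmod (1 - e k)" if "k < N" for k
  proof -
    have "cmod (e k) \<le> \<rho>" using e(2)[OF that] ev by blast
    then show ?thesis using norm_triangle_ineq2[of 1 "e k"] by simp
  qed
  then have "(\<Prod>k<N. 1 - \<rho>) \<le> (\<Prod>k<N. cmod (1 - e k))"
    using \<rho> by (intro prod_mono) auto
  then show ?thesis by (simp add: e(1) prod_norm)
qed

text \<open>A matrix whose absolute row and column sums are at most \<open>e\<close> has operator
  norm at most \<open>e\<close>: split each \<open>\<bar>E i j\<bar>\<close> into two square roots
  and apply Cauchy--Schwarz.\<close>

lemma schur_test:
  assumes e: "e \<ge> 0"
    and row: "\<And>i. i < N \<Longrightarrow> (\<Sum>j<N. cmod (E i j)) \<le> e"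
    and col: "\<And>j. j < N \<Longrightarrow> (\<Sum>i<N. cmod (E i j)) \<le> e"
  shows "sqnorm N (\<lambda>i. \<Sum>j<N. E i j * u j) \<le> e\<^sup>2 * sqnorm N u"
proof -
  have "sqnorm N (\<lambda>i. \<Sum>j<N. E i j * u j) \<le> (\<Sum>i<N. e * (\<Sum>j<N. cmod (E i j) * (cmod (u j))\<^sup>2))"
  proof (rule sum_mono)
    fix i assume "i \<in> {..<N}"
    have "cmod (\<Sum>j<N. E i j * u j) \<le> (\<Sum>j<N. sqrt (cmod (E i j)) * (sqrt (cmod (E i j)) * cmod (u j)))"
      by (rule sum_norm_le) (simp add: norm_mult mult.assoc[symmetric])
    then have "(cmod (\<Sum>j<N. E i j * u j))\<^sup>2 \<le> (\<Sum>j<N. sqrt (cmod (E i j)) * (sqrt (cmod (E i j)) * cmod (u j)))\<^sup>2"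
      by (intro power_mono) auto
    also have "\<dots> \<le> (\<Sum>j<N. (sqrt (cmod (E i j)))\<^sup>2) * (\<Sum>j<N. (sqrt (cmod (E i j)) * cmod (u j))\<^sup>2)"
      by (rule Cauchy_Schwarz_ineq_sum)
    also have "\<dots> = (\<Sum>j<N. cmod (E i j)) * (\<Sum>j<N. cmod (E i j) * (cmod (u j))\<^sup>2)"
      by (simp add: power_mult_distrib)
    also have "\<dots> \<le> e * (\<Sum>j<N. cmod (E i j) * (cmod (u j))\<^sup>2)"
      using row \<open>i \<in> {..<N}\<close> by (intro mult_right_mono sum_nonneg) auto
    finally show "(cmod (\<Sum>j<N. E i j * u j))\<^sup>2 \<le> e * (\<Sum>j<N. cmod (E i j) * (cmod (u j))\<^sup>2)" .
  qed
  also have "\<dots> = e * (\<Sum>j<N. (\<Sum>i<N. cmod (E i j)) * (cmod (u j))\<^sup>2)"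
  proof -
    have "(\<Sum>i<N. \<Sum>j<N. cmod (E i j) * (cmod (u j))\<^sup>2) = (\<Sum>j<N. (\<Sum>i<N. cmod (E i j)) * (cmod (u j))\<^sup>2)"
      by (subst sum.swap) (simp only: sum_distrib_right)
    then show ?thesis by (simp only: sum_distrib_left[symmetric])
  qed
  also have "\<dots> \<le> e * (\<Sum>j<N. e * (cmod (u j))\<^sup>2)"
    using e col by (intro mult_left_mono sum_mono mult_right_mono) auto
  also have "\<dots> = e\<^sup>2 * sqnorm N u" by (simp add: sum_distrib_left power2_eq_square mult.assoc)
  finally show ?thesis .
qed

text \<open>Let \<open>W\<close> be unitary and \<open>X W = W D - E W\<close> with \<open>D\<close>
  diagonal. Then \<open>X\<close> equals \<open>W D (1 - K) W\<^sup>*\<close> with \<open>K =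
  D\<^sup>-\<^sup>1 W\<^sup>* E W\<close>. An eigenvector \<open>v\<close> of \<open>K\<close> for
  \<open>\<kappa>\<close> satisfies \<open>E W v = \<kappa> W D v\<close>, whence
  \<open>\<bar>\<kappa>\<bar> * s \<le> e\<close>, because \<open>e\<close> bounds the operator norm
  of \<open>E\<close>.\<close>

lemma ndet_perturb_normal_ge:
  assumes unit: "\<And>i j. i < N \<Longrightarrow> j < N \<Longrightarrow> (\<Sum>k<N. cnj (W k i) * W k j) = (if i = j then 1 else 0)"
    and unit': "\<And>i j. i < N \<Longrightarrow> j < N \<Longrightarrow> (\<Sum>k<N. W i k * cnj (W j k)) = (if i = j then 1 else 0)"
    and X: "\<And>i j. i < N \<Longrightarrow> j < N \<Longrightarrow> (\<Sum>k<N. X i k * W k j) = W i j * D j - (\<Sum>k<N. E i k * W k j)"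
    and s: "s > 0" "\<And>j. j < N \<Longrightarrow> s \<le> cmod (D j)"
    and e: "e \<ge> 0" "e \<le> s"
    and row: "\<And>i. i < N \<Longrightarrow> (\<Sum>j<N. cmod (E i j)) \<le> e"
    and col: "\<And>j. j < N \<Longrightarrow> (\<Sum>i<N. cmod (E i j)) \<le> e"
  shows "(\<Prod>j<N. cmod (D j)) * (1 - e / s) ^ N \<le> cmod (ndet N X)"
proof -
  define Z where "Z i j = (\<Sum>k<N. E i k * W k j)" for i j
  define K where "K i j = (\<Sum>l<N. cnj (W l i) * Z l j) / D i" for i j
  have D0: "D j \<noteq> 0" if "j < N" for j using s(1) s(2)[OF that] by auto
  have WDK: "(\<Sum>k<N. (W i k * D k) * K k j) = Z i j" if "i < N" for i j
  proof -
    have "(\<Sum>k<N. (W i k * D k) * K k j) = (\<Sum>k<N. \<Sum>l<N. W i k * cnj (W l k) * Z l j)"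
    proof (rule sum.cong[OF refl])
      fix k assume "k \<in> {..<N}"
      then have "(W i k * D k) * K k j = W i k * (\<Sum>l<N. cnj (W l k) * Z l j)"
        using D0 by (simp add: K_def)
      then show "(W i k * D k) * K k j = (\<Sum>l<N. W i k * cnj (W l k) * Z l j)"
        by (simp only: sum_distrib_left mult.assoc)
    qed
    also have "\<dots> = (\<Sum>l<N. (\<Sum>k<N. W i k * cnj (W l k)) * Z l j)"
      by (subst sum.swap) (simp add: sum_distrib_right)
    also have "\<dots> = (\<Sum>l<N. (if i = l then 1 else 0) * Z l j)"
      using unit' that by (intro sum.cong refl) auto
    also have "\<dots> = Z i j" using that by (simp add: if_distrib[of "\<lambda>x. x * _"] cong: if_cong)
    finally show ?thesis .
  qed
  have "ndet N X * ndet N W = ndet N (\<lambda>i j. \<Sum>k<N. (W i k * D k) * ((if k = j then 1 else 0) - K k j))"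
    unfolding ndet_mult[symmetric]
    by (rule ndet_cong)
       (simp add: X right_diff_distrib sum_subtractf WDK Z_def[symmetric] if_distrib[of "\<lambda>x. _ * x"] cong: if_cong)
  also have "\<dots> = (ndet N W * (\<Prod>j<N. D j)) * ndet N (\<lambda>k j. (if k = j then 1 else 0) - K k j)"
    by (simp only: ndet_mult ndet_scale_columns)
  finally have "cmod (ndet N X * ndet N W)
     = cmod ((ndet N W * (\<Prod>j<N. D j)) * ndet N (\<lambda>k j. (if k = j then 1 else 0) - K k j))"
    by (rule arg_cong)
  then have eq: "cmod (ndet N X) = (\<Prod>j<N. cmod (D j)) * cmod (ndet N (\<lambda>k j. (if k = j then 1 else 0) - K k j))"
    by (simp add: norm_mult unitary_ndet[OF unit] prod_norm)
  have "(1 - e / s) ^ N \<le> cmod (ndet N (\<lambda>k j. (if k = j then 1 else 0) - K k j))"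
  proof (rule ndet_one_minus_ge)
    show "e / s \<le> 1" using e s by simp
    fix v \<kappa> assume nz: "\<exists>i<N. v i \<noteq> 0" and ev: "\<And>i. i < N \<Longrightarrow> (\<Sum>j<N. K i j * v j) = \<kappa> * v i"
    define y where "y i = (\<Sum>j<N. W i j * v j)" for i
    obtain i where "i < N" "v i \<noteq> 0" using nz by blast
    then have vpos: "sqnorm N v > 0" by (rule sqnorm_pos)
    have Ey: "(\<Sum>k<N. E i k * y k) = (\<Sum>k<N. W i k * (\<kappa> * (D k * v k)))" if i: "i < N" for i
    proof -
      have "(\<Sum>k<N. E i k * y k) = (\<Sum>j<N. Z i j * v j)"
        unfolding y_def Z_def sum_distrib_left sum_distrib_right
        by (subst sum.swap) (simp add: mult.assoc)
      also have "\<dots> = (\<Sum>j<N. (\<Sum>k<N. (W i k * D k) * K k j) * v j)" by (simp add: WDK i)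
      also have "\<dots> = (\<Sum>k<N. (W i k * D k) * (\<Sum>j<N. K k j * v j))"
        unfolding sum_distrib_left sum_distrib_right by (subst sum.swap) (simp add: mult.assoc)
      also have "\<dots> = (\<Sum>k<N. W i k * (\<kappa> * (D k * v k)))"
        by (intro sum.cong refl) (subst ev, simp, simp add: mult_ac)
      finally show ?thesis .
    qed
    have "(cmod \<kappa>)\<^sup>2 * (s\<^sup>2 * sqnorm N v) \<le> (cmod \<kappa>)\<^sup>2 * sqnorm N (\<lambda>k. D k * v k)"
      unfolding sum_distrib_left norm_mult power_mult_distrib
      using s by (intro sum_mono mult_left_mono mult_right_mono power_mono) auto
    also have "\<dots> = sqnorm N (\<lambda>k. \<kappa> * (D k * v k))"
      by (simp add: norm_mult power_mult_distrib sum_distrib_left)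
    also have "\<dots> = sqnorm N (\<lambda>i. \<Sum>k<N. W i k * (\<kappa> * (D k * v k)))"
      by (rule unitary_sqnorm[OF unit, symmetric])
    also have "\<dots> = sqnorm N (\<lambda>i. \<Sum>k<N. E i k * y k)"
      by (intro sum.cong refl) (simp add: Ey)
    also have "\<dots> \<le> e\<^sup>2 * sqnorm N y" by (rule schur_test[OF e(1) row col])
    also have "sqnorm N y = sqnorm N v" unfolding y_def by (rule unitary_sqnorm[OF unit])
    finally have "(cmod \<kappa> * s)\<^sup>2 * sqnorm N v \<le> e\<^sup>2 * sqnorm N v" by (simp add: power_mult_distrib mult.assoc)
    then have "(cmod \<kappa> * s)\<^sup>2 \<le> e\<^sup>2" using vpos by (rule mult_right_le_imp_le)
    then have "cmod \<kappa> * s \<le> e" using e(1) by (rule power2_le_imp_le)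
    then show "cmod \<kappa> \<le> e / s" using s by (simp add: pos_le_divide_eq)
  qed
  then show ?thesis unfolding eq by (intro mult_left_mono prod_nonneg) auto
qed

section \<open>Logarithmic potentials of root multisets\<close>

text \<open>\<open>N\<close> times the logarithmic potential of the root distribution of a monic
  polynomial of degree \<open>N\<close>. At the roots the value is the default value \<open>ln
  0\<close>; the potential is only ever integrated over \<open>z\<close>, and the roots form a null
  set.\<close>

definition pot :: "complex poly \<Rightarrow> complex \<Rightarrow> real" where
  "pot p z = ln (cmod (poly p z))"

definition trunc_pot :: "complex poly \<Rightarrow> real \<Rightarrow> complex \<Rightarrow> real" where
  "trunc_pot p r z = (\<Sum>x\<in>#proots p. ln (max (cmod (z - x)) r))"

lemma cmod_poly_monic:
  assumes "lead_coeff p = (1 :: complex)"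
  shows "cmod (poly p z) = (\<Prod>x\<in>#proots p. cmod (z - x))"
proof -
  have "p = (\<Prod>x\<in>#proots p. [:-x, 1:])"
    using complex_poly_decompose_multiset[of p] assms by simp
  then have "poly p z = poly (\<Prod>x\<in>#proots p. [:-x, 1:]) z" by simp
  also have "\<dots> = (\<Prod>x\<in>#proots p. z - x)"
    by (induction "proots p") (simp_all add: poly_prod_mset)
  finally have "cmod (poly p z) = cmod (\<Prod>x\<in>#proots p. z - x)" by simp
  also have "cmod (\<Prod>x\<in>#A. z - x) = (\<Prod>x\<in>#A. cmod (z - x))" for A
    by (induction A) (simp_all add: norm_mult)
  finally show ?thesis .
qed

lemma pot_eq_sum:
  assumes "lead_coeff p = 1" "poly p z \<noteq> 0"
  shows "pot p z = (\<Sum>x\<in>#proots p. ln (cmod (z - x)))"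
proof -
  have "p \<noteq> 0" using assms by auto
  then have nz: "\<forall>x\<in>#proots p. z \<noteq> x" using assms(2) by auto
  have "(\<forall>x\<in>#A. z \<noteq> x) \<Longrightarrow> ln (\<Prod>x\<in>#A. cmod (z - x)) = (\<Sum>x\<in>#A. ln (cmod (z - x))) \<and> (\<Prod>x\<in>#A. cmod (z - x)) \<noteq> 0" for A
    by (induction A) (auto simp: ln_mult)
  with nz show ?thesis unfolding pot_def cmod_poly_monic[OF assms(1)] by blast
qed

lemma pot_measurable [measurable]: "pot p \<in> borel_measurable borel"
  unfolding pot_def[abs_def] by (intro borel_measurable_ln borel_measurable_norm
    borel_measurable_continuous_onI continuous_intros)

definition circ_mean :: "real \<Rightarrow> (complex \<Rightarrow> real) \<Rightarrow> complex \<Rightarrow> real" where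
  "circ_mean r u z = (\<integral>t. indicator {0..1} t *\<^sub>R u (z + of_real r * cis (2 * pi * t)) \<partial>lborel)"

lemma circ_mean_ln:
  assumes r: "r > 0" and z: "cmod (z - x) \<noteq> r"
  shows "integrable lborel (\<lambda>t. indicator {0..1} t *\<^sub>R ln (cmod (z + of_real r * cis (2 * pi * t) - x)))"
    and "(\<integral>t. indicator {0..1} t *\<^sub>R ln (cmod (z + of_real r * cis (2 * pi * t) - x)) \<partial>lborel)
      = ln (max (cmod (z - x)) r)"
proof -
  let ?f = "\<lambda>t. ln (cmod (z + of_real r * cis (2 * pi * t) - x))"
  have "z + of_real r * cis (2 * pi * t) - x \<noteq> 0" for t
  proof
    assume "z + of_real r * cis (2 * pi * t) - x = 0"
    then have "z - x = - (of_real r * cis (2 * pi * t))" by (simp add: algebra_simps)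
    then have "cmod (z - x) = cmod (of_real r * cis (2 * pi * t))" by (simp only: norm_minus_cancel)
    then show False using z r by (simp add: norm_mult)
  qed
  then have c: "continuous_on {0..1} ?f" by (intro continuous_intros) auto
  then have si: "set_integrable lborel {0..1} ?f" by (rule borel_integrable_atLeastAtMost')
  then show "integrable lborel (\<lambda>t. indicator {0..1} t *\<^sub>R ?f t)" by (simp add: set_integrable_def)
  have "(?f has_integral ln (max (cmod (z - x)) (cmod (of_real r)))) {0..1}"
    using circle_mean_ln[of "z - x" "of_real r"] z r by (simp add: algebra_simps)
  moreover have "(\<integral>t. indicator {0..1} t *\<^sub>R ?f t \<partial>lborel) = integral {0..1} ?f"
    using set_borel_integral_eq_integral(2)[OF si] by (simp add: set_lebesgue_integral_def)
  ultimately show "(\<integral>t. indicator {0..1} t *\<^sub>R ?f t \<partial>lborel) = ln (max (cmod (z - x)) r)"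
    using r by (simp add: integral_unique)
qed

text \<open>The average of \<open>ln \<bar>\<cdot> - x\<bar>\<close> over a circle is the logarithm
  truncated at the radius, in the centre. Centres for which a root lies on the circle are excluded;
  they form a null set.\<close>

lemma circ_mean_pot:
  assumes p: "lead_coeff p = 1" and r: "r > 0" and z: "\<forall>x\<in>#proots p. cmod (z - x) \<noteq> r"
  shows "integrable lborel (\<lambda>t. indicator {0..1} t *\<^sub>R pot p (z + of_real r * cis (2 * pi * t)))"
    and "circ_mean r (pot p) z = trunc_pot p r z"
proof -
  let ?w = "\<lambda>t. z + of_real r * cis (2 * pi * t)"
  have "p \<noteq> 0" using p by auto
  have nz: "poly p (?w t) \<noteq> 0" for t
  proof
    assume "poly p (?w t) = 0"
    then have "?w t \<in># proots p" using \<open>p \<noteq> 0\<close> by simp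
    then have "cmod (z - ?w t) \<noteq> r" using z by blast
    then show False using r by (simp add: norm_mult)
  qed
  have eq: "pot p (?w t) = (\<Sum>x\<in>#proots p. ln (cmod (?w t - x)))" for t
    by (rule pot_eq_sum[OF p nz])
  have *: "(\<forall>x\<in>#A. cmod (z - x) \<noteq> r) \<Longrightarrow>
     integrable lborel (\<lambda>t. indicator {0..1} t *\<^sub>R (\<Sum>x\<in>#A. ln (cmod (?w t - x)))) \<and>
     (\<integral>t. indicator {0..1} t *\<^sub>R (\<Sum>x\<in>#A. ln (cmod (?w t - x))) \<partial>lborel) = (\<Sum>x\<in>#A. ln (max (cmod (z - x)) r))" for A
  proof (induction A)
    case (add x A)
    then have IH: "integrable lborel (\<lambda>t. indicator {0..1} t *\<^sub>R (\<Sum>x\<in>#A. ln (cmod (?w t - x))))"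
      "(\<integral>t. indicator {0..1} t *\<^sub>R (\<Sum>x\<in>#A. ln (cmod (?w t - x))) \<partial>lborel) = (\<Sum>x\<in>#A. ln (max (cmod (z - x)) r))"
      by auto
    have x: "cmod (z - x) \<noteq> r" using add by auto
    show ?case
      using circ_mean_ln[OF r x] IH
      by (simp only: image_mset_add_mset sum_mset.add_mset scaleR_add_right Bochner_Integration.integral_add
        Bochner_Integration.integrable_add simp_thms)
  qed simp
  from *[OF z] show "integrable lborel (\<lambda>t. indicator {0..1} t *\<^sub>R pot p (?w t))"
    "circ_mean r (pot p) z = trunc_pot p r z"
    unfolding circ_mean_def trunc_pot_def eq by auto
qed

lemma AE_not_on_circles:
  assumes "p \<noteq> 0"
  shows "AE z in lborel. \<forall>x\<in>#proots p. cmod (z - x) \<noteq> r"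
proof -
  have "AE z in lborel. z \<notin> sphere x r" for x :: complex
  proof -
    have "sphere x r \<in> null_sets lebesgue" using negligible_sphere negligible_iff_null_sets by blast
    then have "sphere x r \<in> null_sets lborel" by (simp add: null_sets_completion_iff)
    then show ?thesis by (rule AE_not_in)
  qed
  then have "AE z in lborel. \<forall>x\<in>set_mset (proots p). z \<notin> sphere x r"
    by (intro AE_finite_allI) auto
  then show ?thesis by eventually_elim (auto simp: dist_norm norm_minus_commute)
qed

lemma circ_mean_measurable:
  assumes [measurable]: "(\<lambda>(\<omega>, z). u \<omega> z) \<in> borel_measurable (M \<Otimes>\<^sub>M borel)"
  shows "(\<lambda>(\<omega>, z). circ_mean r (u \<omega>) z) \<in> borel_measurable (M \<Otimes>\<^sub>M borel)"
proof -
  have "(\<lambda>q. indicator {0..1} (snd q) *\<^sub>R u (fst (fst q)) (snd (fst q) + of_real r * cis (2 * pi * snd q)))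
     \<in> borel_measurable ((M \<Otimes>\<^sub>M borel) \<Otimes>\<^sub>M lborel)"
    by measurable
  then have "(\<lambda>(p, t). indicator {0..1} t *\<^sub>R u (fst p) (snd p + of_real r * cis (2 * pi * t)))
     \<in> borel_measurable ((M \<Otimes>\<^sub>M borel) \<Otimes>\<^sub>M lborel)"
    by (simp add: split_beta')
  then have "(\<lambda>p. circ_mean r (u (fst p)) (snd p)) \<in> borel_measurable (M \<Otimes>\<^sub>M borel)"
    unfolding circ_mean_def by (rule lborel.borel_measurable_lebesgue_integral)
  then show ?thesis by (simp add: split_beta')
qed

lemma trunc_pot_continuous_on: "r > 0 \<Longrightarrow> continuous_on S (trunc_pot p r)"
proof -
  assume r: "r > 0"
  have "continuous_on S (\<lambda>z. ln (max (cmod (z - x)) r))" for x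
    using r by (intro continuous_on_ln continuous_intros) (auto simp: max_def)
  then have "continuous_on S (\<lambda>z. \<Sum>x\<in>#A. ln (max (cmod (z - x)) r))" for A
    by (induction A) (auto intro!: continuous_on_add)
  then show ?thesis unfolding trunc_pot_def[abs_def] .
qed

lemma trunc_pot_measurable [measurable]: "r > 0 \<Longrightarrow> trunc_pot p r \<in> borel_measurable borel"
  by (rule borel_measurable_continuous_onI[OF trunc_pot_continuous_on])

text \<open>Taking circle means is a contraction in \<open>L\<^sup>1\<close>, at the price of
  enlarging the disc by the radius: this is Fubini and translation invariance.\<close>

lemma trunc_pot_diff_le:
  assumes p: "lead_coeff p = 1" and q: "lead_coeff q = 1" and r: "r > 0"
  shows "(\<integral>\<^sup>+z. ennreal \<bar>trunc_pot p r z - trunc_pot q r z\<bar> * indicator (cball 0 R) z \<partial>lborel)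
    \<le> (\<integral>\<^sup>+z. ennreal \<bar>pot p z - pot q z\<bar> * indicator (cball 0 (R + r)) z \<partial>lborel)"
proof -
  have [measurable]: "cball (0::complex) R \<in> sets borel" for R by simp
  let ?w = "\<lambda>z t. z + of_real r * cis (2 * pi * t)"
  let ?h = "\<lambda>z. ennreal \<bar>pot p z - pot q z\<bar> * indicator (cball 0 (R + r)) z"
  have nz: "p \<noteq> 0" "q \<noteq> 0" using p q by auto
  have "AE z in lborel. ennreal \<bar>trunc_pot p r z - trunc_pot q r z\<bar> * indicator (cball 0 R) z
      \<le> (\<integral>\<^sup>+t. ?h (?w z t) * indicator {0..1} t \<partial>lborel)"
    using AE_not_on_circles[OF nz(1), of r] AE_not_on_circles[OF nz(2), of r]
  proof eventually_elim
    case (elim z)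
    note P = circ_mean_pot[OF p r elim(1)] and Q = circ_mean_pot[OF q r elim(2)]
    show ?case
    proof (cases "z \<in> cball 0 R")
      case True
      \<comment> \<open>Points on a circle of radius \<open>r\<close> centred in the disc stay in
        the enlarged disc.\<close>
      have inb: "?w z t \<in> cball 0 (R + r)" for t
        using True r by (auto intro!: norm_triangle_le simp: norm_mult)
      let ?d = "\<lambda>t. indicator {0..1} t *\<^sub>R pot p (?w z t) - indicator {0..1} t *\<^sub>R pot q (?w z t)"
      have i: "integrable lborel ?d" by (intro Bochner_Integration.integrable_diff P(1) Q(1))
      have I: "(\<integral>t. ?d t \<partial>lborel) = trunc_pot p r z - trunc_pot q r z"
        unfolding P(2)[symmetric] Q(2)[symmetric] circ_mean_def
        by (rule Bochner_Integration.integral_diff[OF P(1) Q(1)])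
      have "ennreal \<bar>trunc_pot p r z - trunc_pot q r z\<bar> \<le> (\<integral>\<^sup>+t. ennreal (norm (?d t)) \<partial>lborel)"
        using integral_norm_bound_ennreal[OF i] unfolding I by simp
      moreover have "ennreal (norm (?d t)) = ?h (?w z t) * indicator {0..1} t" for t
        using inb[of t] by (auto simp: indicator_def)
      ultimately have "ennreal \<bar>trunc_pot p r z - trunc_pot q r z\<bar> \<le> (\<integral>\<^sup>+t. ?h (?w z t) * indicator {0..1} t \<partial>lborel)"
        by simp
      then show ?thesis using True by simp
    qed simp
  qed
  then have "(\<integral>\<^sup>+z. ennreal \<bar>trunc_pot p r z - trunc_pot q r z\<bar> * indicator (cball 0 R) z \<partial>lborel)
     \<le> (\<integral>\<^sup>+z. \<integral>\<^sup>+t. ?h (?w z t) * indicator {0..1} t \<partial>lborel \<partial>lborel)"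
    by (rule nn_integral_mono_AE)
  also have "\<dots> = (\<integral>\<^sup>+t. \<integral>\<^sup>+z. ?h (?w z t) * indicator {0..1::real} t \<partial>lborel \<partial>lborel)"
    by (rule lborel_pair.Fubini') measurable
  also have "\<dots> = (\<integral>\<^sup>+t. (\<integral>\<^sup>+z. ?h z \<partial>lborel) * indicator {0..1::real} t \<partial>lborel)"
  proof (rule nn_integral_cong)
    fix t :: real
    have "(\<integral>\<^sup>+z. ?h (?w z t) * indicator {0..1} t \<partial>lborel) = (\<integral>\<^sup>+z. ?h (?w z t) \<partial>lborel) * indicator {0..1} t"
      by (rule nn_integral_multc) measurable
    also have "(\<integral>\<^sup>+z. ?h (?w z t) \<partial>lborel) = (\<integral>\<^sup>+z. ?h z \<partial>lborel)"
      by (rule nn_integral_lborel_complex_shift) measurable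
    finally show "(\<integral>\<^sup>+z. ?h (?w z t) * indicator {0..1} t \<partial>lborel) = (\<integral>\<^sup>+z. ?h z \<partial>lborel) * indicator {0..1} t" .
  qed
  also have "\<dots> = (\<integral>\<^sup>+z. ?h z \<partial>lborel)"
    by (simp add: nn_integral_cmult)
  finally show ?thesis .
qed

text \<open>A radial bump of height \<open>ln 2\<close> supported in the disc of radius \<open>2 *
  r\<close>, chosen because its translates by the roots of a polynomial add up to a difference of
  two truncated potentials.\<close>

definition bump :: "real \<Rightarrow> complex \<Rightarrow> real" where
  "bump r w = ln (max (cmod w) (2 * r)) - ln (max (cmod w) r)"

definition bump_mass :: "real \<Rightarrow> real" where
  "bump_mass r = (\<integral>w. bump r w \<partial>lborel)"

definition mollify :: "(complex \<Rightarrow> real) \<Rightarrow> real \<Rightarrow> complex \<Rightarrow> real" where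
  "mollify g r x = (\<integral>z. g z * bump r (z - x) \<partial>lborel) / bump_mass r"

lemma bump_continuous_on: "r > 0 \<Longrightarrow> continuous_on S f \<Longrightarrow> continuous_on S (\<lambda>x. bump r (f x))"
  unfolding bump_def by (intro continuous_intros) (auto simp: max_def)

lemma bump_nonneg: "r > 0 \<Longrightarrow> 0 \<le> bump r w"
  unfolding bump_def by simp

lemma bump_eq_0: "2 * r \<le> cmod w \<Longrightarrow> r > 0 \<Longrightarrow> bump r w = 0"
  unfolding bump_def by (simp add: max_def)

lemma bump_inner: "cmod w \<le> r \<Longrightarrow> r > 0 \<Longrightarrow> bump r w = ln 2"
  unfolding bump_def by (simp add: max_def ln_mult)

lemma integrable_continuous_compact_support:
  fixes f :: "complex \<Rightarrow> real"
  assumes "continuous_on UNIV f" and "\<And>z. z \<notin> cball a R \<Longrightarrow> f z = 0"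
  shows "integrable lborel f"
proof -
  have "set_integrable lborel (cball a R) f"
    unfolding set_integrable_def
    by (rule borel_integrable_compact) (auto intro: continuous_on_subset[OF assms(1)])
  moreover have "(\<lambda>z. indicator (cball a R) z *\<^sub>R f z) = f"
    using assms(2) by (auto simp: indicator_def fun_eq_iff)
  ultimately show ?thesis by (simp add: set_integrable_def)
qed

lemma bump_integrable: "r > 0 \<Longrightarrow> integrable lborel (\<lambda>z. bump r (z - x))"
  by (rule integrable_continuous_compact_support[of _ x "2 * r"])
     (auto intro!: bump_continuous_on continuous_intros bump_eq_0 simp: dist_norm norm_minus_commute)

lemma bump_integral: "r > 0 \<Longrightarrow> (\<integral>z. bump r (z - x) \<partial>lborel) = bump_mass r"
proof -
  assume r: "r > 0"
  have [measurable]: "bump r \<in> borel_measurable borel"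
    by (rule borel_measurable_continuous_onI) (rule bump_continuous_on[OF r continuous_on_id])
  have "bump_mass r = (\<integral>z. bump r z \<partial>distr lborel borel ((+) (- x)))"
    by (simp add: lborel_distr_plus bump_mass_def)
  also have "\<dots> = (\<integral>z. bump r (z - x) \<partial>lborel)" by (subst integral_distr) auto
  finally show ?thesis ..
qed

lemma bump_mass_pos: "r > 0 \<Longrightarrow> bump_mass r > 0"
proof -
  assume r: "r > 0"
  have "0 < ln 2 * measure lborel (cball (0::complex) r)"
    using r content_cball_pos[of r "0::complex"] by simp
  also have "\<dots> = (\<integral>w. indicator (cball (0::complex) r) w * ln 2 \<partial>lborel)"
    using emeasure_lborel_cball_finite[of "0::complex" r] by simp
  also have "\<dots> \<le> bump_mass r"
    unfolding bump_mass_def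
  proof (rule integral_mono)
    show "integrable lborel (\<lambda>w. indicator (cball 0 r) (w::complex) * ln 2 :: real)"
      using emeasure_lborel_cball_finite[of "0::complex" r] by (intro integrable_mult_left integrable_real_indicator) auto
    show "integrable lborel (bump r)" using bump_integrable[OF r, of 0] by simp
    show "indicator (cball 0 r) w * ln 2 \<le> bump r w" for w
      using r by (cases "cmod w \<le> r") (auto simp: bump_inner bump_nonneg)
  qed
  finally show ?thesis .
qed

lemma mollify_integrable:
  assumes g: "continuous_on UNIV g" and r: "r > 0"
  shows "integrable lborel (\<lambda>z. g z * bump r (z - x))"
  by (rule integrable_continuous_compact_support[of _ x "2 * r"])
     (use r in \<open>auto intro!: bump_continuous_on continuous_intros g bump_eq_0 simp: dist_norm norm_minus_commute\<close>)

text \<open>The bump is nonnegative, so \<open>mollify g r x\<close> is an average of values of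
  \<open>g\<close> near \<open>x\<close>.\<close>

lemma mollify_close:
  assumes g: "continuous_on UNIV g" and r: "r > 0"
    and e: "\<And>z. cmod (z - x) \<le> 2 * r \<Longrightarrow> \<bar>g z - g x\<bar> \<le> e"
  shows "\<bar>mollify g r x - g x\<bar> \<le> e"
proof -
  let ?b = "\<lambda>z. bump r (z - x)"
  note m = bump_mass_pos[OF r] and bi = bump_integrable[OF r, of x] and B = bump_integral[OF r, of x]
  have "(\<integral>z. (g z - g x) * ?b z \<partial>lborel) = (\<integral>z. g z * ?b z \<partial>lborel) - g x * bump_mass r"
    using mollify_integrable[OF g r, of x] bi B by (simp add: left_diff_distrib)
  then have "mollify g r x - g x = (\<integral>z. (g z - g x) * ?b z \<partial>lborel) / bump_mass r"
    using m by (simp add: mollify_def field_simps)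
  moreover have "\<bar>\<integral>z. (g z - g x) * ?b z \<partial>lborel\<bar> \<le> (\<integral>z. e * ?b z \<partial>lborel)"
  proof (rule integral_abs_bound[THEN order.trans], rule integral_mono)
    show "integrable lborel (\<lambda>z. e * ?b z)" using bi by simp
    show "integrable lborel (\<lambda>z. \<bar>(g z - g x) * ?b z\<bar>)"
      using mollify_integrable[OF g r, of x] bi by (simp add: left_diff_distrib)
    show "\<bar>(g z - g x) * ?b z\<bar> \<le> e * ?b z" for z
    proof (cases "cmod (z - x) \<le> 2 * r")
      case True
      then show ?thesis using e bump_nonneg[OF r] by (simp add: abs_mult mult_right_mono)
    next
      case False
      then show ?thesis using bump_eq_0[of r "z - x"] r by simp
    qed
  qed
  ultimately show ?thesis using m B by (simp add: abs_div pos_divide_le_eq)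
qed

text \<open>Summing the mollified test function over the roots amounts to integrating the test
  function against a difference of truncated potentials: this is how potentials control the root
  distribution.\<close>

lemma sum_mollify:
  assumes g: "continuous_on UNIV g" and r: "r > 0"
  shows "integrable lborel (\<lambda>z. g z * (trunc_pot p (2 * r) z - trunc_pot p r z))"
    and "(\<Sum>x\<in>#proots p. mollify g r x)
      = (\<integral>z. g z * (trunc_pot p (2 * r) z - trunc_pot p r z) \<partial>lborel) / bump_mass r"
proof -
  have eq: "trunc_pot p (2 * r) z - trunc_pot p r z = (\<Sum>x\<in>#proots p. bump r (z - x))" for z
  proof -
    have "(\<Sum>x\<in>#A. ln (max (cmod (z - x)) (2 * r))) - (\<Sum>x\<in>#A. ln (max (cmod (z - x)) r))
      = (\<Sum>x\<in>#A. bump r (z - x))" for A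
      by (induction A) (simp_all add: bump_def)
    then show ?thesis by (simp add: trunc_pot_def)
  qed
  have *: "integrable lborel (\<lambda>z. g z * (\<Sum>x\<in>#A. bump r (z - x))) \<and>
     (\<Sum>x\<in>#A. mollify g r x) = (\<integral>z. g z * (\<Sum>x\<in>#A. bump r (z - x)) \<partial>lborel) / bump_mass r" for A
    using mollify_integrable[OF g r]
    by (induction A) (simp_all add: distrib_left mollify_def add_divide_distrib)
  from *[of "proots p"] show "integrable lborel (\<lambda>z. g z * (trunc_pot p (2 * r) z - trunc_pot p r z))"
    "(\<Sum>x\<in>#proots p. mollify g r x)
      = (\<integral>z. g z * (trunc_pot p (2 * r) z - trunc_pot p r z) \<partial>lborel) / bump_mass r"
    unfolding eq by auto
qed

text \<open>Mollifying costs \<open>e\<close> per root on either side. The remaining difference is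
  an integral of \<open>g\<close> against differences of truncated potentials, which the
  \<open>L\<^sup>1\<close> distance of the potentials controls.\<close>

lemma root_sum_diff_le:
  assumes p: "lead_coeff p = 1" "size (proots p) = N" and q: "lead_coeff q = 1" "size (proots q) = N"
    and g: "continuous_on UNIV g" "\<And>z. \<bar>g z\<bar> \<le> B" "\<And>z. z \<notin> cball 0 R \<Longrightarrow> g z = 0"
    and r: "r > 0" and e: "\<And>z x. cmod (z - x) \<le> 2 * r \<Longrightarrow> \<bar>g z - g x\<bar> \<le> e"
  shows "ennreal \<bar>(\<Sum>x\<in>#proots p. g x) - (\<Sum>x\<in>#proots q. g x)\<bar>
    \<le> ennreal (2 * real N * e) + ennreal (2 * B / bump_mass r) *
      (\<integral>\<^sup>+z. ennreal \<bar>pot p z - pot q z\<bar> * indicator (cball 0 (R + 2 * r)) z \<partial>lborel)"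
    (is "_ \<le> _ + _ * ?I")
proof -
  have [measurable]: "cball (0::complex) R \<in> sets borel" for R by simp
  have [measurable]: "g \<in> borel_measurable borel" using g(1) by (rule borel_measurable_continuous_onI)
  have B: "B \<ge> 0" using g(2)[of 0] by linarith
  have e0: "e \<ge> 0" using e[of 0 0] r by simp
  note c = bump_mass_pos[OF r]
  have close: "\<bar>(\<Sum>x\<in>#A. g x) - (\<Sum>x\<in>#A. mollify g r x)\<bar> \<le> size A * e" for A
  proof (induction A)
    case (add x A)
    have "\<bar>mollify g r x - g x\<bar> \<le> e" using e by (intro mollify_close[OF g(1) r]) auto
    with add show ?case by (simp add: algebra_simps abs_le_iff)
  qed simp
  let ?T = "\<lambda>s z. trunc_pot p s z - trunc_pot q s z"
  let ?d = "\<lambda>z. g z * (trunc_pot p (2 * r) z - trunc_pot p r z) - g z * (trunc_pot q (2 * r) z - trunc_pot q r z)"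
  note P = sum_mollify[OF g(1) r, of p] and Q = sum_mollify[OF g(1) r, of q]
  have i: "integrable lborel ?d" by (intro Bochner_Integration.integrable_diff P(1) Q(1))
  have I: "(\<integral>z. ?d z \<partial>lborel) = bump_mass r * ((\<Sum>x\<in>#proots p. mollify g r x) - (\<Sum>x\<in>#proots q. mollify g r x))"
  proof -
    have "bump_mass r * (a / bump_mass r - b / bump_mass r) = a - b" for a b
      using c by (simp add: right_diff_distrib)
    then show ?thesis unfolding P(2) Q(2) using Bochner_Integration.integral_diff[OF P(1) Q(1)] by simp
  qed
  have T: "(\<integral>\<^sup>+z. ennreal \<bar>?T s z\<bar> * indicator (cball 0 R) z \<partial>lborel) \<le> ?I" if s: "0 < s" "s \<le> 2 * r" for s
  proof -
    have "(\<integral>\<^sup>+z. ennreal \<bar>?T s z\<bar> * indicator (cball 0 R) z \<partial>lborel)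
      \<le> (\<integral>\<^sup>+z. ennreal \<bar>pot p z - pot q z\<bar> * indicator (cball 0 (R + s)) z \<partial>lborel)"
      by (rule trunc_pot_diff_le[OF p(1) q(1) s(1)])
    also have "\<dots> \<le> ?I" using s by (intro nn_integral_mono) (auto simp: indicator_def)
    finally show ?thesis .
  qed
  have "ennreal \<bar>bump_mass r * ((\<Sum>x\<in>#proots p. mollify g r x) - (\<Sum>x\<in>#proots q. mollify g r x))\<bar>
      \<le> (\<integral>\<^sup>+z. ennreal (norm (?d z)) \<partial>lborel)"
    using integral_norm_bound_ennreal[OF i] unfolding I by simp
  also have "\<dots> \<le> (\<integral>\<^sup>+z. ennreal B * (ennreal \<bar>?T (2 * r) z\<bar> * indicator (cball 0 R) z)
      + ennreal B * (ennreal \<bar>?T r z\<bar> * indicator (cball 0 R) z) \<partial>lborel)"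
  proof (rule nn_integral_mono)
    fix z
    show "ennreal (norm (?d z)) \<le> ennreal B * (ennreal \<bar>?T (2 * r) z\<bar> * indicator (cball 0 R) z)
      + ennreal B * (ennreal \<bar>?T r z\<bar> * indicator (cball 0 R) z)"
    proof (cases "z \<in> cball 0 R")
      case True
      have "?d z = g z * (?T (2 * r) z - ?T r z)" by (simp add: algebra_simps)
      then have "norm (?d z) = \<bar>g z\<bar> * \<bar>?T (2 * r) z - ?T r z\<bar>" by (simp add: abs_mult)
      also have "\<dots> \<le> B * (\<bar>?T (2 * r) z\<bar> + \<bar>?T r z\<bar>)" using g(2) B by (intro mult_mono) auto
      finally have "ennreal (norm (?d z)) \<le> ennreal (B * \<bar>?T (2 * r) z\<bar> + B * \<bar>?T r z\<bar>)"
        by (simp add: distrib_left ennreal_leI)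
      then show ?thesis using True B by (simp add: ennreal_mult)
    next
      case False
      then show ?thesis using g(3) by simp
    qed
  qed
  also have "\<dots> = ennreal B * (\<integral>\<^sup>+z. ennreal \<bar>?T (2 * r) z\<bar> * indicator (cball 0 R) z \<partial>lborel)
      + ennreal B * (\<integral>\<^sup>+z. ennreal \<bar>?T r z\<bar> * indicator (cball 0 R) z \<partial>lborel)"
    using r by (subst nn_integral_add) (auto simp: nn_integral_cmult)
  also have "\<dots> \<le> ennreal B * ?I + ennreal B * ?I"
    using r by (intro add_mono mult_left_mono T) auto
  also have "\<dots> = ennreal (2 * B) * ?I"
  proof -
    have "ennreal (2 * B) = ennreal B + ennreal B" using B by (simp flip: ennreal_plus)
    then show ?thesis by (simp only: distrib_right)
  qed
  finally have M0: "ennreal (1 / bump_mass r) * ennreal \<bar>bump_mass r * ((\<Sum>x\<in>#proots p. mollify g r x) - (\<Sum>x\<in>#proots q. mollify g r x))\<bar>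
      \<le> ennreal (1 / bump_mass r) * (ennreal (2 * B) * ?I)"
    by (intro mult_left_mono) auto
  have M: "ennreal \<bar>(\<Sum>x\<in>#proots p. mollify g r x) - (\<Sum>x\<in>#proots q. mollify g r x)\<bar>
     \<le> ennreal (2 * B / bump_mass r) * ?I"
  proof -
    have "ennreal (1 / bump_mass r) * ennreal \<bar>bump_mass r * X\<bar> = ennreal \<bar>X\<bar>" for X
      using c by (subst ennreal_mult[symmetric]) (auto simp: abs_mult)
    moreover have "ennreal (1 / bump_mass r) * (ennreal (2 * B) * Y) = ennreal (2 * B / bump_mass r) * Y" for Y
      using c B by (subst mult.assoc[symmetric], subst ennreal_mult[symmetric]) auto
    ultimately show ?thesis using M0 by (simp only:)
  qed
  have "\<bar>(\<Sum>x\<in>#proots p. g x) - (\<Sum>x\<in>#proots q. g x)\<bar>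
    \<le> 2 * real N * e + \<bar>(\<Sum>x\<in>#proots p. mollify g r x) - (\<Sum>x\<in>#proots q. mollify g r x)\<bar>"
    using close[of "proots p"] close[of "proots q"] p(2) q(2) by simp
  then have "ennreal \<bar>(\<Sum>x\<in>#proots p. g x) - (\<Sum>x\<in>#proots q. g x)\<bar>
    \<le> ennreal (2 * real N * e) + ennreal \<bar>(\<Sum>x\<in>#proots p. mollify g r x) - (\<Sum>x\<in>#proots q. mollify g r x)\<bar>"
    using e0 by (simp add: ennreal_leI flip: ennreal_plus)
  also note add_left_mono[OF M]
  finally show ?thesis .
qed

lemma uniform_modulus_compact_support:
  fixes g :: "complex \<Rightarrow> real"
  assumes g: "continuous_on UNIV g" "\<And>z. z \<notin> cball 0 R \<Longrightarrow> g z = 0" and e: "e > 0"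
  obtains r where "r > 0" "r \<le> 1" "\<And>z x. cmod (z - x) \<le> 2 * r \<Longrightarrow> \<bar>g z - g x\<bar> \<le> e"
proof -
  \<comment> \<open>A margin of 3 beyond the support suffices, since the distances considered are at
    most 2.\<close>
  have "uniformly_continuous_on (cball 0 (R + 3)) g"
    by (intro compact_uniformly_continuous continuous_on_subset[OF g(1)]) auto
  then obtain d where d: "d > 0"
    "\<And>x z. x \<in> cball 0 (R + 3) \<Longrightarrow> z \<in> cball 0 (R + 3) \<Longrightarrow> dist z x < d \<Longrightarrow> dist (g z) (g x) < e"
    unfolding uniformly_continuous_on_def using e by metis
  define r where "r = min 1 (d / 3)"
  show thesis
  proof (rule that[of r])
    show "r > 0" "r \<le> 1" using d(1) by (auto simp: r_def)
    fix z x assume zx: "cmod (z - x) \<le> 2 * r"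
    have rd: "2 * r < d" "2 * r \<le> 2" using d(1) by (auto simp: r_def min_def)
    show "\<bar>g z - g x\<bar> \<le> e"
    proof (cases "z \<in> cball 0 R \<or> x \<in> cball 0 R")
      case True
      then have "z \<in> cball 0 (R + 3)" "x \<in> cball 0 (R + 3)"
        using zx rd norm_triangle_ineq2[of z x] norm_triangle_ineq2[of x z] by (auto simp: norm_minus_commute)
      then show ?thesis using d(2)[of x z] zx rd by (simp add: dist_norm less_imp_le)
    qed (use g(2) e in simp)
  qed
qed

text \<open>The roots themselves are not chosen measurably. The sum over them is nevertheless
  measurable: it is a limit of integrals of circle means of the potential, which is jointly
  measurable by assumption.\<close>

lemma measurable_root_sum_compact:
  fixes M :: "'w measure" and g :: "complex \<Rightarrow> real"
  assumes p: "\<And>\<omega>. \<omega> \<in> space M \<Longrightarrow> lead_coeff (p \<omega>) = 1"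
    and pot: "(\<lambda>(\<omega>, z). pot (p \<omega>) z) \<in> borel_measurable (M \<Otimes>\<^sub>M borel)"
    and g: "continuous_on UNIV g" "\<And>z. z \<notin> cball 0 R \<Longrightarrow> g z = 0"
  shows "(\<lambda>\<omega>. \<Sum>x\<in>#proots (p \<omega>). g x) \<in> borel_measurable M"
proof -
  have [measurable]: "g \<in> borel_measurable borel" using g(1) by (rule borel_measurable_continuous_onI)
  have "\<exists>r>0. r \<le> 1 \<and> (\<forall>z x. cmod (z - x) \<le> 2 * r \<longrightarrow> \<bar>g z - g x\<bar> \<le> 1 / Suc k)" for k
    by (rule uniform_modulus_compact_support[OF g, where e = "1 / Suc k"]) auto
  then obtain r where r: "\<And>k. r k > 0" "\<And>k z x. cmod (z - x) \<le> 2 * r k \<Longrightarrow> \<bar>g z - g x\<bar> \<le> 1 / Suc k"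
    by metis
  let ?h = "\<lambda>k \<omega>. (\<integral>z. g z * (circ_mean (2 * r k) (pot (p \<omega>)) z - circ_mean (r k) (pot (p \<omega>)) z) \<partial>lborel) / bump_mass (r k)"
  have m: "?h k \<in> borel_measurable M" for k
  proof -
    note [measurable] = circ_mean_measurable[OF pot]
    have "(\<lambda>(\<omega>, z). g z * (circ_mean (2 * r k) (pot (p \<omega>)) z - circ_mean (r k) (pot (p \<omega>)) z))
       \<in> borel_measurable (M \<Otimes>\<^sub>M lborel)" by measurable
    then have "(\<lambda>\<omega>. \<integral>z. g z * (circ_mean (2 * r k) (pot (p \<omega>)) z - circ_mean (r k) (pot (p \<omega>)) z) \<partial>lborel) \<in> borel_measurable M"
      by (rule lborel.borel_measurable_lebesgue_integral)
    then show ?thesis by measurable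
  qed
  have eq: "?h k \<omega> = (\<Sum>x\<in>#proots (p \<omega>). mollify g (r k) x)" if "\<omega> \<in> space M" for k \<omega>
  proof -
    note l = p[OF that]
    then have "p \<omega> \<noteq> 0" by auto
    note A = AE_not_on_circles[OF this]
    have [measurable]: "(\<lambda>z. circ_mean s (pot (p \<omega>)) z) \<in> borel_measurable borel" for s
      using measurable_Pair2[OF circ_mean_measurable[OF pot] that] by simp
    have rk: "r k > 0" "2 * r k > 0" using r(1)[of k] by auto
    have "AE z in lborel. g z * (circ_mean (2 * r k) (pot (p \<omega>)) z - circ_mean (r k) (pot (p \<omega>)) z)
       = g z * (trunc_pot (p \<omega>) (2 * r k) z - trunc_pot (p \<omega>) (r k) z)"
      using A[of "r k"] A[of "2 * r k"]
    proof eventually_elim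
      case (elim z)
      then show ?case using circ_mean_pot(2)[OF l rk(1)] circ_mean_pot(2)[OF l rk(2)] by simp
    qed
    then have "(\<integral>z. g z * (circ_mean (2 * r k) (pot (p \<omega>)) z - circ_mean (r k) (pot (p \<omega>)) z) \<partial>lborel)
      = (\<integral>z. g z * (trunc_pot (p \<omega>) (2 * r k) z - trunc_pot (p \<omega>) (r k) z) \<partial>lborel)"
      using rk by (intro integral_cong_AE) measurable
    then show ?thesis using sum_mollify(2)[OF g(1) rk(1)] by simp
  qed
  have lim: "(\<lambda>k. \<Sum>x\<in>#A. mollify g (r k) x) \<longlonglongrightarrow> (\<Sum>x\<in>#A. g x)" for A
  proof -
    have "(\<lambda>k. mollify g (r k) x) \<longlonglongrightarrow> g x" for x
    proof (rule LIMSEQ_I)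
      fix e :: real assume "e > 0"
      then obtain n where n: "1 / Suc n < e" by (metis nat_approx_posE)
      show "\<exists>no. \<forall>k\<ge>no. norm (mollify g (r k) x - g x) < e"
      proof (intro exI allI impI)
        fix k assume "n \<le> k"
        then have "1 / Suc k \<le> 1 / Suc n" by (simp add: frac_le)
        moreover have "\<bar>mollify g (r k) x - g x\<bar> \<le> 1 / Suc k"
          using r by (intro mollify_close[OF g(1)]) auto
        ultimately show "norm (mollify g (r k) x - g x) < e" using n by simp
      qed
    qed
    then show ?thesis by (induction A) (auto intro!: tendsto_add)
  qed
  show ?thesis
  proof (rule borel_measurable_LIMSEQ_real[OF _ m])
    fix \<omega> assume "\<omega> \<in> space M"
    then show "(\<lambda>k. ?h k \<omega>) \<longlonglongrightarrow> (\<Sum>x\<in>#proots (p \<omega>). g x)"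
      using lim by (simp only: eq)
  qed
qed

lemma measurable_root_sum:
  fixes M :: "'w measure" and g :: "complex \<Rightarrow> real"
  assumes p: "\<And>\<omega>. \<omega> \<in> space M \<Longrightarrow> lead_coeff (p \<omega>) = 1"
    and pot: "(\<lambda>(\<omega>, z). pot (p \<omega>) z) \<in> borel_measurable (M \<Otimes>\<^sub>M borel)"
    and g: "continuous_on UNIV g"
  shows "(\<lambda>\<omega>. \<Sum>x\<in>#proots (p \<omega>). g x) \<in> borel_measurable M"
proof -
  \<comment> \<open>Exhaust the plane by continuous cutoffs; each root is eventually in the region
    where the cutoff is 1.\<close>
  define cut where "cut n z = max 0 (min 1 (real n + 1 - cmod z))" for n z
  let ?h = "\<lambda>n \<omega>. \<Sum>x\<in>#proots (p \<omega>). g x * cut n x"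
  have "?h n \<in> borel_measurable M" for n
    by (rule measurable_root_sum_compact[OF p pot, where R = "real n + 1"])
       (auto simp: cut_def intro!: continuous_intros g)
  moreover have "(\<lambda>n. \<Sum>x\<in>#A. g x * cut n x) \<longlonglongrightarrow> (\<Sum>x\<in>#A. g x)" for A
  proof -
    have "(\<lambda>n. g x * cut n x) \<longlonglongrightarrow> g x" for x
    proof -
      obtain n where n: "cmod x \<le> real n" using real_arch_simple by blast
      have "\<forall>\<^sub>F k in sequentially. g x * cut k x = g x"
        using eventually_ge_at_top[of n]
      proof eventually_elim
        case (elim k)
        then have "real n \<le> real k" by simp
        then show ?case using n by (simp add: cut_def)
      qed
      then show ?thesis by (rule tendsto_eventually)
    qed
    then show ?thesis by (induction A) (auto intro!: tendsto_add)
  qed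
  ultimately show ?thesis
    by (rule borel_measurable_LIMSEQ_real[rotated])
qed

section \<open>Determinants with Gaussian noise\<close>

text \<open>Laplace expansion along the row of the entry; the cofactors of that row do not involve
  it.\<close>

lemma ndet_affine_entry:
  "\<exists>u c. \<forall>t. ndet N (\<lambda>i j. (y(p := t)) (i, j)) = u + c * t"
proof (cases "fst p < N \<and> snd p < N")
  case False
  then have "ndet N (\<lambda>i j. (y(p := t)) (i, j)) = ndet N (\<lambda>i j. y (i, j))" for t
    by (intro ndet_cong) auto
  then show ?thesis by (intro exI[of _ "ndet N (\<lambda>i j. y (i, j))"] exI[of _ 0]) simp
next
  case True
  obtain a b where p: "p = (a, b)" "a < N" "b < N" using True by (cases p) auto
  let ?A = "\<lambda>t. Matrix.mat N N (\<lambda>(i, j). (y(p := t)) (i, j))"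
  have cof: "cofactor (?A t) a j = cofactor (?A 0) a j" if "j < N" for t j
  proof -
    have "mat_delete (?A t) a j = mat_delete (?A 0) a j"
      unfolding mat_delete_def using p by (intro eq_matI) auto
    then show ?thesis by (simp add: cofactor_def)
  qed
  let ?c = "cofactor (?A 0) a"
  have "ndet N (\<lambda>i j. (y(p := t)) (i, j)) = (\<Sum>j\<in>{..<N} - {b}. y (a, j) * ?c j) + ?c b * t" for t
  proof -
    have "ndet N (\<lambda>i j. (y(p := t)) (i, j)) = (\<Sum>j<N. ?A t $$ (a, j) * cofactor (?A t) a j)"
      unfolding ndet_def using p by (intro laplace_expansion_row) auto
    also have "\<dots> = (\<Sum>j<N. (y(p := t)) (a, j) * ?c j)"
    proof (rule sum.cong[OF refl])
      fix j assume "j \<in> {..<N}"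
      then show "?A t $$ (a, j) * cofactor (?A t) a j = (y(p := t)) (a, j) * ?c j"
        using cof[of j t] p(2) by simp
    qed
    also have "\<dots> = (\<Sum>j\<in>{..<N} - {b}. (y(p := t)) (a, j) * ?c j) + (y(p := t)) (a, b) * ?c b"
      using p by (subst sum.remove[of _ b]) auto
    also have "(\<Sum>j\<in>{..<N} - {b}. (y(p := t)) (a, j) * ?c j) = (\<Sum>j\<in>{..<N} - {b}. y (a, j) * ?c j)"
      using p by (intro sum.cong) auto
    finally show ?thesis using p by (simp add: mult.commute)
  qed
  then show ?thesis by blast
qed

lemma measurable_ndet:
  assumes "\<And>i j. i < N \<Longrightarrow> j < N \<Longrightarrow> (\<lambda>y. h y i j) \<in> borel_measurable M"
  shows "(\<lambda>y. ndet N (h y)) \<in> borel_measurable M"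
proof -
  have "p permutes {0..<N} \<Longrightarrow> i \<in> {0..<N} \<Longrightarrow> p i < N" for p i
    using permutes_in_image[of p "{0..<N}" i] by auto
  then show ?thesis
    unfolding ndet_leibniz
    by (intro borel_measurable_sum borel_measurable_times borel_measurable_const borel_measurable_prod assms) auto
qed

lemma multiaffine_ndet:
  assumes "\<delta> \<noteq> 0"
  shows "multiaffine (\<lambda>y. ndet N (\<lambda>i j. y (i, j)) * a) \<delta>"
proof
  fix y p
  obtain u c where "\<And>t. ndet N (\<lambda>i j. (y(p := t)) (i, j)) = u + c * t"
    using ndet_affine_entry[of N y p] by blast
  then show "\<exists>u c. \<forall>t. ndet N (\<lambda>i j. (y(p := t)) (i, j)) * a = u + c * t"
    by (intro exI[of _ "u * a"] exI[of _ "c * a"]) (simp add: algebra_simps)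
next
  fix M :: "(nat \<times> nat \<Rightarrow> complex) measure" and h :: "(nat \<times> nat \<Rightarrow> complex) \<Rightarrow> nat \<times> nat \<Rightarrow> complex"
  assume h: "\<And>i. (\<lambda>y. h y i) \<in> borel_measurable M"
  show "(\<lambda>y. ndet N (\<lambda>i j. h y (i, j)) * a) \<in> borel_measurable M"
    by (intro borel_measurable_times borel_measurable_const measurable_ndet h)
qed (rule assms)

lemma gaussian_entry_measurable:
  assumes "complex_gaussian_matrix P N G" "i < N" "j < N"
  shows "(\<lambda>\<omega>. G \<omega> $$ (i, j)) \<in> borel_measurable P"
  using assms distributed_measurable[of P lborel "\<lambda>\<omega>. G \<omega> $$ (i, j)"]
  unfolding complex_gaussian_matrix_def by auto

lemma gaussian_entry_distr:
  assumes "complex_gaussian_matrix P N G" "i < N" "j < N"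
  shows "distr P borel (\<lambda>\<omega>. G \<omega> $$ (i, j)) = cgauss"
proof -
  have "distributed P lborel (\<lambda>\<omega>. G \<omega> $$ (i, j)) (\<lambda>z. ennreal (std_complex_normal_density z))"
    using assms unfolding complex_gaussian_matrix_def by auto
  then have "distr P lborel (\<lambda>\<omega>. G \<omega> $$ (i, j)) = cgauss"
    unfolding cgauss_def by (rule distributed_distr_eq_density)
  then show ?thesis by (metis distr_cong sets_lborel)
qed

text \<open>Independence and the marginal laws determine the joint law, so expectations over the
  matrix become integrals over a product of complex Gaussians.\<close>

lemma gaussian_joint_distr:
  assumes P: "prob_space P" and G: "complex_gaussian_matrix P N G" and N: "N > 0"
  shows "distr P (PiM ({..<N} \<times> {..<N}) (\<lambda>_. borel)) (\<lambda>\<omega>. \<lambda>p\<in>{..<N} \<times> {..<N}. G \<omega> $$ p)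
    = PiM ({..<N} \<times> {..<N}) (\<lambda>_. cgauss)"
proof -
  interpret prob_space P by (rule P)
  let ?I = "{..<N} \<times> {..<N}"
  have "indep_vars (\<lambda>_. borel) (\<lambda>p \<omega>. G \<omega> $$ p) ?I"
    using G unfolding complex_gaussian_matrix_def by (simp add: split_beta')
  moreover have "?I \<noteq> {}" using N by auto
  moreover have "(\<lambda>\<omega>. G \<omega> $$ p) \<in> borel_measurable P" if "p \<in> ?I" for p
    using gaussian_entry_measurable[OF G] that by auto
  ultimately have "distr P (PiM ?I (\<lambda>_. borel)) (\<lambda>\<omega>. \<lambda>p\<in>?I. G \<omega> $$ p)
     = PiM ?I (\<lambda>p. distr P borel (\<lambda>\<omega>. G \<omega> $$ p))"
    by (subst (asm) indep_vars_iff_distr_eq_PiM') auto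
  also have "\<dots> = PiM ?I (\<lambda>_. cgauss)"
    using gaussian_entry_distr[OF G] by (intro PiM_cong) auto
  finally show ?thesis .
qed

text \<open>Subharmonicity for determinants: \<open>x'\<close> may differ from the deterministic
  part \<open>x\<close> in the entries of \<open>S\<close>. The scale \<open>a\<close> will be taken
  so large that \<open>lnp\<close> and \<open>ln\<close> agree on the relevant range.\<close>

lemma noisy_ndet_lower:
  fixes x x' :: "nat \<times> nat \<Rightarrow> complex"
  assumes P: "prob_space P" and G: "complex_gaussian_matrix P N G" and N: "N > 0" and \<delta>: "\<delta> \<noteq> 0"
    and S: "S \<subseteq> {..<N} \<times> {..<N}"
    and x': "\<And>p. p \<notin> S \<Longrightarrow> x' p = x p" "\<And>p. p \<in> S \<Longrightarrow> cmod (x' p - x p) \<le> D"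
    and a: "a > 0" and nz: "ndet N (\<lambda>i j. x' (i, j)) \<noteq> 0"
  shows "ennreal (ln (cmod (ndet N (\<lambda>i j. x' (i, j)))) + ln a)
    \<le> (\<integral>\<^sup>+\<omega>. ennreal (lnp (cmod (ndet N (\<lambda>i j. x (i, j) + \<delta> * G \<omega> $$ (i, j))) * a)) \<partial>P)
      + of_nat (card S) * entry_cost D (cmod \<delta>)"
proof -
  let ?I = "{..<N} \<times> {..<N}"
  interpret A: multiaffine "\<lambda>y. ndet N (\<lambda>i j. y (i, j)) * of_real a" \<delta>
    by (rule multiaffine_ndet[OF \<delta>])
  have finS: "finite S" using S by (rule finite_subset) auto
  have "ln (cmod (ndet N (\<lambda>i j. x' (i, j)))) + ln a = ln (cmod (ndet N (\<lambda>i j. x' (i, j))) * a)"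
    using nz a by (simp add: ln_mult_pos)
  also have "\<dots> \<le> lnp (cmod (ndet N (\<lambda>i j. x' (i, j)) * of_real a))"
    using nz a by (simp add: lnp_def norm_mult)
  finally have "ennreal (ln (cmod (ndet N (\<lambda>i j. x' (i, j)))) + ln a)
     \<le> ennreal (lnp (cmod (ndet N (\<lambda>i j. x' (i, j)) * of_real a)))" by (rule ennreal_leI)
  also have "\<dots> \<le> A.elnp ?I x + of_nat (card S) * entry_cost D (cmod \<delta>)"
    using S finS x' by (intro A.lnp_le_elnp_changed) auto
  also have "A.elnp ?I x = (\<integral>\<^sup>+\<omega>. ennreal (lnp (cmod (ndet N (\<lambda>i j. x (i, j) + \<delta> * G \<omega> $$ (i, j))) * a)) \<partial>P)"
  proof -
    have X: "(\<lambda>\<omega>. \<lambda>p\<in>?I. G \<omega> $$ p) \<in> P \<rightarrow>\<^sub>M PiM ?I (\<lambda>_. borel)"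
      using gaussian_entry_measurable[OF G] by (intro measurable_restrict) auto
    have s: "sets (PiM ?I (\<lambda>_. cgauss)) = sets (PiM ?I (\<lambda>_. borel))"
      by (intro sets_PiM_cong) auto
    have m: "(\<lambda>y. ennreal (lnp (cmod (ndet N (\<lambda>i j. A.noisy ?I x y (i, j)) * of_real a))))
      \<in> borel_measurable (PiM ?I (\<lambda>_. borel))"
      using A.measurable_noisy[of ?I x] by (simp cong: measurable_cong_sets[OF s refl] add: measurable_cong_sets[OF s refl])
    have "A.elnp ?I x = (\<integral>\<^sup>+\<omega>. ennreal (lnp (cmod (ndet N (\<lambda>i j. A.noisy ?I x (\<lambda>p\<in>?I. G \<omega> $$ p) (i, j)) * of_real a))) \<partial>P)"
      unfolding A.elnp_def gaussian_joint_distr[OF P G N, symmetric]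
      by (rule nn_integral_distr[OF X]) (use m in simp)
    moreover have "ndet N (\<lambda>i j. A.noisy ?I x (\<lambda>p\<in>?I. G \<omega> $$ p) (i, j)) = ndet N (\<lambda>i j. x (i, j) + \<delta> * G \<omega> $$ (i, j))" for \<omega>
      by (rule ndet_cong) (simp add: A.noisy_def)
    ultimately show ?thesis using a by (simp add: norm_mult)
  qed
  finally show ?thesis .
qed

text \<open>The elementary bound \<open>sqrt y \<le> N + y / N\<close> reduces the claim to second
  moments.\<close>

lemma expectation_frobenius_le:
  assumes P: "prob_space P" and G: "complex_gaussian_matrix P N G" and N: "N > 0"
  shows "(\<integral>\<^sup>+\<omega>. ennreal (sqrt (\<Sum>i<N. \<Sum>j<N. (cmod (G \<omega> $$ (i, j)))\<^sup>2)) \<partial>P) \<le> ennreal (5 * real N)"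
proof -
  interpret prob_space P by (rule P)
  let ?y = "\<lambda>\<omega>. \<Sum>i<N. \<Sum>j<N. (cmod (G \<omega> $$ (i, j)))\<^sup>2"
  have m: "(\<lambda>\<omega>. ennreal ((cmod (G \<omega> $$ (i, j)))\<^sup>2)) \<in> borel_measurable P" if "i < N" "j < N" for i j
    using gaussian_entry_measurable[OF G that] by measurable
  have [measurable]: "?y \<in> borel_measurable P"
    using gaussian_entry_measurable[OF G]
    by (intro borel_measurable_sum borel_measurable_power borel_measurable_norm) auto
  have sq: "sqrt y \<le> real N + y / real N" if "y \<ge> 0" for y
  proof -
    have "0 \<le> (real N)\<^sup>2 + (y / real N)\<^sup>2 + y" using that by simp
    then have "y \<le> (real N + y / real N)\<^sup>2" using N by (simp add: power2_sum)
    then show ?thesis using that by (intro real_le_lsqrt) auto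
  qed
  have "(\<integral>\<^sup>+\<omega>. ennreal (sqrt (?y \<omega>)) \<partial>P) \<le> (\<integral>\<^sup>+\<omega>. ennreal (real N) + ennreal (1 / real N) * ennreal (?y \<omega>) \<partial>P)"
  proof (rule nn_integral_mono)
    fix \<omega>
    have y0: "?y \<omega> \<ge> 0" by (intro sum_nonneg) auto
    have "ennreal (sqrt (?y \<omega>)) \<le> ennreal (real N + ?y \<omega> / real N)" by (rule ennreal_leI[OF sq[OF y0]])
    also have "\<dots> = ennreal (real N) + ennreal (1 / real N) * ennreal (?y \<omega>)"
      using y0 by (simp add: ennreal_mult[symmetric])
    finally show "ennreal (sqrt (?y \<omega>)) \<le> ennreal (real N) + ennreal (1 / real N) * ennreal (?y \<omega>)" .
  qed
  also have "\<dots> = ennreal (real N) + ennreal (1 / real N) * (\<integral>\<^sup>+\<omega>. ennreal (?y \<omega>) \<partial>P)"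
    by (subst nn_integral_add) (auto simp: nn_integral_cmult emeasure_space_1)
  also have "(\<integral>\<^sup>+\<omega>. ennreal (?y \<omega>) \<partial>P) = (\<Sum>i<N. \<Sum>j<N. \<integral>\<^sup>+\<omega>. ennreal ((cmod (G \<omega> $$ (i, j)))\<^sup>2) \<partial>P)"
  proof -
    have "ennreal (?y \<omega>) = (\<Sum>i<N. \<Sum>j<N. ennreal ((cmod (G \<omega> $$ (i, j)))\<^sup>2))" for \<omega>
      by (simp add: sum_ennreal sum_nonneg)
    then have "(\<integral>\<^sup>+\<omega>. ennreal (?y \<omega>) \<partial>P) = (\<integral>\<^sup>+\<omega>. (\<Sum>i<N. \<Sum>j<N. ennreal ((cmod (G \<omega> $$ (i, j)))\<^sup>2)) \<partial>P)"
      by (simp only:)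
    also have "\<dots> = (\<Sum>i<N. \<integral>\<^sup>+\<omega>. (\<Sum>j<N. ennreal ((cmod (G \<omega> $$ (i, j)))\<^sup>2)) \<partial>P)"
      by (rule nn_integral_sum) (intro borel_measurable_sum m, auto)
    also have "\<dots> = (\<Sum>i<N. \<Sum>j<N. \<integral>\<^sup>+\<omega>. ennreal ((cmod (G \<omega> $$ (i, j)))\<^sup>2) \<partial>P)"
      by (intro sum.cong refl nn_integral_sum m) auto
    finally show ?thesis .
  qed
  also have "\<dots> \<le> (\<Sum>i<N. \<Sum>j<N. 4)"
  proof (intro sum_mono)
    fix i j assume "i \<in> {..<N}" "j \<in> {..<N}"
    then have ij: "i < N" "j < N" by auto
    have "(\<integral>\<^sup>+\<omega>. ennreal ((cmod (G \<omega> $$ (i, j)))\<^sup>2) \<partial>P) = (\<integral>\<^sup>+z. ennreal ((cmod z)\<^sup>2) \<partial>distr P borel (\<lambda>\<omega>. G \<omega> $$ (i, j)))"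
      using gaussian_entry_measurable[OF G ij] by (subst nn_integral_distr) auto
    also have "\<dots> \<le> 4" unfolding gaussian_entry_distr[OF G ij] by (rule nn_integral_cgauss_norm_square)
    finally show "(\<integral>\<^sup>+\<omega>. ennreal ((cmod (G \<omega> $$ (i, j)))\<^sup>2) \<partial>P) \<le> 4" .
  qed
  also have "(\<Sum>i<N. \<Sum>j<N. 4 :: ennreal) = ennreal (4 * real N * real N)"
    by (simp add: ennreal_mult ennreal_of_nat_eq_real_of_nat mult_ac)
  finally have "(\<integral>\<^sup>+\<omega>. ennreal (sqrt (?y \<omega>)) \<partial>P) \<le> ennreal (real N) + ennreal (1 / real N) * ennreal (4 * real N * real N)"
    by (simp add: add_left_mono mult_left_mono)
  also have "\<dots> = ennreal (5 * real N)"
    using N by (simp add: ennreal_mult[symmetric] ennreal_plus[symmetric] del: ennreal_plus)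
  finally show ?thesis .
qed

text \<open>If \<open>ln \<Theta>\<close> has the pathwise upper bound \<open>U + w\<close> and
  \<open>U + w - ln \<Theta>\<close> has small expectation, then \<open>ln \<Theta>\<close> is close
  to any \<open>Y \<le> U\<close> near \<open>U\<close> in \<open>L\<^sup>1\<close>. The lower bound
  on the expectation of \<open>ln \<Theta>\<close> is given in the truncated form \<open>lnp
  (\<Theta> * exp k) - k\<close>, for every \<open>k\<close>, and Fatou's lemma passes to the limit.
  Integrability of \<open>ln \<Theta>\<close> is thus a consequence, not an assumption.\<close>

lemma log_deviation_le:
  fixes \<Theta> w :: "'w \<Rightarrow> real" and U L K Y :: real
  assumes P: "prob_space P"
    and [measurable]: "\<Theta> \<in> borel_measurable P" "w \<in> borel_measurable P"
    and \<Theta>0: "\<And>\<omega>. 0 \<le> \<Theta> \<omega>" and w0: "\<And>\<omega>. 0 \<le> w \<omega>"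
    and up: "\<And>\<omega>. \<omega> \<in> space P \<Longrightarrow> \<Theta> \<omega> \<noteq> 0 \<Longrightarrow> ln (\<Theta> \<omega>) \<le> U + w \<omega>"
    and low: "\<And>k :: nat. ennreal (L + real k) \<le> (\<integral>\<^sup>+\<omega>. ennreal (lnp (\<Theta> \<omega> * exp (real k))) \<partial>P) + ennreal K"
    and ord: "L \<le> U" "Y \<le> U" "0 \<le> K"
  shows "(\<integral>\<^sup>+\<omega>. ennreal \<bar>ln (\<Theta> \<omega>) - Y\<bar> \<partial>P)
    \<le> ennreal (U - L + K) + ennreal (U - Y) + 2 * (\<integral>\<^sup>+\<omega>. ennreal (w \<omega>) \<partial>P)"
proof -
  interpret prob_space P by (rule P)
  let ?W = "\<integral>\<^sup>+\<omega>. ennreal (w \<omega>) \<partial>P"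
  \<comment> \<open>The gap in the upper bound. For \<open>k\<close> large it is nonnegative and,
    unless \<open>\<Theta> \<omega> = 0\<close>, eventually equal to \<open>U + w \<omega> - ln
    (\<Theta> \<omega>)\<close>.\<close>
  define V where "V k \<omega> = ennreal (U + w \<omega> + real k - lnp (\<Theta> \<omega> * exp (real k)))" for k :: nat and \<omega>
  have [measurable]: "V k \<in> borel_measurable P" for k unfolding V_def by measurable
  obtain k0 :: nat where k0: "\<bar>U\<bar> + \<bar>L\<bar> \<le> real k0" using real_arch_simple by blast
  have le: "lnp (\<Theta> \<omega> * exp (real k)) \<le> U + w \<omega> + real k" if "k0 \<le> k" "\<omega> \<in> space P" for k \<omega>
  proof -
    have "\<bar>U\<bar> + \<bar>L\<bar> \<le> real k" using k0 that by linarith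
    then have "0 \<le> U + w \<omega> + real k" using w0[of \<omega>] by linarith
    moreover have "ln (\<Theta> \<omega> * exp (real k)) \<le> U + w \<omega> + real k" if "\<Theta> \<omega> \<noteq> 0"
      using up[OF \<open>\<omega> \<in> space P\<close> that] that \<Theta>0[of \<omega>] by (simp add: ln_mult_pos less_le)
    ultimately show ?thesis using \<Theta>0[of \<omega>] by (cases "\<Theta> \<omega> = 0") (auto simp: lnp_def max_def)
  qed
  have VC: "(\<integral>\<^sup>+\<omega>. V k \<omega> \<partial>P) \<le> ennreal (U - L + K) + ?W" if k: "k0 \<le> k" for k
  proof -
    let ?l = "\<integral>\<^sup>+\<omega>. ennreal (lnp (\<Theta> \<omega> * exp (real k))) \<partial>P"
    have nn: "0 \<le> U + real k" "0 \<le> L + real k" using k0 k by linarith+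
    have "(\<integral>\<^sup>+\<omega>. V k \<omega> \<partial>P) + ?l = (\<integral>\<^sup>+\<omega>. V k \<omega> + ennreal (lnp (\<Theta> \<omega> * exp (real k))) \<partial>P)"
      by (rule nn_integral_add[symmetric]) measurable
    also have "\<dots> = (\<integral>\<^sup>+\<omega>. ennreal (U + real k) + ennreal (w \<omega>) \<partial>P)"
      using le[OF k] nn w0 by (intro nn_integral_cong) (simp add: V_def algebra_simps flip: ennreal_plus)
    also have "\<dots> = ennreal (U + real k) + ?W"
      by (subst nn_integral_add) (auto simp: emeasure_space_1)
    finally have eq: "(\<integral>\<^sup>+\<omega>. V k \<omega> \<partial>P) + ?l = ennreal (U + real k) + ?W" .
    have "ennreal (L + real k) + (\<integral>\<^sup>+\<omega>. V k \<omega> \<partial>P) \<le> (?l + ennreal K) + (\<integral>\<^sup>+\<omega>. V k \<omega> \<partial>P)"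
      by (intro add_right_mono low)
    also have "\<dots> = ennreal (U + real k) + ?W + ennreal K"
      unfolding eq[symmetric] by (simp add: add_ac)
    also have "ennreal (U + real k) = ennreal (L + real k) + ennreal (U - L)"
      using nn ord by (subst ennreal_plus[symmetric]) auto
    also have "ennreal (L + real k) + ennreal (U - L) + ?W + ennreal K
        = ennreal (L + real k) + (ennreal (U - L + K) + ?W)"
      using ord by (simp add: add_ac)
    finally show ?thesis by (simp add: ennreal_add_left_cancel_le)
  qed
  have "(\<integral>\<^sup>+\<omega>. liminf (\<lambda>k. V k \<omega>) \<partial>P) \<le> liminf (\<lambda>k. \<integral>\<^sup>+\<omega>. V k \<omega> \<partial>P)"
    by (rule nn_integral_liminf) measurable
  also have "\<dots> \<le> limsup (\<lambda>k. \<integral>\<^sup>+\<omega>. V k \<omega> \<partial>P)" by (rule Liminf_le_Limsup) simp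
  also have "\<dots> \<le> ennreal (U - L + K) + ?W"
    using VC by (intro Limsup_bounded) (auto simp: eventually_sequentially)
  finally have fatou: "(\<integral>\<^sup>+\<omega>. liminf (\<lambda>k. V k \<omega>) \<partial>P) \<le> ennreal (U - L + K) + ?W" .
  have "(\<integral>\<^sup>+\<omega>. ennreal \<bar>ln (\<Theta> \<omega>) - Y\<bar> \<partial>P)
     \<le> (\<integral>\<^sup>+\<omega>. liminf (\<lambda>k. V k \<omega>) + (ennreal (U - Y) + ennreal (w \<omega>)) \<partial>P)"
  proof (rule nn_integral_mono)
    fix \<omega> assume \<omega>: "\<omega> \<in> space P"
    show "ennreal \<bar>ln (\<Theta> \<omega>) - Y\<bar> \<le> liminf (\<lambda>k. V k \<omega>) + (ennreal (U - Y) + ennreal (w \<omega>))"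
    proof (cases "\<Theta> \<omega> = 0")
      case True
      \<comment> \<open>At a zero of \<open>\<Theta>\<close> the right-hand side is infinite, so the
        default value \<open>ln 0\<close> is harmless.\<close>
      have "(\<lambda>k. V k \<omega>) \<longlonglongrightarrow> \<infinity>"
      proof -
        have "filterlim (\<lambda>k. (U + w \<omega>) + real k) at_top sequentially"
          by (intro filterlim_tendsto_add_at_top[OF tendsto_const] filterlim_real_sequentially)
        then show ?thesis unfolding V_def True
          by (simp add: lnp_def ennreal_tendsto_top_eq_at_top)
      qed
      then have "liminf (\<lambda>k. V k \<omega>) = \<infinity>" by (intro lim_imp_Liminf) auto
      then show ?thesis by simp
    next
      case False
      with \<Theta>0[of \<omega>] have pos: "\<Theta> \<omega> > 0" by simp
      obtain k1 :: nat where k1: "\<bar>ln (\<Theta> \<omega>)\<bar> \<le> real k1" using real_arch_simple by blast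
      have "eventually (\<lambda>k. V k \<omega> = ennreal (U + w \<omega> - ln (\<Theta> \<omega>))) sequentially"
        using eventually_ge_at_top[of k1]
      proof eventually_elim
        case (elim k)
        have l: "ln (\<Theta> \<omega> * exp (real k)) = ln (\<Theta> \<omega>) + real k" using pos by (simp add: ln_mult_pos)
        also have "\<dots> \<ge> 0" using k1 elim by linarith
        finally have "1 \<le> \<Theta> \<omega> * exp (real k)" using pos by (subst (asm) ln_ge_zero_iff) auto
        then show ?case using l by (simp add: V_def lnp_def max_def)
      qed
      then have "(\<lambda>k. V k \<omega>) \<longlonglongrightarrow> ennreal (U + w \<omega> - ln (\<Theta> \<omega>))" by (rule tendsto_eventually)
      then have "liminf (\<lambda>k. V k \<omega>) = ennreal (U + w \<omega> - ln (\<Theta> \<omega>))" by (intro lim_imp_Liminf) auto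
      moreover have "\<bar>ln (\<Theta> \<omega>) - Y\<bar> \<le> (U + w \<omega> - ln (\<Theta> \<omega>)) + ((U - Y) + w \<omega>)" and "ln (\<Theta> \<omega>) \<le> U + w \<omega>"
        using up[OF \<omega> False] ord w0[of \<omega>] by (auto simp: abs_if)
      ultimately show ?thesis
        using ord w0[of \<omega>] by (simp add: ennreal_leI flip: ennreal_plus)
    qed
  qed
  also have "\<dots> = (\<integral>\<^sup>+\<omega>. liminf (\<lambda>k. V k \<omega>) \<partial>P) + (ennreal (U - Y) + ?W)"
    by (subst nn_integral_add) (auto simp: nn_integral_add emeasure_space_1)
  also have "\<dots> \<le> (ennreal (U - L + K) + ?W) + (ennreal (U - Y) + ?W)"
    by (intro add_right_mono fatou)
  also have "\<dots> = ennreal (U - L + K) + ennreal (U - Y) + 2 * ?W"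
    unfolding mult_2 by (simp add: add_ac)
  finally show ?thesis .
qed

section \<open>Block-circulant approximation of a band matrix\<close>

lemma sum_if_eq_le:
  fixes c :: "'l \<Rightarrow> real"
  assumes "finite L" "finite J" "\<And>l. l \<in> L \<Longrightarrow> 0 \<le> c l"
  shows "(\<Sum>j\<in>J. \<Sum>l\<in>L. if j = t l then c l else 0) \<le> (\<Sum>l\<in>L. c l)"
proof -
  have "(\<Sum>j\<in>J. \<Sum>l\<in>L. if j = t l then c l else 0) = (\<Sum>l\<in>L. \<Sum>j\<in>J. if j = t l then c l else 0)"
    by (rule sum.swap)
  also have "\<dots> \<le> (\<Sum>l\<in>L. c l)"
    using assms by (intro sum_mono) (simp add: sum.delta)
  finally show ?thesis .
qed

lemma cmod_sum_if_le: "cmod (\<Sum>l\<in>L. if P l then a l else 0) \<le> (\<Sum>l\<in>L. if P l then cmod (a l) else 0)"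
  by (rule sum_norm_le) simp

lemma cis_mod_period:
  assumes "m > 0"
  shows "cis (2 * pi * (real (n mod m) * real b) / real m) = cis (2 * pi * (real n * real b) / real m)"
proof -
  have "real n = real (n mod m) + real m * real (n div m)"
    by (metis add.commute mult_div_mod_eq of_nat_add of_nat_mult)
  then have "2 * pi * (real n * real b) / real m
     = 2 * pi * (real (n mod m) * real b) / real m + 2 * pi * real (n div m * b)"
    using assms by (simp add: field_simps)
  then have "cis (2 * pi * (real n * real b) / real m)
     = cis (2 * pi * (real (n mod m) * real b) / real m) * cis (2 * pi * real (n div m * b))"
    by (simp only: cis_mult)
  also have "cis (2 * pi * real (n div m * b)) = 1"
    using cis_multiple_2pi[of "real (n div m * b)"] by simp
  finally show ?thesis by simp
qed

text \<open>Orthogonality of the characters of the cyclic group of order \<open>m\<close>.\<close>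

lemma sum_roots_of_unity:
  assumes m: "m > 0" and a: "a < m" and b: "b < m"
  shows "(\<Sum>k<m. cis (2 * pi * (real k * real b) / real m) * cnj (cis (2 * pi * (real k * real a) / real m)))
    = (if a = b then of_nat m else 0)"
proof (cases "a = b")
  case True
  then show ?thesis by (simp add: cis_cnj cis_mult)
next
  case False
  define \<zeta> where "\<zeta> = cis (2 * pi * (real b - real a) / real m)"
  have t: "cis (2 * pi * (real k * real b) / real m) * cnj (cis (2 * pi * (real k * real a) / real m)) = \<zeta> ^ k" for k
    unfolding \<zeta>_def Complex.DeMoivre cis_cnj cis_mult
    by (rule arg_cong[where f = cis]) (use m in \<open>simp add: field_simps\<close>)
  have "\<zeta> ^ m = cis (2 * pi * (real b - real a))"
    using m by (simp add: \<zeta>_def Complex.DeMoivre)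
  also have "\<dots> = 1" using cis_multiple_2pi[of "real b - real a"] by simp
  finally have zm: "\<zeta> ^ m = 1" .
  have "\<zeta> \<noteq> 1"
  proof
    assume "\<zeta> = 1"
    then have "cos (2 * pi * (real b - real a) / real m) = 1"
      by (metis Re_complex_of_real cis.sel(1) of_real_1 \<zeta>_def)
    then obtain n :: int where "2 * pi * (real b - real a) / real m = real_of_int n * 2 * pi"
      using cos_one_2pi_int by auto
    then have "(2 * pi) * (real b - real a) = (2 * pi) * (real_of_int n * real m)"
      using m by (simp add: divide_eq_eq mult_ac)
    then have "real b - real a = real_of_int n * real m" by (subst (asm) mult_cancel_left) simp
    then have "real_of_int (int b - int a) = real_of_int (n * int m)" by simp
    then have "int b - int a = n * int m" by (simp only: of_int_eq_iff)
    moreover have "\<bar>int b - int a\<bar> < int m" using a b by linarith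
    ultimately have "\<bar>n\<bar> * int m < 1 * int m" by (simp add: abs_mult)
    then have "n = 0" using m by (simp only: mult_less_cancel_right) linarith
    with \<open>int b - int a = n * int m\<close> False show False by simp
  qed
  then have "(\<Sum>k<m. \<zeta> ^ k) = 0" using zm by (simp add: geometric_sum)
  then show ?thesis using False by (simp only: t) simp
qed

text \<open>The index set is cut into \<open>N div m\<close> blocks of length \<open>m\<close>,
  leaving fewer than \<open>m\<close> indices over. The number \<open>S\<close> bounds the
  coefficients and \<open>h\<close> bounds the oscillation of each of them within a block.\<close>

locale block_structure =
  fixes N d m :: nat and f :: "nat \<Rightarrow> real \<Rightarrow> complex" and S h :: real
  assumes m: "d < m" "m \<le> N"
    and S: "\<And>x. x \<in> {0..1} \<Longrightarrow> (\<Sum>l\<le>d. cmod (f l x)) \<le> S"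
    and h: "\<And>l x y. l \<le> d \<Longrightarrow> x \<in> {0..1} \<Longrightarrow> y \<in> {0..1} \<Longrightarrow> \<bar>x - y\<bar> \<le> real m / real N \<Longrightarrow> cmod (f l x - f l y) \<le> h"
begin

definition q :: nat where "q = N div m"

text \<open>The cyclic shift by \<open>l\<close> within the block of \<open>i\<close>.\<close>

definition cyc :: "nat \<Rightarrow> nat \<Rightarrow> nat" where
  "cyc l i = (i div m) * m + (i mod m + l) mod m"

text \<open>The left end of the block of \<open>i\<close> in the unit interval. Coefficients sampled
  there are constant on blocks, whereas \<open>pt\<close> is the point at which the band matrix
  itself samples them.\<close>

definition node :: "nat \<Rightarrow> real" where "node i = real (i div m * m) / real N"

definition pt :: "nat \<Rightarrow> real" where "pt i = real (i + 1) / real N"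

definition band :: "nat \<Rightarrow> nat \<Rightarrow> complex" where
  "band i j = (\<Sum>l\<le>d. if j = i + l then f l (pt i) else 0)"

text \<open>The band matrix with its shifts made cyclic within blocks, the coefficients of row
  \<open>i\<close> sampled at \<open>p i\<close>, and zero rows for the indices left over. For
  \<open>p = node\<close> it is block-circulant, hence normal; for \<open>p = pt\<close> it agrees
  with the band matrix away from the last \<open>d\<close> rows of each block and the indices left
  over.\<close>

definition cmat :: "(nat \<Rightarrow> real) \<Rightarrow> nat \<Rightarrow> nat \<Rightarrow> complex" where
  "cmat p i j = (if i < q * m then \<Sum>l\<le>d. if j = cyc l i then f l (p i) else 0 else 0)"

text \<open>The unitary discrete Fourier transform on each block, and the identity on the indices
  left over.\<close>

definition W :: "nat \<Rightarrow> nat \<Rightarrow> complex" where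
  "W i j = (if i < q * m \<and> j < q * m
     then if i div m = j div m then cis (2 * pi * (real (i mod m) * real (j mod m)) / real m) / of_real (sqrt (real m)) else 0
     else if i = j then 1 else 0)"

definition ev :: "nat \<Rightarrow> complex" where
  "ev j = (if j < q * m then \<Sum>l\<le>d. f l (node j) * cis (2 * pi * (real l * real (j mod m)) / real m) else 0)"

definition e :: real where "e = real (d + 1) * h"

lemma m0: "m > 0" and N0: "N > 0"
  using m by auto

lemma qm: "q * m \<le> N" "N < q * m + m"
  using div_mult_mod_eq[of N m] mod_less_divisor[OF m0, of N] unfolding q_def by linarith+

lemma S0: "S \<ge> 0"
  by (rule order.trans[OF _ S[of 0]]) (auto intro: sum_nonneg)

lemma h0: "h \<ge> 0"
  using h[of 0 0 0] m by (auto intro: order.trans[OF norm_ge_zero])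

lemma e0: "e \<ge> 0"
  using h0 by (simp add: e_def)

lemma div_less_q: "i < q * m \<longleftrightarrow> i div m < q"
  using m0 by (simp add: div_less_iff_less_mult)

lemma cyc_div [simp]: "cyc l i div m = i div m"
  using m0 by (simp add: cyc_def)

lemma cyc_mod [simp]: "cyc l i mod m = (i mod m + l) mod m"
  using m0 by (simp add: cyc_def)

lemma cyc_less: "i < q * m \<Longrightarrow> cyc l i < q * m"
  unfolding div_less_q by simp

lemma cyc_inj: "cyc l i = cyc l i' \<Longrightarrow> i = i'"
proof -
  assume eq: "cyc l i = cyc l i'"
  then have d: "i div m = i' div m" by (metis cyc_div)
  have "(i mod m + l) mod m = (i' mod m + l) mod m" using eq by (metis cyc_mod)
  then have "int (i mod m + l) mod int m = int (i' mod m + l) mod int m" by (simp only: zmod_int[symmetric])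
  then have "int (i mod m) mod int m = int (i' mod m) mod int m" by (simp only: mod_eq_dvd_iff) simp
  then have "i mod m = i' mod m" by (simp add: zmod_int[symmetric])
  with d show ?thesis by (metis div_mult_mod_eq)
qed

lemma cyc_eq_add: "i mod m + l < m \<Longrightarrow> cyc l i = i + l"
  unfolding cyc_def by simp

lemma node_in: "i < N \<Longrightarrow> node i \<in> {0..1}"
proof -
  assume "i < N"
  then have "i div m * m \<le> N" by (meson div_times_less_eq_dividend less_imp_le order.trans)
  then have "real (i div m * m) \<le> real N" by (simp only: of_nat_le_iff)
  then show ?thesis using N0 by (simp add: node_def del: of_nat_mult)
qed

lemma pt_in: "i < N \<Longrightarrow> pt i \<in> {0..1}"
  by (simp add: pt_def)

lemma pt_node: "\<bar>pt i - node i\<bar> \<le> real m / real N"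
proof -
  have "i + 1 \<le> i div m * m + m" "i div m * m \<le> i + 1"
    using m0 mod_less_divisor[OF m0, of i] div_mult_mod_eq[of i m] by linarith+
  then have "real (i + 1) \<le> real (i div m * m) + real m" "real (i div m * m) \<le> real (i + 1)"
    by (metis of_nat_add of_nat_le_iff)+
  then have "\<bar>real (i + 1) - real (i div m * m)\<bar> \<le> real m" by linarith
  moreover have "pt i - node i = (real (i + 1) - real (i div m * m)) / real N"
    by (simp add: pt_def node_def diff_divide_distrib)
  ultimately show ?thesis by (simp only: abs_divide) (simp add: divide_right_mono)
qed

lemma band_row: "i < N \<Longrightarrow> (\<Sum>j<N. cmod (band i j)) \<le> S"
proof -
  assume i: "i < N"
  have "(\<Sum>j<N. cmod (band i j)) \<le> (\<Sum>j<N. \<Sum>l\<le>d. if j = i + l then cmod (f l (pt i)) else 0)"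
    unfolding band_def by (intro sum_mono cmod_sum_if_le)
  also have "\<dots> \<le> (\<Sum>l\<le>d. cmod (f l (pt i)))" by (rule sum_if_eq_le) auto
  also have "\<dots> \<le> S" by (rule S[OF pt_in[OF i]])
  finally show ?thesis .
qed

lemma cmat_row: "p i \<in> {0..1} \<Longrightarrow> (\<Sum>j<N. cmod (cmat p i j)) \<le> S"
proof -
  assume i: "p i \<in> {0..1}"
  have "(\<Sum>j<N. cmod (cmat p i j)) \<le> (\<Sum>j<N. \<Sum>l\<le>d. if j = cyc l i then cmod (f l (p i)) else 0)"
    unfolding cmat_def by (intro sum_mono) (auto intro: cmod_sum_if_le sum_nonneg)
  also have "\<dots> \<le> (\<Sum>l\<le>d. cmod (f l (p i)))" by (rule sum_if_eq_le) auto
  also have "\<dots> \<le> S" by (rule S[OF i])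
  finally show ?thesis .
qed

lemma entry_le_S: "(\<Sum>j<N. cmod (a j)) \<le> S \<Longrightarrow> j < N \<Longrightarrow> cmod (a j) \<le> S"
  using member_le_sum[of j "{..<N}" "\<lambda>j. cmod (a j)"] by fastforce

lemma cmat_diff:
  assumes "i < N"
  shows "cmod (cmat pt i j - cmat node i j) \<le> (\<Sum>l\<le>d. if i < q * m \<and> j = cyc l i then h else 0)"
proof -
  have eq: "cmat pt i j - cmat node i j = (\<Sum>l\<le>d. if i < q * m \<and> j = cyc l i then f l (pt i) - f l (node i) else 0)"
    unfolding cmat_def by (auto simp: sum_subtractf[symmetric] intro!: sum.cong)
  have "cmod (cmat pt i j - cmat node i j) \<le> (\<Sum>l\<le>d. if i < q * m \<and> j = cyc l i then cmod (f l (pt i) - f l (node i)) else 0)"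
    unfolding eq by (rule cmod_sum_if_le)
  also have "\<dots> \<le> (\<Sum>l\<le>d. if i < q * m \<and> j = cyc l i then h else 0)"
    using h[OF _ pt_in[OF assms] node_in[OF assms] pt_node] by (intro sum_mono) auto
  finally show ?thesis .
qed

text \<open>Moving the sampling points within a block is a small perturbation in operator norm, by
  way of the bounds on absolute row and column sums.\<close>

lemma cmat_diff_row: "i < N \<Longrightarrow> (\<Sum>j<N. cmod (cmat pt i j - cmat node i j)) \<le> e"
proof -
  assume i: "i < N"
  have "(\<Sum>j<N. cmod (cmat pt i j - cmat node i j)) \<le> (\<Sum>j<N. \<Sum>l\<le>d. if j = cyc l i then h else 0)"
    using h0 by (intro sum_mono order.trans[OF cmat_diff[OF i]]) auto
  also have "\<dots> \<le> (\<Sum>l\<le>d. h)" using h0 by (intro sum_if_eq_le) auto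
  finally show ?thesis by (simp add: e_def)
qed

lemma cmat_diff_col: "(\<Sum>i<N. cmod (cmat pt i j - cmat node i j)) \<le> e"
proof -
  have "(\<Sum>i<N. cmod (cmat pt i j - cmat node i j)) \<le> (\<Sum>i<N. \<Sum>l\<le>d. if j = cyc l i then h else 0)"
    using h0 by (intro sum_mono order.trans[OF cmat_diff]) (auto intro!: sum_mono)
  also have "\<dots> = (\<Sum>l\<le>d. \<Sum>i<N. if j = cyc l i then h else 0)" by (rule sum.swap)
  also have "\<dots> \<le> (\<Sum>l\<le>d. h)"
  proof (rule sum_mono)
    fix l
    have eq: "(\<Sum>i<N. if j = cyc l i then h else 0) = real (card {i\<in>{..<N}. j = cyc l i}) * h"
      by (subst sum.inter_filter[symmetric]) auto
    have "\<forall>a\<in>{i\<in>{..<N}. j = cyc l i}. \<forall>b\<in>{i\<in>{..<N}. j = cyc l i}. a = b"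
      by (auto dest: cyc_inj)
    then have "card {i\<in>{..<N}. j = cyc l i} \<le> Suc 0"
      by (rule card_le_Suc0_iff_eq[THEN iffD2, rotated]) simp
    then have "real (card {i\<in>{..<N}. j = cyc l i}) \<le> 1" by simp
    then show "(\<Sum>i<N. if j = cyc l i then h else 0) \<le> h"
      using h0 mult_right_mono[of "real (card {i\<in>{..<N}. j = cyc l i})" 1 h] unfolding eq by simp
  qed
  finally show ?thesis by (simp add: e_def)
qed

lemma W_sym: "W i j = W j i"
  by (auto simp: W_def mult.commute)

lemma sum_block:
  fixes g :: "nat \<Rightarrow> complex"
  assumes I: "I < q"
  shows "(\<Sum>k<N. if k < q * m \<and> k div m = I then g (k mod m) else 0) = (\<Sum>a<m. g a)"
proof -
  have "(\<Sum>k<N. if k < q * m \<and> k div m = I then g (k mod m) else 0)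
     = (\<Sum>k\<in>{k\<in>{..<N}. k < q * m \<and> k div m = I}. g (k mod m))"
    by (rule sum.inter_filter[symmetric]) simp
  also have "\<dots> = (\<Sum>a<m. g a)"
  proof (rule sum.reindex_bij_witness[of _ "\<lambda>a. I * m + a" "\<lambda>k. k mod m"])
    fix a assume a: "a \<in> {..<m}"
    then have "(I * m + a) div m = I" by simp
    moreover from this have "I * m + a < q * m" using I by (simp add: div_less_q)
    ultimately show "I * m + a \<in> {k \<in> {..<N}. k < q * m \<and> k div m = I}" using qm by auto
  next
    fix k assume "k \<in> {k \<in> {..<N}. k < q * m \<and> k div m = I}"
    then show "I * m + k mod m = k" by (auto simp: div_mult_mod_eq)
  qed (use m0 in auto)
  finally show ?thesis .
qed

lemma W_unitary:
  assumes ij: "i < N" "j < N"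
  shows "(\<Sum>k<N. cnj (W k i) * W k j) = (if i = j then 1 else 0)"
proof (cases "i < q * m \<and> j < q * m \<and> i div m = j div m")
  case True
  let ?g = "\<lambda>k. cis (2 * pi * (real k * real (j mod m)) / real m) * cnj (cis (2 * pi * (real k * real (i mod m)) / real m)) / of_nat m"
  have sq: "complex_of_real (sqrt (real m)) * complex_of_real (sqrt (real m)) = of_nat m"
    by (simp flip: of_real_mult)
  have "(\<Sum>k<N. cnj (W k i) * W k j) = (\<Sum>k<N. if k < q * m \<and> k div m = i div m then ?g (k mod m) else 0)"
    using True sq by (intro sum.cong refl) (auto simp: W_def mult.commute)
  also have "\<dots> = (\<Sum>a<m. ?g a)" using True by (intro sum_block) (simp add: div_less_q)
  also have "\<dots> = (if i mod m = j mod m then of_nat m else 0) / of_nat m"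
    using sum_roots_of_unity[OF m0, of "i mod m" "j mod m"] m0 by (simp add: sum_divide_distrib[symmetric])
  also have "\<dots> = (if i = j then 1 else 0)"
  proof -
    have "i mod m = j mod m \<longleftrightarrow> i = j" using True by (metis div_mult_mod_eq)
    then show ?thesis using m0 by simp
  qed
  finally show ?thesis .
next
  case False
  have "cnj (W k i) * W k j = (if k = i \<and> i = j then 1 else 0)" for k
  proof (cases "i < q * m \<and> j < q * m")
    case True
    with False have ne: "i div m \<noteq> j div m" by blast
    then have "i \<noteq> j" by blast
    moreover have "W k i = 0 \<or> W k j = 0"
      using True ne by (cases "k div m = i div m") (simp_all add: W_def)
    ultimately show ?thesis by auto
  next
    case out: False
    show ?thesis
      using out by (cases "k < q * m"; cases "i < q * m"; cases "j < q * m") (simp_all add: W_def)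
  qed
  then have "(\<Sum>k<N. cnj (W k i) * W k j) = (\<Sum>k<N. if k = i then (if i = j then 1 else 0) else 0)"
    by (intro sum.cong) auto
  then show ?thesis using ij by simp
qed

lemma W_unitary':
  assumes ij: "i < N" "j < N"
  shows "(\<Sum>k<N. W i k * cnj (W j k)) = (if i = j then 1 else 0)"
  using W_unitary[OF ij(2,1)] by (simp add: W_sym[of i] W_sym[of j] mult.commute)

text \<open>A cyclic shift by \<open>l\<close> multiplies the \<open>b\<close>-th Fourier mode by
  \<open>cis (2 * pi * l * b / m)\<close>, and on a block the coefficients sampled at
  \<open>node\<close> are scalars.\<close>

lemma cmat_diag:
  assumes ij: "i < N" "j < N"
  shows "(\<Sum>k<N. cmat node i k * W k j) = W i j * ev j"
proof (cases "i < q * m")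
  case False
  then have "cmat node i k = 0" for k by (simp add: cmat_def)
  moreover have "W i j * ev j = 0" using False by (auto simp: W_def ev_def)
  ultimately show ?thesis by simp
next
  case True
  have "(\<Sum>k<N. cmat node i k * W k j) = (\<Sum>k<N. \<Sum>l\<le>d. if k = cyc l i then f l (node i) * W k j else 0)"
    using True by (intro sum.cong refl) (auto simp: cmat_def sum_distrib_right intro!: sum.cong)
  also have "\<dots> = (\<Sum>l\<le>d. \<Sum>k<N. if k = cyc l i then f l (node i) * W k j else 0)" by (rule sum.swap)
  also have "\<dots> = (\<Sum>l\<le>d. f l (node i) * W (cyc l i) j)"
    using cyc_less[OF True] qm(1) by (intro sum.cong refl) (auto simp: sum.delta dest: less_le_trans)
  also have "\<dots> = W i j * ev j"
  proof (cases "j < q * m \<and> i div m = j div m")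
    case same: True
    have "W (cyc l i) j = W i j * cis (2 * pi * (real l * real (j mod m)) / real m)" for l
    proof -
      have "cis (2 * pi * (real ((i mod m + l) mod m) * real (j mod m)) / real m)
        = cis (2 * pi * (real (i mod m + l) * real (j mod m)) / real m)"
        by (rule cis_mod_period[OF m0])
      also have "\<dots> = cis (2 * pi * (real (i mod m) * real (j mod m)) / real m) * cis (2 * pi * (real l * real (j mod m)) / real m)"
        by (simp add: cis_mult add_divide_distrib algebra_simps)
      finally show ?thesis using same True cyc_less[OF True] by (simp add: W_def)
    qed
    moreover have "node i = node j" using same by (simp add: node_def)
    ultimately show ?thesis using same by (simp add: ev_def sum_distrib_left mult_ac)
  next
    case False
    then have "W (cyc l i) j = 0" for l
      using True cyc_less[OF True] by (auto simp: W_def)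
    moreover have "W i j = 0" using False True by (auto simp: W_def)
    ultimately show ?thesis by simp
  qed
  finally show ?thesis .
qed

lemma cmod_ev: "j < N \<Longrightarrow> cmod (ev j) \<le> S"
proof -
  assume j: "j < N"
  have "cmod (\<Sum>l\<le>d. f l (node j) * cis (2 * pi * (real l * real (j mod m)) / real m)) \<le> (\<Sum>l\<le>d. cmod (f l (node j)))"
    by (rule sum_norm_le) (simp add: norm_mult)
  also have "\<dots> \<le> S" by (rule S[OF node_in[OF j]])
  finally show ?thesis using S0 by (simp add: ev_def)
qed

end

section \<open>The comparison matrix at a spectral parameter\<close>

context block_structure
begin

text \<open>Goodness depends on the block of \<open>i\<close> only: no eigenvalue of that block is
  within \<open>s\<close> of \<open>z\<close>.\<close>

definition good :: "complex \<Rightarrow> real \<Rightarrow> nat \<Rightarrow> bool" where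
  "good z s i \<longleftrightarrow> i < q * m \<and> (\<forall>j<q * m. j div m = i div m \<longrightarrow> s \<le> cmod (z - ev j))"

definition near :: "complex \<Rightarrow> real \<Rightarrow> nat set" where
  "near z s = {j. j < q * m \<and> cmod (z - ev j) < s}"

lemma good_block: "i < q * m \<Longrightarrow> j < q * m \<Longrightarrow> i div m = j div m \<Longrightarrow> good z s i \<longleftrightarrow> good z s j"
  by (simp add: good_def)

lemma card_block: "card {i. i < q * m \<and> i div m = I} \<le> m"
proof -
  have "{i. i < q * m \<and> i div m = I} \<subseteq> (\<lambda>a. I * m + a) ` {..<m}"
  proof
    fix i assume "i \<in> {i. i < q * m \<and> i div m = I}"
    then have I: "i div m = I" by simp
    have "i = I * m + i mod m" unfolding I[symmetric] by (rule div_mult_mod_eq[symmetric])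
    then show "i \<in> (\<lambda>a. I * m + a) ` {..<m}" using m0 by (intro image_eqI[of _ _ "i mod m"]) auto
  qed
  then have "card {i. i < q * m \<and> i div m = I} \<le> card ((\<lambda>a. I * m + a) ` {..<m})"
    by (intro card_mono) auto
  also have "\<dots> \<le> m" using card_image_le[of "{..<m}" "\<lambda>a. I * m + a"] by simp
  finally show ?thesis .
qed

text \<open>One eigenvalue near \<open>z\<close> spoils a whole block of \<open>m\<close>
  indices.\<close>

lemma card_bad: "card {i. i < N \<and> \<not> good z s i} \<le> m + m * card (near z s)"
proof -
  have fin: "finite (near z s)" by (simp add: near_def)
  have "{i. i < N \<and> \<not> good z s i} \<subseteq> {q * m..<N} \<union> (\<Union>j\<in>near z s. {i. i < q * m \<and> i div m = j div m})"
    by (auto simp: good_def near_def not_le)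
  then have "card {i. i < N \<and> \<not> good z s i}
     \<le> card ({q * m..<N} \<union> (\<Union>j\<in>near z s. {i. i < q * m \<and> i div m = j div m}))"
    using fin by (intro card_mono) auto
  also have "\<dots> \<le> card {q * m..<N} + card (\<Union>j\<in>near z s. {i. i < q * m \<and> i div m = j div m})"
    by (rule card_Un_le)
  also have "card (\<Union>j\<in>near z s. {i. i < q * m \<and> i div m = j div m}) \<le> (\<Sum>j\<in>near z s. card {i. i < q * m \<and> i div m = j div m})"
    by (rule card_UN_le[OF fin])
  also have "\<dots> \<le> (\<Sum>j\<in>near z s. m)" by (intro sum_mono card_block)
  also have "card {q * m..<N} \<le> m" using qm(2) by simp
  finally show ?thesis by (simp add: mult.commute)
qed

lemma card_boundary: "card {i. i < q * m \<and> m \<le> i mod m + d} \<le> d * q"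
proof -
  have "{i. i < q * m \<and> m \<le> i mod m + d} \<subseteq> (\<lambda>(a, I). I * m + a) ` ({m - d..<m} \<times> {..<q})"
  proof
    fix i assume i: "i \<in> {i. i < q * m \<and> m \<le> i mod m + d}"
    then have "i = (\<lambda>(a, I). I * m + a) (i mod m, i div m)" by (simp add: div_mult_mod_eq)
    moreover have "(i mod m, i div m) \<in> {m - d..<m} \<times> {..<q}" using i m0 by (auto simp: div_less_q)
    ultimately show "i \<in> (\<lambda>(a, I). I * m + a) ` ({m - d..<m} \<times> {..<q})" by (rule image_eqI)
  qed
  then have "card {i. i < q * m \<and> m \<le> i mod m + d} \<le> card ((\<lambda>(a, I). I * m + a) ` ({m - d..<m} \<times> {..<q}))"
    by (intro card_mono) auto
  also have "\<dots> \<le> card ({m - d..<m} \<times> {..<q})" by (rule card_image_le) simp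
  also have "\<dots> = d * q" using m(1) by simp
  finally show ?thesis .
qed

definition bad_rows :: "complex \<Rightarrow> real \<Rightarrow> nat set" where
  "bad_rows z s = {i. i < N \<and> \<not> good z s i} \<union> {i. i < q * m \<and> m \<le> i mod m + d}"

lemma card_bad_rows: "card (bad_rows z s) \<le> d * q + m + m * card (near z s)"
  using card_Un_le[of "{i. i < N \<and> \<not> good z s i}" "{i. i < q * m \<and> m \<le> i mod m + d}"]
    card_bad[of z s] card_boundary unfolding bad_rows_def by linarith

lemma band_eq_cmat:
  assumes "i < q * m" "\<not> m \<le> i mod m + d"
  shows "band i j = cmat pt i j"
proof -
  have "cyc l i = i + l" if "l \<le> d" for l using assms that by (intro cyc_eq_add) linarith
  then show ?thesis using assms by (auto simp: band_def cmat_def intro!: sum.cong)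
qed

text \<open>This matrix agrees with \<open>z - M\<close> on most rows and is well conditioned: good
  blocks carry the cyclic version of \<open>z - M\<close>, everything else is replaced by the
  identity.\<close>

definition comp :: "complex \<Rightarrow> real \<Rightarrow> nat \<Rightarrow> nat \<Rightarrow> complex" where
  "comp z s i j = (if good z s i then (if i = j then z else 0) - cmat pt i j else if i = j then 1 else 0)"

text \<open>The entries of \<open>z - M\<close>, where \<open>M\<close> is the band matrix.\<close>

definition shifted_entry :: "complex \<Rightarrow> nat \<Rightarrow> nat \<Rightarrow> complex" where
  "shifted_entry z i j = (if i = j then z else 0) - band i j"

definition changed :: "complex \<Rightarrow> real \<Rightarrow> (nat \<times> nat) set" where
  "changed z s = {(i, j). i < N \<and> j < N \<and> comp z s i j \<noteq> shifted_entry z i j}"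

text \<open>The two matrices differ on bad rows only, and every row of either has few nonzero
  entries.\<close>

lemma card_changed: "card (changed z s) \<le> card (bad_rows z s) * (2 * d + 3)"
proof -
  let ?T = "\<lambda>i. {i} \<union> (\<lambda>l. i + l) ` {..d} \<union> (\<lambda>l. cyc l i) ` {..d}"
  have fin: "finite (bad_rows z s)" by (simp add: bad_rows_def)
  have "changed z s \<subseteq> (SIGMA i:bad_rows z s. ?T i)"
  proof safe
    fix i j assume "(i, j) \<in> changed z s"
    then have ij: "i < N" "comp z s i j \<noteq> shifted_entry z i j" by (auto simp: changed_def)
    show "i \<in> bad_rows z s"
    proof (rule ccontr)
      assume "i \<notin> bad_rows z s"
      then have g: "good z s i" and b: "\<not> m \<le> i mod m + d" using ij by (auto simp: bad_rows_def good_def)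
      from g have "i < q * m" by (simp add: good_def)
      with g b ij show False by (simp add: comp_def shifted_entry_def band_eq_cmat)
    qed
    assume c: "j \<notin> (\<lambda>l. cyc l i) ` {..d}" and b: "j \<notin> (\<lambda>l. i + l) ` {..d}" "j \<notin> {}"
    have "cmat pt i j = 0" using c by (auto simp: cmat_def intro!: sum.neutral)
    moreover have "band i j = 0" using b by (auto simp: band_def intro!: sum.neutral)
    ultimately show "j = i" using ij by (auto simp: comp_def shifted_entry_def split: if_splits)
  qed
  then have "card (changed z s) \<le> card (SIGMA i:bad_rows z s. ?T i)"
    using fin by (intro card_mono) auto
  also have "\<dots> = (\<Sum>i\<in>bad_rows z s. card (?T i))" using fin by (intro card_SigmaI) auto
  also have "\<dots> \<le> (\<Sum>i\<in>bad_rows z s. 2 * d + 3)"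
  proof (rule sum_mono)
    fix i
    have "card (?T i) \<le> card ({i} \<union> (\<lambda>l. i + l) ` {..d}) + card ((\<lambda>l. cyc l i) ` {..d})" by (rule card_Un_le)
    also have "\<dots> \<le> (card {i} + card ((\<lambda>l. i + l) ` {..d})) + card ((\<lambda>l. cyc l i) ` {..d})"
      by (intro add_right_mono card_Un_le)
    also have "\<dots> \<le> (1 + (d + 1)) + (d + 1)"
      using card_image_le[of "{..d}" "\<lambda>l. i + l"] card_image_le[of "{..d}" "\<lambda>l. cyc l i"] by simp
    finally show "card (?T i) \<le> 2 * d + 3" by simp
  qed
  finally show ?thesis by simp
qed

lemma comp_diff:
  assumes "i < N" "j < N"
  shows "cmod (comp z s i j - shifted_entry z i j) \<le> 2 * (cmod z + S + 1)"
proof -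
  have b: "cmod (band i j) \<le> S" by (rule entry_le_S[OF band_row]) (use assms in auto)
  have c: "cmod (cmat pt i j) \<le> S" by (rule entry_le_S[OF cmat_row[of pt i, OF pt_in]]) (use assms in auto)
  have r: "cmod (shifted_entry z i j) \<le> cmod z + S"
    unfolding shifted_entry_def using b by (intro norm_triangle_le_diff) (auto intro: add_increasing)
  have "cmod (comp z s i j) \<le> cmod z + S + 1"
  proof (cases "good z s i")
    case True
    have "cmod ((if i = j then z else 0) - cmat pt i j) \<le> cmod z + S"
      using c by (intro norm_triangle_le_diff) (auto intro: add_increasing)
    then show ?thesis using True by (simp add: comp_def)
  next
    case False
    then show ?thesis using S0 by (simp add: comp_def add_nonneg_nonneg)
  qed
  then have "cmod (comp z s i j - shifted_entry z i j) \<le> (cmod z + S + 1) + (cmod z + S)"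
    using r by (intro order.trans[OF norm_triangle_ineq4] add_mono)
  then show ?thesis by simp
qed

text \<open>In the Fourier basis \<open>comp\<close> is diagonal, with entries \<open>z - ev
  j\<close> on good blocks and 1 elsewhere, up to the error of moving the sampling points from
  \<open>node\<close> to \<open>pt\<close>. The diagonal is bounded below by \<open>s\<close> and
  the error is at most \<open>e\<close> in operator norm.\<close>

lemma ndet_comp_ge:
  assumes s: "0 < s" "s \<le> 1" "e \<le> s"
  shows "(\<Prod>j\<in>{j. j < N \<and> good z s j}. cmod (z - ev j)) * (1 - e / s) ^ N \<le> cmod (ndet N (comp z s))"
proof -
  define D where "D j = (if good z s j then z - ev j else 1)" for j
  define E where "E i j = (if good z s i then cmat pt i j - cmat node i j else 0)" for i j
  have X: "(\<Sum>k<N. comp z s i k * W k j) = W i j * D j - (\<Sum>k<N. E i k * W k j)" if ij: "i < N" "j < N" for i j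
  proof (cases "good z s i")
    case True
    have "(\<Sum>k<N. comp z s i k * W k j) = (\<Sum>k<N. (if i = k then z else 0) * W k j) - (\<Sum>k<N. cmat pt i k * W k j)"
      using True by (simp add: comp_def left_diff_distrib sum_subtractf)
    also have "(\<Sum>k<N. (if i = k then z else 0) * W k j) = z * W i j"
      using ij by (simp add: if_distrib[of "\<lambda>x. x * _"] cong: if_cong)
    also have "(\<Sum>k<N. cmat pt i k * W k j) = W i j * ev j + (\<Sum>k<N. E i k * W k j)"
      using True cmat_diag[OF ij] by (simp add: E_def left_diff_distrib sum_subtractf)
    also have "z * W i j - (W i j * ev j + (\<Sum>k<N. E i k * W k j)) = W i j * (z - ev j) - (\<Sum>k<N. E i k * W k j)"
      by (simp add: algebra_simps)
    also have "W i j * (z - ev j) = W i j * D j"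
    proof (cases "W i j = 0")
      case False
      have "i < q * m" using True by (simp add: good_def)
      with False have "j < q * m" "i div m = j div m" by (auto simp: W_def split: if_splits)
      then have "good z s j" using good_block[OF \<open>i < q * m\<close>] True by blast
      then show ?thesis by (simp add: D_def)
    qed simp
    finally show ?thesis .
  next
    case False
    have "(\<Sum>k<N. comp z s i k * W k j) = W i j"
      using False ij by (simp add: comp_def if_distrib[of "\<lambda>x. x * _"] cong: if_cong)
    moreover have "W i j = W i j * D j"
    proof (cases "W i j = 0")
      case nz: False
      \<comment> \<open>\<open>W\<close> does not mix blocks, so a replaced row of
        \<open>comp\<close> meets only columns \<open>j\<close> with \<open>D j = 1\<close>.\<close>
      have "\<not> good z s j"
      proof (cases "i < q * m \<and> j < q * m")
        case True
        with nz have "i div m = j div m" by (auto simp: W_def split: if_splits)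
        then show ?thesis using good_block[of i j] True False by blast
      next
        case out: False
        with nz have "i = j" by (auto simp: W_def split: if_splits)
        then show ?thesis using False by simp
      qed
      then show ?thesis by (simp add: D_def)
    qed simp
    ultimately show ?thesis using False by (simp add: E_def)
  qed
  have "(\<Prod>j<N. cmod (D j)) * (1 - e / s) ^ N \<le> cmod (ndet N (comp z s))"
  proof (rule ndet_perturb_normal_ge[OF W_unitary W_unitary' X s(1) _ e0 s(3)])
    show "s \<le> cmod (D j)" for j using s by (auto simp: D_def good_def)
    show "(\<Sum>j<N. cmod (E i j)) \<le> e" if "i < N" for i
      using cmat_diff_row[OF that] e0 by (cases "good z s i") (auto simp: E_def)
    show "(\<Sum>i<N. cmod (E i j)) \<le> e" for j
      by (rule order.trans[OF sum_mono cmat_diff_col[of j]]) (simp add: E_def)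
  qed
  moreover have "(\<Prod>j<N. cmod (D j)) = (\<Prod>j\<in>{j. j < N \<and> good z s j}. cmod (z - ev j))"
  proof -
    have "(\<Prod>j<N. cmod (D j)) = (\<Prod>j<N. if good z s j then cmod (z - ev j) else 1)"
      by (intro prod.cong) (auto simp: D_def)
    also have "\<dots> = (\<Prod>j\<in>{j\<in>{..<N}. good z s j}. cmod (z - ev j))" by (rule prod.inter_filter[symmetric]) simp
    finally show ?thesis by simp
  qed
  ultimately show ?thesis by simp
qed

text \<open>Few rows are altered by making the shifts cyclic, and there the entries are bounded. On
  all other rows only the sampling points differ.\<close>

lemma band_cmat_frobenius:
  "(\<Sum>i<N. \<Sum>j<N. (cmod (band i j - cmat node i j))\<^sup>2) \<le> real N * e\<^sup>2 + real (d * q + m) * (2 * S)\<^sup>2"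
proof -
  let ?B = "{i. i < q * m \<and> m \<le> i mod m + d} \<union> {q * m..<N}"
  have cB: "card ?B \<le> d * q + m"
    using card_Un_le[of "{i. i < q * m \<and> m \<le> i mod m + d}" "{q * m..<N}"] card_boundary qm(2) by simp
  have sq: "(\<Sum>j<N. (cmod (a j))\<^sup>2) \<le> (\<Sum>j<N. cmod (a j))\<^sup>2" for a :: "nat \<Rightarrow> complex"
    by (rule L2_set_le_sum[of "{..<N}" "\<lambda>j. cmod (a j)", unfolded L2_set_def, THEN sqrt_le_D]) simp
  have "(\<Sum>j<N. (cmod (band i j - cmat node i j))\<^sup>2) \<le> e\<^sup>2 + (if i \<in> ?B then (2 * S)\<^sup>2 else 0)" if i: "i < N" for i
  proof (cases "i \<in> ?B")
    case False
    then have "i < q * m" "\<not> m \<le> i mod m + d" using i by auto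
    then have "(\<Sum>j<N. cmod (band i j - cmat node i j)) \<le> e"
      using cmat_diff_row[OF i] by (simp add: band_eq_cmat)
    then have "(\<Sum>j<N. cmod (band i j - cmat node i j))\<^sup>2 \<le> e\<^sup>2" by (intro power_mono sum_nonneg) auto
    with sq[of "\<lambda>j. band i j - cmat node i j"] show ?thesis unfolding if_not_P[OF False] by linarith
  next
    case True
    have "(\<Sum>j<N. cmod (band i j - cmat node i j)) \<le> (\<Sum>j<N. cmod (band i j) + cmod (cmat node i j))"
      by (intro sum_mono norm_triangle_ineq4)
    also have "\<dots> \<le> 2 * S" using band_row[OF i] cmat_row[of node i, OF node_in[OF i]] by (simp add: sum.distrib)
    finally have "(\<Sum>j<N. cmod (band i j - cmat node i j))\<^sup>2 \<le> (2 * S)\<^sup>2" by (intro power_mono sum_nonneg) auto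
    with sq[of "\<lambda>j. band i j - cmat node i j"] show ?thesis
      unfolding if_P[OF True] using zero_le_power2[of e] by linarith
  qed
  then have "(\<Sum>i<N. \<Sum>j<N. (cmod (band i j - cmat node i j))\<^sup>2) \<le> (\<Sum>i<N. e\<^sup>2 + (if i \<in> ?B then (2 * S)\<^sup>2 else 0))"
    by (intro sum_mono) auto
  also have "\<dots> = real N * e\<^sup>2 + real (card {i\<in>{..<N}. i \<in> ?B}) * (2 * S)\<^sup>2"
    by (simp add: sum.distrib sum.inter_filter[symmetric] del: Un_iff)
  also have "real (card {i\<in>{..<N}. i \<in> ?B}) \<le> real (d * q + m)"
    unfolding of_nat_le_iff by (rule order.trans[OF card_mono cB]) auto
  finally show ?thesis by (simp add: mult_right_mono)
qed

end

section \<open>Deviation of the log-determinant at one point\<close>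

lemma ennreal_plus3:
  "0 \<le> a \<Longrightarrow> 0 \<le> b \<Longrightarrow> 0 \<le> c \<Longrightarrow> ennreal a + ennreal b + ennreal c = ennreal (a + b + c)"
  by simp

lemma frobenius_triangle:
  fixes a b :: "nat \<Rightarrow> nat \<Rightarrow> complex"
  shows "sqrt (\<Sum>i<N. \<Sum>j<N. (cmod (a i j + b i j))\<^sup>2)
    \<le> sqrt (\<Sum>i<N. \<Sum>j<N. (cmod (a i j))\<^sup>2) + sqrt (\<Sum>i<N. \<Sum>j<N. (cmod (b i j))\<^sup>2)"
proof -
  let ?I = "{..<N} \<times> {..<N}"
  have eq: "sqrt (\<Sum>i<N. \<Sum>j<N. (cmod (c i j))\<^sup>2) = L2_set (\<lambda>p. cmod (c (fst p) (snd p))) ?I" for c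
    unfolding L2_set_def by (simp add: sum.cartesian_product split_beta')
  have "L2_set (\<lambda>p. cmod (a (fst p) (snd p) + b (fst p) (snd p))) ?I
    \<le> L2_set (\<lambda>p. cmod (a (fst p) (snd p)) + cmod (b (fst p) (snd p))) ?I"
    by (intro L2_set_mono norm_triangle_ineq) auto
  also have "\<dots> \<le> L2_set (\<lambda>p. cmod (a (fst p) (snd p))) ?I + L2_set (\<lambda>p. cmod (b (fst p) (snd p))) ?I"
    by (rule L2_set_triangle_ineq)
  finally show ?thesis unfolding eq .
qed

text \<open>A majorant of the effect of the regularisation \<open>\<sigma>\<close> that is
  integrable in the plane and small with \<open>\<sigma>\<close>, uniformly in the position of the
  singularity.\<close>

lemma ln_add_minus_ln_le:
  assumes "u > 0" "\<sigma> > 0"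
  shows "ln (u + \<sigma>) - ln u \<le> 2 * sqrt \<sigma> * u powr (-1/2)"
proof -
  define t where "t = sqrt (\<sigma> / u)"
  have t: "t \<ge> 0" "t\<^sup>2 = \<sigma> / u" using assms by (auto simp: t_def)
  have "ln (u + \<sigma>) - ln u = ln ((u + \<sigma>) / u)" using assms by (simp add: ln_div)
  also have "(u + \<sigma>) / u = 1 + t\<^sup>2" using assms t by (simp add: field_simps)
  also have "ln (1 + t\<^sup>2) \<le> ln ((1 + t)\<^sup>2)"
  proof -
    have le: "1 + t\<^sup>2 \<le> (1 + t)\<^sup>2" using t(1) by (simp add: power2_sum)
    have p: "0 < 1 + t\<^sup>2" by (simp add: add_pos_nonneg)
    show ?thesis by (rule ln_le_cancel_iff[THEN iffD2, OF p less_le_trans[OF p le] le])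
  qed
  also have "\<dots> = 2 * ln (1 + t)" using t by (simp add: ln_realpow)
  also have "\<dots> \<le> 2 * t" using t ln_add_one_self_le_self[of t] by simp
  also have "t = sqrt \<sigma> * u powr (-1/2)"
  proof -
    have "u powr (-1/2) = 1 / sqrt u"
      using assms powr_minus_divide[of u "1/2"] powr_half_sqrt[of u] by simp
    then show ?thesis by (simp only: t_def real_sqrt_divide) simp
  qed
  finally show ?thesis by simp
qed

context block_structure
begin

definition noisy_det :: "real \<Rightarrow> (nat \<Rightarrow> nat \<Rightarrow> complex) \<Rightarrow> complex \<Rightarrow> real" where
  "noisy_det \<delta> g z = cmod (ndet N (\<lambda>i j. shifted_entry z i j - of_real \<delta> * g i j))"

definition ref_pot :: "complex \<Rightarrow> real" where
  "ref_pot z = (\<Sum>j<N. ln (cmod (z - ev j)))"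

text \<open>The price of one bad row: \<open>2 * d + 3\<close> altered entries, plus the upper bound
  \<open>R + S\<close> for the summand \<open>ln \<bar>z - ev j\<bar>\<close> of the reference
  potential that is given up.\<close>

definition change_cost :: "real \<Rightarrow> real \<Rightarrow> real" where
  "change_cost R \<delta> = real (2 * d + 3) * (ln (2 + 2 * (R + S + 1) / \<delta>) + 2 * inv_sqrt_mass) + (R + S)"

text \<open>The expectation of the error term in the Hadamard bound, with the two summands coming
  from the deterministic approximation and from the noise.\<close>

definition residual :: "real \<Rightarrow> real \<Rightarrow> real" where
  "residual \<sigma> \<delta> = sqrt (real N) / \<sigma> * (sqrt (real N * e\<^sup>2 + real (d * q + m) * (2 * S)\<^sup>2) + 5 * \<delta> * real N)"

text \<open>Combines the pathwise upper bound (Hadamard) with the lower bound for the expectation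
  (subharmonicity). The summands on the right are, in this order, the regularisation of the
  logarithm, the perturbation of the good blocks, the rows that had to be changed, and the error
  term of the Hadamard bound.\<close>

lemma log_det_deviation_at:
  fixes P :: "'w measure" and G :: "'w \<Rightarrow> complex mat"
  assumes P: "prob_space P" and G: "complex_gaussian_matrix P N G"
    and \<delta>: "\<delta> > 0" and s: "0 < s" "s \<le> 1" "2 * e \<le> s" and \<sigma>: "\<sigma> > 0"
    and z: "cmod z \<le> R" "\<And>j. j < N \<Longrightarrow> z \<noteq> ev j"
  shows "(\<integral>\<^sup>+\<omega>. ennreal \<bar>ln (noisy_det \<delta> (\<lambda>i j. G \<omega> $$ (i, j)) z) - ref_pot z\<bar> \<partial>P)
    \<le> ennreal (2 * (\<Sum>j<N. 2 * sqrt \<sigma> * cmod (z - ev j) powr (-1/2)) + 2 * real N * e / s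
        + change_cost R \<delta> * real (card (bad_rows z s)) + 2 * residual \<sigma> \<delta>)"
proof -
  interpret prob_space P by (rule P)
  \<comment> \<open>The array \<open>?x'\<close> is \<open>comp z s\<close> inside the index square
    and agrees with \<open>?x\<close> outside, so that the two differ exactly on \<open>changed z
    s\<close>.\<close>
  let ?x = "\<lambda>p. shifted_entry z (fst p) (snd p)" and ?x' = "\<lambda>p. if p \<in> changed z s then comp z s (fst p) (snd p) else shifted_entry z (fst p) (snd p)"
  let ?T = "\<lambda>\<omega>. noisy_det \<delta> (\<lambda>i j. G \<omega> $$ (i, j)) z"
  define Q where "Q i j = cmat node i j - band i j" for i j
  define U where "U = (\<Sum>j<N. ln (cmod (z - ev j) + \<sigma>))"
  define w where "w \<omega> = sqrt (real N) / \<sigma> * sqrt (\<Sum>i<N. \<Sum>j<N. (cmod (Q i j + (- of_real \<delta>) * G \<omega> $$ (i, j)))\<^sup>2)" for \<omega>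
  define L where "L = ref_pot z - real (card {i. i < N \<and> \<not> good z s i}) * (R + S) + real N * ln (1 - e / s)"
  define \<kappa> where "\<kappa> = ln (2 + 2 * (R + S + 1) / \<delta>) + 2 * inv_sqrt_mass"
  define K where "K = real (card (changed z s)) * \<kappa>"
  have R0: "R \<ge> 0" using z(1) norm_ge_zero order.trans by blast
  have \<kappa>0: "\<kappa> \<ge> 0"
    using R0 S0 \<delta> by (auto simp: \<kappa>_def inv_sqrt_mass_def intro!: add_nonneg_nonneg ln_ge_zero)
  have es: "0 \<le> e / s" "e / s \<le> 1 / 2" using s e0 by (auto simp: field_simps)
  have lnes: "- (2 * (e / s)) \<le> ln (1 - e / s)" "ln (1 - e / s) \<le> 0"
  proof -
    have "- (e / s) - 2 * (e / s)\<^sup>2 \<le> ln (1 - e / s)" using es by (rule ln_one_minus_pos_lower_bound)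
    moreover have "2 * (e / s)\<^sup>2 \<le> e / s" using es mult_left_mono[of "e / s" "1/2" "e / s"] by (simp add: power2_eq_square)
    ultimately show "- (2 * (e / s)) \<le> ln (1 - e / s)" by linarith
    have "0 < 1 - e / s" "1 - e / s \<le> 1" using es by linarith+
    then show "ln (1 - e / s) \<le> 0" by (simp only: ln_le_zero_iff)
  qed
  have pos: "cmod (z - ev j) > 0" if "j < N" for j using z(2)[OF that] by simp
  have YU: "ref_pot z \<le> U"
    unfolding ref_pot_def U_def
  proof (rule sum_mono)
    fix j assume "j \<in> {..<N}"
    then have p: "0 < cmod (z - ev j)" by (intro pos) simp
    then have p': "0 < cmod (z - ev j) + \<sigma>" using \<sigma> by linarith
    show "ln (cmod (z - ev j)) \<le> ln (cmod (z - ev j) + \<sigma>)"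
      using \<sigma> by (intro ln_le_cancel_iff[THEN iffD2, OF p p']) simp
  qed
  have T_meas: "?T \<in> borel_measurable P"
    unfolding noisy_det_def
    by (rule measurable_compose[OF _ borel_measurable_norm], rule measurable_ndet)
      (intro borel_measurable_diff borel_measurable_times borel_measurable_const gaussian_entry_measurable[OF G])
  have frob_meas: "(\<lambda>\<omega>. sqrt (\<Sum>i<N. \<Sum>j<N. (cmod (A i j + c * G \<omega> $$ (i, j)))\<^sup>2)) \<in> borel_measurable P" for A and c
  proof -
    have "(\<lambda>\<omega>. (cmod (A i j + c * G \<omega> $$ (i, j)))\<^sup>2) \<in> borel_measurable P" if "i < N" "j < N" for i j
      using gaussian_entry_measurable[OF G that] by measurable
    then have "(\<lambda>\<omega>. \<Sum>i<N. \<Sum>j<N. (cmod (A i j + c * G \<omega> $$ (i, j)))\<^sup>2) \<in> borel_measurable P"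
      by (intro borel_measurable_sum) auto
    then show ?thesis by measurable
  qed
  have w_meas: "w \<in> borel_measurable P"
    unfolding w_def by (rule borel_measurable_times[OF borel_measurable_const frob_meas])
  have w0: "0 \<le> w \<omega>" for \<omega> unfolding w_def using \<sigma> by (intro mult_nonneg_nonneg divide_nonneg_pos) (auto intro!: sum_nonneg)
  have up: "ln (?T \<omega>) \<le> U + w \<omega>" if "?T \<omega> \<noteq> 0" for \<omega>
  proof -
    let ?C = "\<lambda>i j. (if i = j then z else 0) - cmat node i j"
    let ?Y = "\<lambda>i j. Q i j + (- of_real \<delta>) * G \<omega> $$ (i, j)"
    have eq: "ndet N (\<lambda>i j. shifted_entry z i j - of_real \<delta> * G \<omega> $$ (i, j)) = ndet N (\<lambda>i j. ?C i j + ?Y i j)"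
      by (rule ndet_cong) (simp add: Q_def shifted_entry_def)
    have diag: "(\<Sum>k<N. ?C i k * W k j) = W i j * (z - ev j)" if ij: "i < N" "j < N" for i j
    proof -
      have "(\<Sum>k<N. ?C i k * W k j) = (\<Sum>k<N. (if i = k then z else 0) * W k j) - (\<Sum>k<N. cmat node i k * W k j)"
        by (simp add: left_diff_distrib sum_subtractf)
      also have "(\<Sum>k<N. (if i = k then z else 0) * W k j) = z * W i j"
        using ij by (simp add: if_distrib[of "\<lambda>x. x * _"] cong: if_cong)
      finally show ?thesis unfolding cmat_diag[OF ij] by (simp add: algebra_simps)
    qed
    have nz: "ndet N (\<lambda>i j. ?C i j + ?Y i j) \<noteq> 0" using that unfolding noisy_det_def eq by simp
    show ?thesis
      using ndet_perturb_normal_le[OF W_unitary W_unitary' diag \<sigma> nz]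
      unfolding noisy_det_def eq U_def w_def by simp
  qed
  have Llow: "L \<le> ln (cmod (ndet N (comp z s)))" and nz: "ndet N (comp z s) \<noteq> 0"
  proof -
    let ?g = "{j. j < N \<and> good z s j}" and ?b = "{i. i < N \<and> \<not> good z s i}"
    have fin: "finite ?g" "finite ?b" by auto
    have "{..<N} = ?g \<union> ?b" "?g \<inter> ?b = {}" by auto
    then have split: "ref_pot z = (\<Sum>j\<in>?g. ln (cmod (z - ev j))) + (\<Sum>j\<in>?b. ln (cmod (z - ev j)))"
      unfolding ref_pot_def using fin by (simp add: sum.union_disjoint)
    \<comment> \<open>The reference potential includes the bad eigenvalues; discarding them costs at
      most \<open>R + S\<close> each.\<close>
    have "(\<Sum>j\<in>?b. ln (cmod (z - ev j))) \<le> (\<Sum>j\<in>?b. R + S)"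
    proof (rule sum_mono)
      fix j assume "j \<in> ?b"
      then have j: "j < N" by auto
      have "ln (cmod (z - ev j)) \<le> cmod (z - ev j)" using ln_bound[OF pos[OF j]] .
      also have "\<dots> \<le> R + S" using z(1) cmod_ev[OF j] norm_triangle_ineq4[of z "ev j"] by linarith
      finally show "ln (cmod (z - ev j)) \<le> R + S" .
    qed
    then have "(\<Sum>j\<in>?b. ln (cmod (z - ev j))) \<le> real (card ?b) * (R + S)" by simp
    then have "L \<le> (\<Sum>j\<in>?g. ln (cmod (z - ev j))) + real N * ln (1 - e / s)"
      unfolding L_def split by linarith
    also have "\<dots> = ln ((\<Prod>j\<in>?g. cmod (z - ev j)) * (1 - e / s) ^ N)"
    proof -
      have "0 < (\<Prod>j\<in>?g. cmod (z - ev j))" using pos by (intro prod_pos) auto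
      moreover have "0 < (1 - e / s) ^ N" using es by (intro zero_less_power) linarith
      moreover have "ln (\<Prod>j\<in>?g. cmod (z - ev j)) = (\<Sum>j\<in>?g. ln (cmod (z - ev j)))"
        using z(2) by (intro ln_prod) auto
      moreover have "ln ((1 - e / s) ^ N) = real N * ln (1 - e / s)" by (rule ln_realpow)
      ultimately show ?thesis by (simp add: ln_mult_pos)
    qed
    finally have L1: "L \<le> ln ((\<Prod>j\<in>?g. cmod (z - ev j)) * (1 - e / s) ^ N)" .
    have p: "0 < (\<Prod>j\<in>?g. cmod (z - ev j)) * (1 - e / s) ^ N"
    proof (intro mult_pos_pos prod_pos zero_less_power)
      show "0 < 1 - e / s" using es by linarith
    qed (use pos in auto)
    have ge: "(\<Prod>j\<in>?g. cmod (z - ev j)) * (1 - e / s) ^ N \<le> cmod (ndet N (comp z s))"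
      using s e0 by (intro ndet_comp_ge) auto
    from p ge have p': "0 < cmod (ndet N (comp z s))" by linarith
    then show "ndet N (comp z s) \<noteq> 0" by simp
    show "L \<le> ln (cmod (ndet N (comp z s)))"
      using L1 ln_le_cancel_iff[OF p p'] ge by linarith
  qed
  have low: "ennreal (L + real k) \<le> (\<integral>\<^sup>+\<omega>. ennreal (lnp (?T \<omega> * exp (real k))) \<partial>P) + ennreal K" for k :: nat
  proof -
    have cx: "ndet N (\<lambda>i j. ?x' (i, j)) = ndet N (comp z s)"
      by (rule ndet_cong) (auto simp: changed_def)
    have "ennreal (L + real k) \<le> ennreal (ln (cmod (ndet N (comp z s))) + ln (exp (real k)))"
      using Llow by (intro ennreal_leI) simp
    also have "\<dots> \<le> (\<integral>\<^sup>+\<omega>. ennreal (lnp (cmod (ndet N (\<lambda>i j. ?x (i, j) + (- of_real \<delta>) * G \<omega> $$ (i, j))) * exp (real k))) \<partial>P)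
      + of_nat (card (changed z s)) * entry_cost (2 * (R + S + 1)) (cmod (- of_real \<delta>))"
      unfolding cx[symmetric]
    proof (rule noisy_ndet_lower[OF P G N0])
      show "- complex_of_real \<delta> \<noteq> 0" using \<delta> by simp
      show "changed z s \<subseteq> {..<N} \<times> {..<N}" by (auto simp: changed_def)
      show "cmod (?x' p - ?x p) \<le> 2 * (R + S + 1)" if "p \<in> changed z s" for p
        using that comp_diff[of "fst p" "snd p" z s] z(1) by (auto simp: changed_def)
      show "ndet N (\<lambda>i j. ?x' (i, j)) \<noteq> 0" using nz cx by simp
    qed auto
    also have "of_nat (card (changed z s)) * entry_cost (2 * (R + S + 1)) (cmod (- of_real \<delta>)) \<le> ennreal K"
    proof -
      have "entry_cost (2 * (R + S + 1)) (cmod (- of_real \<delta>)) \<le> ennreal \<kappa>"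
        using entry_cost_le[of "2 * (R + S + 1)" \<delta>] R0 S0 \<delta> by (simp add: \<kappa>_def)
      then have "of_nat (card (changed z s)) * entry_cost (2 * (R + S + 1)) (cmod (- of_real \<delta>))
        \<le> of_nat (card (changed z s)) * ennreal \<kappa>" by (rule mult_left_mono) simp
      also have "\<dots> = ennreal K"
        using \<kappa>0 by (simp add: K_def ennreal_mult ennreal_of_nat_eq_real_of_nat)
      finally show ?thesis .
    qed
    finally show ?thesis by (simp add: noisy_det_def add_left_mono)
  qed
  have K0: "0 \<le> K" using \<kappa>0 by (simp add: K_def)
  have LY: "L \<le> ref_pot z"
  proof -
    have "real N * ln (1 - e / s) \<le> 0" using lnes(2) by (intro mult_nonneg_nonpos) auto
    moreover have "0 \<le> real (card {i. i < N \<and> \<not> good z s i}) * (R + S)" using R0 S0 by simp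
    ultimately show ?thesis unfolding L_def by linarith
  qed
  have "(\<integral>\<^sup>+\<omega>. ennreal \<bar>ln (?T \<omega>) - ref_pot z\<bar> \<partial>P)
    \<le> ennreal (U - L + K) + ennreal (U - ref_pot z) + 2 * (\<integral>\<^sup>+\<omega>. ennreal (w \<omega>) \<partial>P)"
    using LY YU K0 up w0 low
    by (intro log_deviation_le[OF P T_meas w_meas]) (auto simp: noisy_det_def)
  also have "(\<integral>\<^sup>+\<omega>. ennreal (w \<omega>) \<partial>P) \<le> ennreal (residual \<sigma> \<delta>)"
  proof -
    let ?F = "sqrt (real N * e\<^sup>2 + real (d * q + m) * (2 * S)\<^sup>2)"
    let ?c = "sqrt (real N) / \<sigma>"
    let ?g = "\<lambda>\<omega>. sqrt (\<Sum>i<N. \<Sum>j<N. (cmod (G \<omega> $$ (i, j)))\<^sup>2)"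
    have c0: "?c \<ge> 0" using \<sigma> by simp
    have [measurable]: "?g \<in> borel_measurable P"
      using frob_meas[of "\<lambda>_ _. 0" 1] by simp
    have wle: "w \<omega> \<le> ?c * ?F + ?c * \<delta> * ?g \<omega>" for \<omega>
    proof -
      have "sqrt (\<Sum>i<N. \<Sum>j<N. (cmod (Q i j + (- of_real \<delta>) * G \<omega> $$ (i, j)))\<^sup>2)
        \<le> sqrt (\<Sum>i<N. \<Sum>j<N. (cmod (Q i j))\<^sup>2) + sqrt (\<Sum>i<N. \<Sum>j<N. (cmod ((- of_real \<delta>) * G \<omega> $$ (i, j)))\<^sup>2)"
        by (rule frobenius_triangle)
      also have "sqrt (\<Sum>i<N. \<Sum>j<N. (cmod (Q i j))\<^sup>2) \<le> ?F"
        using band_cmat_frobenius by (simp add: Q_def norm_minus_commute)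
      also have "(\<Sum>i<N. \<Sum>j<N. (cmod ((- of_real \<delta>) * G \<omega> $$ (i, j)))\<^sup>2) = \<delta>\<^sup>2 * (\<Sum>i<N. \<Sum>j<N. (cmod (G \<omega> $$ (i, j)))\<^sup>2)"
        by (simp add: norm_mult power_mult_distrib sum_distrib_left)
      also have "sqrt \<dots> = \<delta> * ?g \<omega>" using \<delta> by (simp add: real_sqrt_mult)
      finally have "w \<omega> \<le> ?c * (?F + \<delta> * ?g \<omega>)" unfolding w_def using c0 by (intro mult_left_mono) auto
      then show ?thesis by (simp add: distrib_left mult.assoc)
    qed
    have "(\<integral>\<^sup>+\<omega>. ennreal (w \<omega>) \<partial>P) \<le> (\<integral>\<^sup>+\<omega>. ennreal (?c * ?F) + ennreal (?c * \<delta>) * ennreal (?g \<omega>) \<partial>P)"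
    proof (rule nn_integral_mono)
      fix \<omega>
      have g0: "?g \<omega> \<ge> 0" by (intro real_sqrt_ge_zero sum_nonneg) auto
      have F0: "?F \<ge> 0" by simp
      have "ennreal (w \<omega>) \<le> ennreal (?c * ?F + ?c * \<delta> * ?g \<omega>)" by (rule ennreal_leI[OF wle])
      also have "\<dots> = ennreal (?c * ?F) + ennreal (?c * \<delta> * ?g \<omega>)"
        using c0 \<delta> g0 F0 by (intro ennreal_plus mult_nonneg_nonneg) auto
      also have "ennreal (?c * \<delta> * ?g \<omega>) = ennreal (?c * \<delta>) * ennreal (?g \<omega>)"
        using c0 \<delta> g0 by (intro ennreal_mult mult_nonneg_nonneg) auto
      finally show "ennreal (w \<omega>) \<le> ennreal (?c * ?F) + ennreal (?c * \<delta>) * ennreal (?g \<omega>)" .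
    qed
    also have "\<dots> = ennreal (?c * ?F) + ennreal (?c * \<delta>) * (\<integral>\<^sup>+\<omega>. ennreal (?g \<omega>) \<partial>P)"
      by (subst nn_integral_add) (auto simp: nn_integral_cmult emeasure_space_1)
    also have "\<dots> \<le> ennreal (?c * ?F) + ennreal (?c * \<delta>) * ennreal (5 * real N)"
      by (intro add_left_mono mult_left_mono expectation_frobenius_le[OF P G N0]) auto
    also have "\<dots> = ennreal (residual \<sigma> \<delta>)"
    proof -
      have "0 \<le> ?c * ?F" using c0 by (intro mult_nonneg_nonneg) auto
      moreover have "0 \<le> ?c * \<delta> * (5 * real N)" using c0 \<delta> by (intro mult_nonneg_nonneg) auto
      ultimately have "ennreal (?c * ?F) + ennreal (?c * \<delta> * (5 * real N)) = ennreal (?c * ?F + ?c * \<delta> * (5 * real N))"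
        by (rule ennreal_plus[symmetric])
      moreover have "ennreal (?c * \<delta>) * ennreal (5 * real N) = ennreal (?c * \<delta> * (5 * real N))"
        using c0 \<delta> by (intro ennreal_mult[symmetric] mult_nonneg_nonneg) auto
      moreover have "?c * ?F + ?c * \<delta> * (5 * real N) = residual \<sigma> \<delta>"
        by (simp add: residual_def algebra_simps)
      ultimately show ?thesis by (simp only:)
    qed
    finally show ?thesis .
  qed
  also have "ennreal (U - L + K) + ennreal (U - ref_pot z) + 2 * ennreal (residual \<sigma> \<delta>)
     = ennreal (U - L + K + (U - ref_pot z) + 2 * residual \<sigma> \<delta>)"
  proof -
    have "residual \<sigma> \<delta> \<ge> 0" using \<sigma> \<delta> by (auto simp: residual_def intro!: mult_nonneg_nonneg add_nonneg_nonneg)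
    moreover have "2 * ennreal r = ennreal (2 * r)" if "r \<ge> 0" for r using that by (simp add: ennreal_mult)
    ultimately show ?thesis using LY YU K0 ennreal_plus3[of "U - L + K" "U - ref_pot z" "2 * residual \<sigma> \<delta>"] by simp
  qed
  also have "\<dots> \<le> ennreal (2 * (\<Sum>j<N. 2 * sqrt \<sigma> * cmod (z - ev j) powr (-1/2)) + 2 * real N * e / s
        + change_cost R \<delta> * real (card (bad_rows z s)) + 2 * residual \<sigma> \<delta>)"
  proof (rule ennreal_leI)
    have "U - ref_pot z = (\<Sum>j<N. ln (cmod (z - ev j) + \<sigma>) - ln (cmod (z - ev j)))"
      by (simp add: U_def ref_pot_def sum_subtractf)
    also have "\<dots> \<le> (\<Sum>j<N. 2 * sqrt \<sigma> * cmod (z - ev j) powr (-1/2))"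
      using pos \<sigma> by (intro sum_mono ln_add_minus_ln_le) auto
    finally have 1: "U - ref_pot z \<le> (\<Sum>j<N. 2 * sqrt \<sigma> * cmod (z - ev j) powr (-1/2))" .
    have "real (card {i. i < N \<and> \<not> good z s i}) \<le> real (card (bad_rows z s))"
      unfolding of_nat_le_iff by (intro card_mono) (auto simp: bad_rows_def)
    then have 2: "real (card {i. i < N \<and> \<not> good z s i}) * (R + S) \<le> real (card (bad_rows z s)) * (R + S)"
      using R0 S0 by (intro mult_right_mono) auto
    have 3: "- (real N * ln (1 - e / s)) \<le> 2 * real N * e / s"
      using mult_left_mono[OF lnes(1), of "real N"] by simp
    have "real (card (changed z s)) \<le> real (card (bad_rows z s)) * real (2 * d + 3)"
      using card_changed[of z s] by (metis of_nat_le_iff of_nat_mult)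
    then have 4: "K \<le> real (card (bad_rows z s)) * real (2 * d + 3) * \<kappa>"
      unfolding K_def using \<kappa>0 by (rule mult_right_mono)
    have 5: "change_cost R \<delta> * real (card (bad_rows z s))
      = real (card (bad_rows z s)) * real (2 * d + 3) * \<kappa> + real (card (bad_rows z s)) * (R + S)"
      by (simp add: change_cost_def \<kappa>_def algebra_simps)
    show "U - L + K + (U - ref_pot z) + 2 * residual \<sigma> \<delta>
      \<le> 2 * (\<Sum>j<N. 2 * sqrt \<sigma> * cmod (z - ev j) powr (-1/2)) + 2 * real N * e / s
        + change_cost R \<delta> * real (card (bad_rows z s)) + 2 * residual \<sigma> \<delta>"
      unfolding 5 using 1 2 3 4 by (simp only: L_def)
  qed
  finally show ?thesis by (simp add: add_left_mono mult_left_mono)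
qed

end

section \<open>Deviation integrated over a disc\<close>

lemma emeasure_ball_complex_le:
  assumes "s > 0"
  shows "emeasure lborel (ball (c :: complex) s) \<le> ennreal (4 * s\<^sup>2)"
proof -
  have "emeasure lborel (ball c s) = ennreal (pi * s\<^sup>2)"
    using assms by (simp add: emeasure_ball unit_ball_vol_2)
  also have "\<dots> \<le> ennreal (4 * s\<^sup>2)"
    using pi_less_4 by (intro ennreal_leI mult_right_mono) auto
  finally show ?thesis .
qed

context block_structure
begin

lemma change_cost_nonneg: "R \<ge> 0 \<Longrightarrow> \<delta> > 0 \<Longrightarrow> change_cost R \<delta> \<ge> 0"
  using S0 unfolding change_cost_def inv_sqrt_mass_def
  by (intro add_nonneg_nonneg mult_nonneg_nonneg ln_ge_zero) auto

lemma residual_nonneg: "\<sigma> > 0 \<Longrightarrow> \<delta> > 0 \<Longrightarrow> residual \<sigma> \<delta> \<ge> 0"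
  unfolding residual_def by (intro mult_nonneg_nonneg add_nonneg_nonneg) auto

text \<open>Pointwise the number of bad rows may be as large as \<open>N\<close>. Integrated over
  \<open>z\<close>, each eigenvalue contributes at most \<open>m\<close> rows on a disc of area at
  most \<open>4 * s\<^sup>2\<close>.\<close>

lemma log_det_deviation_integrated:
  fixes P :: "'w measure" and G :: "'w \<Rightarrow> complex mat"
  assumes P: "prob_space P" and G: "complex_gaussian_matrix P N G"
    and \<delta>: "\<delta> > 0" and s: "0 < s" "s \<le> 1" "2 * e \<le> s" and \<sigma>: "\<sigma> > 0" and R: "R \<ge> 0"
  shows "(\<integral>\<^sup>+z. (\<integral>\<^sup>+\<omega>. ennreal \<bar>ln (noisy_det \<delta> (\<lambda>i j. G \<omega> $$ (i, j)) z) - ref_pot z\<bar> \<partial>P) * indicator (cball 0 R) z \<partial>lborel)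
    \<le> ennreal (4 * sqrt \<sigma> * real N * (measure lborel (cball (0::complex) R) + inv_sqrt_mass)
        + measure lborel (cball (0::complex) R) * (2 * real N * e / s + change_cost R \<delta> * real (d * q + m) + 2 * residual \<sigma> \<delta>)
        + change_cost R \<delta> * real m * real N * (4 * s\<^sup>2))"
    (is "_ \<le> ennreal (_ + ?V * ?B + _)")
proof -
  have [measurable]: "cball (0::complex) R \<in> sets borel" "\<And>j. ball (ev j) s \<in> sets borel" by auto
  let ?c = "change_cost R \<delta>"
  have c0: "?c \<ge> 0" by (rule change_cost_nonneg[OF R \<delta>])
  have B0: "?B \<ge> 0"
    using c0 residual_nonneg[OF \<sigma> \<delta>] s e0 by (intro add_nonneg_nonneg mult_nonneg_nonneg divide_nonneg_pos) auto
  have Vem: "emeasure lborel (cball (0::complex) R) = ennreal ?V"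
    using emeasure_lborel_cball_finite[of "0::complex" R] by (simp add: emeasure_eq_ennreal_measure)
  have i0: "inv_sqrt_mass \<ge> 0" by (simp add: inv_sqrt_mass_def)
  let ?p = "\<lambda>j z. ennreal (cmod (z - ev j) powr (-1/2)) * indicator (cball 0 R) z"
  have ne: "AE z in lborel. \<forall>j\<in>{..<N}. z \<noteq> ev j"
    by (intro AE_finite_allI AE_lborel_singleton) auto
  have "(\<integral>\<^sup>+z. (\<integral>\<^sup>+\<omega>. ennreal \<bar>ln (noisy_det \<delta> (\<lambda>i j. G \<omega> $$ (i, j)) z) - ref_pot z\<bar> \<partial>P) * indicator (cball 0 R) z \<partial>lborel)
    \<le> (\<integral>\<^sup>+z. (\<Sum>j<N. ennreal (4 * sqrt \<sigma>) * ?p j z) + (ennreal ?B * indicator (cball 0 R) z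
        + (\<Sum>j<N. ennreal (?c * real m) * indicator (ball (ev j) s) z)) \<partial>lborel)"
  proof (rule nn_integral_mono_AE, use ne in eventually_elim)
    case (elim z)
    show ?case
    proof (cases "z \<in> cball 0 R")
      case True
      \<comment> \<open>Counting the eigenvalues near \<open>z\<close> is a sum of indicators of
        discs, which integrates to their areas.\<close>
      have "real (card (near z s)) \<le> (\<Sum>j<N. indicator (ball (ev j) s) z)"
      proof -
        have "near z s \<subseteq> {j\<in>{..<N}. z \<in> ball (ev j) s}"
          using qm(1) by (auto simp: near_def dist_norm norm_minus_commute)
        then have "card (near z s) \<le> card {j\<in>{..<N}. z \<in> ball (ev j) s}" by (intro card_mono) auto
        also have "real \<dots> = (\<Sum>j<N. indicator (ball (ev j) s) z)"
          by (simp add: indicator_def sum.inter_filter[symmetric]) (rule arg_cong[where f = card], auto)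
        finally show ?thesis by simp
      qed
      then have near: "real m * real (card (near z s)) \<le> real m * (\<Sum>j<N. indicator (ball (ev j) s) z)"
        by (rule mult_left_mono) simp
      have "real (card (bad_rows z s)) \<le> real (d * q + m) + real m * real (card (near z s))"
        using card_bad_rows[of z s] by (metis of_nat_add of_nat_le_iff of_nat_mult)
      with near have "real (card (bad_rows z s)) \<le> real (d * q + m) + real m * (\<Sum>j<N. indicator (ball (ev j) s) z)"
        by linarith
      then have "?c * real (card (bad_rows z s)) \<le> ?c * (real (d * q + m) + real m * (\<Sum>j<N. indicator (ball (ev j) s) z))"
        using c0 by (rule mult_left_mono)
      moreover have "(\<Sum>j<N. ?c * real m * indicator (ball (ev j) s) z) = ?c * (real m * (\<Sum>j<N. indicator (ball (ev j) s) z))"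
        by (simp only: sum_distrib_left[symmetric] mult.assoc)
      moreover have "(\<Sum>j<N. 4 * sqrt \<sigma> * cmod (z - ev j) powr (-1/2)) = 2 * (\<Sum>j<N. 2 * sqrt \<sigma> * cmod (z - ev j) powr (-1/2))"
        by (simp add: sum_distrib_left mult.assoc)
      ultimately have bd: "2 * (\<Sum>j<N. 2 * sqrt \<sigma> * cmod (z - ev j) powr (-1/2)) + 2 * real N * e / s
          + ?c * real (card (bad_rows z s)) + 2 * residual \<sigma> \<delta>
        \<le> (\<Sum>j<N. 4 * sqrt \<sigma> * cmod (z - ev j) powr (-1/2)) + (?B + (\<Sum>j<N. ?c * real m * indicator (ball (ev j) s) z))"
        by (simp only: distrib_left)
      have "(\<integral>\<^sup>+\<omega>. ennreal \<bar>ln (noisy_det \<delta> (\<lambda>i j. G \<omega> $$ (i, j)) z) - ref_pot z\<bar> \<partial>P)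
        \<le> ennreal (2 * (\<Sum>j<N. 2 * sqrt \<sigma> * cmod (z - ev j) powr (-1/2)) + 2 * real N * e / s
          + ?c * real (card (bad_rows z s)) + 2 * residual \<sigma> \<delta>)"
        using True elim by (intro log_det_deviation_at[OF P G \<delta> s \<sigma>]) auto
      also have "\<dots> \<le> ennreal ((\<Sum>j<N. 4 * sqrt \<sigma> * cmod (z - ev j) powr (-1/2)) + (?B + (\<Sum>j<N. ?c * real m * indicator (ball (ev j) s) z)))"
        by (rule ennreal_leI[OF bd])
      also have "\<dots> = ennreal (\<Sum>j<N. 4 * sqrt \<sigma> * cmod (z - ev j) powr (-1/2)) + (ennreal ?B + ennreal (\<Sum>j<N. ?c * real m * indicator (ball (ev j) s) z))"
        using B0 c0 \<sigma> by (simp add: ennreal_plus sum_nonneg del: ennreal_plus[symmetric])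
      also have "ennreal (\<Sum>j<N. 4 * sqrt \<sigma> * cmod (z - ev j) powr (-1/2)) = (\<Sum>j<N. ennreal (4 * sqrt \<sigma>) * ennreal (cmod (z - ev j) powr (-1/2)))"
        using \<sigma> by (subst sum_ennreal[symmetric]) (auto simp: ennreal_mult)
      also have "ennreal (\<Sum>j<N. ?c * real m * indicator (ball (ev j) s) z) = (\<Sum>j<N. ennreal (?c * real m) * indicator (ball (ev j) s) z)"
        using c0 by (subst sum_ennreal[symmetric]) (auto simp: ennreal_mult ennreal_indicator)
      finally show ?thesis using True by simp
    qed simp
  qed
  also have "\<dots> = (\<Sum>j<N. ennreal (4 * sqrt \<sigma>) * (\<integral>\<^sup>+z. ?p j z \<partial>lborel)) + (ennreal ?B * ennreal ?V
      + (\<Sum>j<N. ennreal (?c * real m) * emeasure lborel (ball (ev j) s)))"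
  proof -
    have a: "(\<integral>\<^sup>+z. (\<Sum>j<N. ennreal (4 * sqrt \<sigma>) * ?p j z) \<partial>lborel) = (\<Sum>j<N. ennreal (4 * sqrt \<sigma>) * (\<integral>\<^sup>+z. ?p j z \<partial>lborel))"
      by (subst nn_integral_sum, measurable, intro sum.cong refl nn_integral_cmult) measurable
    have b: "(\<integral>\<^sup>+z. (\<Sum>j<N. ennreal (?c * real m) * indicator (ball (ev j) s) z) \<partial>lborel)
      = (\<Sum>j<N. ennreal (?c * real m) * emeasure lborel (ball (ev j) s))"
      by (subst nn_integral_sum, measurable, intro sum.cong refl nn_integral_cmult_indicator) measurable
    have c: "(\<integral>\<^sup>+z. ennreal ?B * indicator (cball (0::complex) R) z \<partial>lborel) = ennreal ?B * ennreal ?V"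
      unfolding Vem[symmetric] by (rule nn_integral_cmult_indicator) measurable
    let ?f1 = "\<lambda>z. \<Sum>j<N. ennreal (4 * sqrt \<sigma>) * ?p j z" and ?f2 = "\<lambda>z. ennreal ?B * indicator (cball (0::complex) R) z"
      and ?f3 = "\<lambda>z. \<Sum>j<N. ennreal (?c * real m) * indicator (ball (ev j) s) z"
    have [measurable]: "?f1 \<in> borel_measurable lborel" "?f2 \<in> borel_measurable lborel" "?f3 \<in> borel_measurable lborel"
      by (intro borel_measurable_sum, measurable)+
    have "(\<integral>\<^sup>+z. ?f1 z + (?f2 z + ?f3 z) \<partial>lborel) = (\<integral>\<^sup>+z. ?f1 z \<partial>lborel) + (\<integral>\<^sup>+z. ?f2 z + ?f3 z \<partial>lborel)"
      by (rule nn_integral_add) (intro borel_measurable_add | fact)+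
    also have "(\<integral>\<^sup>+z. ?f2 z + ?f3 z \<partial>lborel) = (\<integral>\<^sup>+z. ?f2 z \<partial>lborel) + (\<integral>\<^sup>+z. ?f3 z \<partial>lborel)"
      by (rule nn_integral_add) fact+
    finally show ?thesis unfolding a b c .
  qed
  also have "\<dots> \<le> (\<Sum>j<N. ennreal (4 * sqrt \<sigma>) * (ennreal ?V + ennreal inv_sqrt_mass)) + (ennreal ?B * ennreal ?V
      + (\<Sum>j<N. ennreal (?c * real m) * ennreal (4 * s\<^sup>2)))"
  proof (intro add_mono order_refl sum_mono mult_left_mono)
    fix j
    show "(\<integral>\<^sup>+z. ?p j z \<partial>lborel) \<le> ennreal ?V + ennreal inv_sqrt_mass"
      using nn_integral_inv_sqrt_le[of "cball 0 R" "ev j"] by (simp add: Vem)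
    show "emeasure lborel (ball (ev j) s) \<le> ennreal (4 * s\<^sup>2)" by (rule emeasure_ball_complex_le[OF s(1)])
  qed auto
  also have "\<dots> = ennreal (4 * sqrt \<sigma> * real N * (?V + inv_sqrt_mass) + ?V * ?B + ?c * real m * real N * (4 * s\<^sup>2))"
  proof -
    have 1: "(\<Sum>j<N. ennreal (4 * sqrt \<sigma>) * (ennreal ?V + ennreal inv_sqrt_mass)) = ennreal (4 * sqrt \<sigma> * real N * (?V + inv_sqrt_mass))"
      using \<sigma> i0 by (simp add: ennreal_of_nat_eq_real_of_nat ennreal_mult[symmetric] ennreal_plus[symmetric] mult_ac del: ennreal_plus)
    have 2: "(\<Sum>j<N. ennreal (?c * real m) * ennreal (4 * s\<^sup>2)) = ennreal (?c * real m * real N * (4 * s\<^sup>2))"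
      using c0 by (simp add: ennreal_of_nat_eq_real_of_nat ennreal_mult[symmetric] mult_ac)
    have 3: "ennreal ?B * ennreal ?V = ennreal (?V * ?B)" using B0 by (simp only: ennreal_mult[symmetric] measure_nonneg mult.commute)
    have n: "0 \<le> 4 * sqrt \<sigma> * real N * (?V + inv_sqrt_mass)" "0 \<le> ?V * ?B" "0 \<le> ?c * real m * real N * (4 * s\<^sup>2)"
      using \<sigma> i0 B0 c0 by (auto intro!: mult_nonneg_nonneg add_nonneg_nonneg)
    show ?thesis unfolding 1 2 3 using n
      by (simp only: ennreal_plus add_nonneg_nonneg add.assoc)
  qed
  finally show ?thesis .
qed

end

section \<open>From potentials to root averages\<close>

lemma root_sums_close_compact:
  fixes P :: "nat \<Rightarrow> 'w measure" and p :: "nat \<Rightarrow> 'w \<Rightarrow> complex poly" and q :: "nat \<Rightarrow> complex poly"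
    and g :: "complex \<Rightarrow> real"
  assumes P: "\<And>N. prob_space (P N)"
    and p: "\<And>N \<omega>. \<omega> \<in> space (P N) \<Longrightarrow> lead_coeff (p N \<omega>) = 1 \<and> size (proots (p N \<omega>)) = N"
    and q: "\<And>N. lead_coeff (q N) = 1 \<and> size (proots (q N)) = N"
    and pot: "\<And>N. (\<lambda>(\<omega>, z). pot (p N \<omega>) z) \<in> borel_measurable (P N \<Otimes>\<^sub>M borel)"
    and conv: "\<And>R e. R > 0 \<Longrightarrow> e > 0 \<Longrightarrow> \<forall>\<^sub>F N in sequentially.
      (\<integral>\<^sup>+\<omega>. \<integral>\<^sup>+z. ennreal \<bar>pot (p N \<omega>) z - pot (q N) z\<bar> * indicator (cball 0 R) z \<partial>lborel \<partial>P N) \<le> ennreal (e * real N)"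
    and g: "continuous_on UNIV g" "\<And>z. \<bar>g z\<bar> \<le> B" "\<And>z. z \<notin> cball 0 R \<Longrightarrow> g z = 0" and R: "R \<ge> 0" and e: "e > 0"
  shows "\<forall>\<^sub>F N in sequentially.
    (\<integral>\<^sup>+\<omega>. ennreal \<bar>(\<Sum>x\<in>#proots (p N \<omega>). g x) - (\<Sum>x\<in>#proots (q N). g x)\<bar> \<partial>P N) \<le> ennreal (e * real N)"
proof -
  have B: "B \<ge> 0" using g(2)[of 0] by linarith
  obtain r where r: "r > 0" "r \<le> 1" "\<And>z x. cmod (z - x) \<le> 2 * r \<Longrightarrow> \<bar>g z - g x\<bar> \<le> e / 4"
    by (rule uniform_modulus_compact_support[OF g(1,3), where e = "e / 4"]) (use e in auto)
  define c where "c = bump_mass r"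
  have c: "c > 0" using bump_mass_pos[OF r(1)] by (simp add: c_def)
  \<comment> \<open>Half of \<open>e\<close> is spent on mollification and half on the potentials;
    \<open>B + 1\<close> avoids division by 0.\<close>
  define e' where "e' = e * c / (4 * (B + 1))"
  have e': "e' > 0" using e c B by (simp add: e'_def)
  have "R + 2 * r > 0" using R r by simp
  from conv[OF this e'] show ?thesis
  proof eventually_elim
    case (elim N)
    interpret prob_space "P N" by (rule P)
    have [measurable]: "cball (0::complex) R \<in> sets borel" for R by simp
    let ?I = "\<lambda>\<omega>. \<integral>\<^sup>+z. ennreal \<bar>pot (p N \<omega>) z - pot (q N) z\<bar> * indicator (cball 0 (R + 2 * r)) z \<partial>lborel"
    have [measurable]: "?I \<in> borel_measurable (P N)"
    proof -
      note [measurable] = pot[of N]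
      have "(\<lambda>(\<omega>, z). ennreal \<bar>pot (p N \<omega>) z - pot (q N) z\<bar> * indicator (cball 0 (R + 2 * r)) z) \<in> borel_measurable (P N \<Otimes>\<^sub>M lborel)"
        by measurable
      then show ?thesis by (rule lborel.borel_measurable_nn_integral)
    qed
    have "(\<integral>\<^sup>+\<omega>. ennreal \<bar>(\<Sum>x\<in>#proots (p N \<omega>). g x) - (\<Sum>x\<in>#proots (q N). g x)\<bar> \<partial>P N)
      \<le> (\<integral>\<^sup>+\<omega>. ennreal (2 * real N * (e / 4)) + ennreal (2 * B / c) * ?I \<omega> \<partial>P N)"
      unfolding c_def using p q by (intro nn_integral_mono root_sum_diff_le g r) auto
    also have "\<dots> = ennreal (2 * real N * (e / 4)) + ennreal (2 * B / c) * (\<integral>\<^sup>+\<omega>. ?I \<omega> \<partial>P N)"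
      by (subst nn_integral_add) (auto simp: nn_integral_cmult emeasure_space_1)
    also have "\<dots> \<le> ennreal (2 * real N * (e / 4)) + ennreal (2 * B / c) * ennreal (e' * real N)"
      by (intro add_left_mono mult_left_mono elim) auto
    also have "\<dots> = ennreal (2 * real N * (e / 4) + 2 * B / c * (e' * real N))"
      using B c e e' by (simp add: ennreal_mult[symmetric] ennreal_plus[symmetric] del: ennreal_plus)
    also have "\<dots> \<le> ennreal (e * real N)"
    proof (rule ennreal_leI)
      have "2 * B / c * e' = e / 2 * (B / (B + 1))" using c B by (simp add: e'_def field_simps)
      also have "\<dots> \<le> e / 2 * 1" using e B by (intro mult_left_mono) auto
      finally have "2 * B / c * e' * real N \<le> e / 2 * real N" by (intro mult_right_mono) auto
      then show "2 * real N * (e / 4) + 2 * B / c * (e' * real N) \<le> e * real N" by (simp add: mult.assoc)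
    qed
    finally show ?case .
  qed
qed

text \<open>Bounded test functions need tightness. The roots of \<open>q N\<close> lie in a fixed
  disc, so a cutoff function that is 1 there has average 1 with respect to them; the compactly
  supported case, applied to the cutoff, shows that the roots of \<open>p N\<close> lose little mass
  outside, and applied to \<open>g\<close> times the cutoff it gives the claim.\<close>

lemma root_sums_close:
  fixes P :: "nat \<Rightarrow> 'w measure" and p :: "nat \<Rightarrow> 'w \<Rightarrow> complex poly" and q :: "nat \<Rightarrow> complex poly"
    and g :: "complex \<Rightarrow> real"
  assumes P: "\<And>N. prob_space (P N)"
    and p: "\<And>N \<omega>. \<omega> \<in> space (P N) \<Longrightarrow> lead_coeff (p N \<omega>) = 1 \<and> size (proots (p N \<omega>)) = N"
    and q: "\<And>N. lead_coeff (q N) = 1 \<and> size (proots (q N)) = N"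
    and pot: "\<And>N. (\<lambda>(\<omega>, z). pot (p N \<omega>) z) \<in> borel_measurable (P N \<Otimes>\<^sub>M borel)"
    and conv: "\<And>R e. R > 0 \<Longrightarrow> e > 0 \<Longrightarrow> \<forall>\<^sub>F N in sequentially.
      (\<integral>\<^sup>+\<omega>. \<integral>\<^sup>+z. ennreal \<bar>pot (p N \<omega>) z - pot (q N) z\<bar> * indicator (cball 0 R) z \<partial>lborel \<partial>P N) \<le> ennreal (e * real N)"
    and S: "S \<ge> 0" "\<And>N x. x \<in># proots (q N) \<Longrightarrow> cmod x \<le> S"
    and g: "continuous_on UNIV g" "\<And>z. \<bar>g z\<bar> \<le> B" and e: "e > 0"
  shows "\<forall>\<^sub>F N in sequentially.
    (\<integral>\<^sup>+\<omega>. ennreal \<bar>(\<Sum>x\<in>#proots (p N \<omega>). g x) - (\<Sum>x\<in>#proots (q N). g x)\<bar> \<partial>P N) \<le> ennreal (e * real N)"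
proof -
  define cut where "cut z = max 0 (min 1 (S + 1 - cmod z))" for z
  have B: "B \<ge> 0" using g(2)[of 0] by linarith
  have cut01: "0 \<le> cut z" "cut z \<le> 1" for z by (auto simp: cut_def)
  have cut0: "cut z = 0" if "z \<notin> cball 0 (S + 1)" for z using that by (simp add: cut_def)
  have cutc: "continuous_on UNIV cut" unfolding cut_def by (intro continuous_intros)
  have S1: "S + 1 \<ge> 0" using S by simp
  have gc: "continuous_on UNIV (\<lambda>z. g z * cut z)" by (intro continuous_intros g cutc)
  have gB: "\<bar>g z * cut z\<bar> \<le> B" for z
    using g(2)[of z] cut01[of z] mult_mono[of "\<bar>g z\<bar>" B "cut z" 1] B by (simp add: abs_mult)
  define e2 where "e2 = e / (2 * (B + 1))"
  have e2: "e2 > 0" using e B by (simp add: e2_def)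
  have 1: "\<forall>\<^sub>F N in sequentially. (\<integral>\<^sup>+\<omega>. ennreal \<bar>(\<Sum>x\<in>#proots (p N \<omega>). g x * cut x) - (\<Sum>x\<in>#proots (q N). g x * cut x)\<bar> \<partial>P N) \<le> ennreal (e / 2 * real N)"
    by (rule root_sums_close_compact[OF P p q pot conv gc gB _ S1]) (use e cut0 in auto)
  have 2: "\<forall>\<^sub>F N in sequentially. (\<integral>\<^sup>+\<omega>. ennreal \<bar>(\<Sum>x\<in>#proots (p N \<omega>). cut x) - (\<Sum>x\<in>#proots (q N). cut x)\<bar> \<partial>P N) \<le> ennreal (e2 * real N)"
    by (rule root_sums_close_compact[OF P p q pot conv cutc _ _ S1, where B = 1]) (use e2 cut0 cut01 in auto)
  from 1 2 show ?thesis
  proof eventually_elim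
    case (elim N)
    let ?A = "\<lambda>\<omega>. \<bar>(\<Sum>x\<in>#proots (p N \<omega>). g x * cut x) - (\<Sum>x\<in>#proots (q N). g x * cut x)\<bar>"
    let ?C = "\<lambda>\<omega>. \<bar>(\<Sum>x\<in>#proots (p N \<omega>). cut x) - (\<Sum>x\<in>#proots (q N). cut x)\<bar>"
    have [measurable]: "(\<lambda>\<omega>. \<Sum>x\<in>#proots (p N \<omega>). g x * cut x) \<in> borel_measurable (P N)"
      "(\<lambda>\<omega>. \<Sum>x\<in>#proots (p N \<omega>). cut x) \<in> borel_measurable (P N)"
      using p pot gc cutc by (auto intro!: measurable_root_sum)
    have "(\<integral>\<^sup>+\<omega>. ennreal \<bar>(\<Sum>x\<in>#proots (p N \<omega>). g x) - (\<Sum>x\<in>#proots (q N). g x)\<bar> \<partial>P N)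
      \<le> (\<integral>\<^sup>+\<omega>. ennreal (?A \<omega>) + ennreal B * ennreal (?C \<omega>) \<partial>P N)"
    proof (rule nn_integral_mono)
      fix \<omega> assume \<omega>: "\<omega> \<in> space (P N)"
      \<comment> \<open>The error of the cutoff is governed by the mass that the cutoff
        misses.\<close>
      have t: "\<bar>(\<Sum>x\<in>#A. g x) - (\<Sum>x\<in>#A. g x * cut x)\<bar> \<le> B * (real (size A) - (\<Sum>x\<in>#A. cut x))" for A
      proof (induction A)
        case (add x A)
        have "\<bar>g x - g x * cut x\<bar> = \<bar>g x\<bar> * (1 - cut x)"
          using cut01[of x] by (simp add: abs_mult flip: right_diff_distrib[of "g x" 1, simplified])
        also have "\<dots> \<le> B * (1 - cut x)" using g(2) cut01 by (intro mult_right_mono) auto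
        finally have "\<bar>g x - g x * cut x\<bar> \<le> B * (1 - cut x)" .
        with add show ?case by (simp add: algebra_simps abs_le_iff)
      qed simp
      have q1: "(\<Sum>x\<in>#A. g x * cut x) = (\<Sum>x\<in>#A. g x) \<and> (\<Sum>x\<in>#A. cut x) = real (size A)" if "\<And>x. x \<in># A \<Longrightarrow> cmod x \<le> S" for A
        using that by (induction A) (auto simp: cut_def)
      have qN: "(\<Sum>x\<in>#proots (q N). g x * cut x) = (\<Sum>x\<in>#proots (q N). g x)" "(\<Sum>x\<in>#proots (q N). cut x) = real N"
        using q1[of "proots (q N)"] S(2)[of _ N] q[of N] by auto
      have "\<bar>(\<Sum>x\<in>#proots (p N \<omega>). g x) - (\<Sum>x\<in>#proots (q N). g x)\<bar>
        \<le> ?A \<omega> + B * (real N - (\<Sum>x\<in>#proots (p N \<omega>). cut x))"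
      proof -
        have "size (proots (p N \<omega>)) = N" using p[OF \<omega>] by blast
        with t[of "proots (p N \<omega>)"] show ?thesis unfolding qN by simp
      qed
      also have "\<dots> \<le> ?A \<omega> + B * ?C \<omega>"
        unfolding qN using B by (intro add_left_mono mult_left_mono) auto
      finally show "ennreal \<bar>(\<Sum>x\<in>#proots (p N \<omega>). g x) - (\<Sum>x\<in>#proots (q N). g x)\<bar> \<le> ennreal (?A \<omega>) + ennreal B * ennreal (?C \<omega>)"
        using B by (simp add: ennreal_leI ennreal_mult[symmetric] ennreal_plus[symmetric] del: ennreal_plus)
    qed
    also have "\<dots> = (\<integral>\<^sup>+\<omega>. ennreal (?A \<omega>) \<partial>P N) + ennreal B * (\<integral>\<^sup>+\<omega>. ennreal (?C \<omega>) \<partial>P N)"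
      by (subst nn_integral_add) (auto simp: nn_integral_cmult)
    also have "\<dots> \<le> ennreal (e / 2 * real N) + ennreal B * ennreal (e2 * real N)"
      by (intro add_mono mult_left_mono elim) auto
    also have "\<dots> = ennreal (e / 2 * real N + B * (e2 * real N))"
      using B e e2 by (simp add: ennreal_mult[symmetric] ennreal_plus[symmetric] del: ennreal_plus)
    also have "\<dots> \<le> ennreal (e * real N)"
    proof (rule ennreal_leI)
      have "B * e2 = e / 2 * (B / (B + 1))" using B by (simp add: e2_def field_simps)
      also have "\<dots> \<le> e / 2 * 1" using e B by (intro mult_left_mono) auto
      finally have "B * e2 * real N \<le> e / 2 * real N" by (intro mult_right_mono) auto
      then show "e / 2 * real N + B * (e2 * real N) \<le> e * real N" by (simp add: mult.assoc)
    qed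
    finally show ?case .
  qed
qed

lemma tendsto_in_prob_of_L1:
  fixes P :: "nat \<Rightarrow> 'w measure" and X :: "nat \<Rightarrow> 'w \<Rightarrow> real" and y :: "nat \<Rightarrow> real"
  assumes P: "\<And>N. prob_space (P N)" and X: "\<And>N. X N \<in> borel_measurable (P N)"
    and y: "y \<longlonglongrightarrow> c"
    and L1: "\<And>e. e > 0 \<Longrightarrow> \<forall>\<^sub>F N in sequentially. (\<integral>\<^sup>+\<omega>. ennreal \<bar>X N \<omega> - y N\<bar> \<partial>P N) \<le> ennreal e"
  shows "tendsto_in_prob P X c"
  unfolding tendsto_in_prob_def
proof (intro conjI allI impI X)
  fix \<epsilon> :: real assume \<epsilon>: "\<epsilon> > 0"
  show "(\<lambda>N. measure (P N) {\<omega> \<in> space (P N). \<epsilon> < \<bar>X N \<omega> - c\<bar>}) \<longlonglongrightarrow> 0"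
  proof (rule tendstoI)
    fix e :: real assume e: "e > 0"
    define e' where "e' = e * \<epsilon> / 4"
    have e': "e' > 0" using e \<epsilon> by (simp add: e'_def)
    have "\<forall>\<^sub>F N in sequentially. dist (y N) c < \<epsilon> / 2" using y \<epsilon> by (intro tendstoD) auto
    with L1[OF e'] show "\<forall>\<^sub>F N in sequentially. dist (measure (P N) {\<omega> \<in> space (P N). \<epsilon> < \<bar>X N \<omega> - c\<bar>}) 0 < e"
    proof eventually_elim
      case (elim N)
      interpret prob_space "P N" by (rule P)
      note [measurable] = X
      let ?A = "{\<omega> \<in> space (P N). \<epsilon> < \<bar>X N \<omega> - c\<bar>}"
      have "?A \<subseteq> {\<omega> \<in> space (P N). 1 \<le> ennreal (2 / \<epsilon>) * ennreal \<bar>X N \<omega> - y N\<bar>}"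
      proof safe
        fix \<omega> assume "\<epsilon> < \<bar>X N \<omega> - c\<bar>"
        then have "\<epsilon> / 2 \<le> \<bar>X N \<omega> - y N\<bar>" using elim(2) by (auto simp: dist_real_def abs_if split: if_splits)
        then have "1 \<le> 2 / \<epsilon> * \<bar>X N \<omega> - y N\<bar>" using \<epsilon> by (simp add: field_simps)
        then show "1 \<le> ennreal (2 / \<epsilon>) * ennreal \<bar>X N \<omega> - y N\<bar>"
          using \<epsilon> by (simp add: ennreal_mult[symmetric])
      qed
      then have "emeasure (P N) ?A \<le> emeasure (P N) {\<omega> \<in> space (P N). 1 \<le> ennreal (2 / \<epsilon>) * ennreal \<bar>X N \<omega> - y N\<bar>}"
        by (intro emeasure_mono) measurable
      also have "\<dots> \<le> ennreal (2 / \<epsilon>) * (\<integral>\<^sup>+\<omega>. ennreal \<bar>X N \<omega> - y N\<bar> * indicator (space (P N)) \<omega> \<partial>P N)"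
        by (rule nn_integral_Markov_inequality) measurable
      also have "(\<integral>\<^sup>+\<omega>. ennreal \<bar>X N \<omega> - y N\<bar> * indicator (space (P N)) \<omega> \<partial>P N) = (\<integral>\<^sup>+\<omega>. ennreal \<bar>X N \<omega> - y N\<bar> \<partial>P N)"
        by (intro nn_integral_cong) simp
      also have "ennreal (2 / \<epsilon>) * (\<integral>\<^sup>+\<omega>. ennreal \<bar>X N \<omega> - y N\<bar> \<partial>P N) \<le> ennreal (2 / \<epsilon>) * ennreal e'"
        by (intro mult_left_mono elim) auto
      also have "\<dots> = ennreal (e / 2)"
        using \<epsilon> e by (simp add: ennreal_mult[symmetric] e'_def)
      finally have "measure (P N) ?A \<le> e / 2"
        using e by (simp add: emeasure_eq_measure)
      then show ?case using e measure_nonneg[of "P N" ?A] by simp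
    qed
  qed
qed

section \<open>Riemann sums and the limit law\<close>

lemma continuous_on_section:
  assumes c: "continuous_on (A \<times> B) (\<lambda>(x, t). H x t)" and x: "x \<in> A"
  shows "continuous_on B (H x)"
proof -
  have "continuous_on B (\<lambda>t. case (x, t) of (x, t) \<Rightarrow> H x t)"
  proof (rule continuous_on_compose2[OF c])
    show "continuous_on B (\<lambda>t. (x, t))" by (intro continuous_on_Pair continuous_on_const continuous_on_id)
  qed (use x in auto)
  then show ?thesis by simp
qed

lemma riemann_sum_error:
  fixes h :: "real \<Rightarrow> real"
  assumes c: "continuous_on {0..1} h" and w: "w \<ge> 0" and q: "real n * w \<le> 1"
    and mod: "\<And>x y. x \<in> {0..1} \<Longrightarrow> y \<in> {0..1} \<Longrightarrow> \<bar>x - y\<bar> \<le> w \<Longrightarrow> \<bar>h x - h y\<bar> \<le> e"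
  shows "\<bar>(\<Sum>k<n. w * h (real k * w)) - integral {0..real n * w} h\<bar> \<le> real n * w * e"
  using q
proof (induction n)
  case (Suc n)
  let ?a = "real n * w" and ?b = "real (Suc n) * w"
  have ab: "0 \<le> ?a" "?a \<le> ?b" "?b \<le> 1" using w Suc.prems by (auto simp: algebra_simps)
  have int: "h integrable_on {x..y}" if "0 \<le> x" "y \<le> 1" for x y
    by (rule integrable_continuous_real) (rule continuous_on_subset[OF c], use that in auto)
  have comb: "integral {0..?b} h = integral {0..?a} h + integral {?a..?b} h"
    using ab by (intro Henstock_Kurzweil_Integration.integral_combine[symmetric] int) auto
  have "\<bar>integral {?a..?b} (\<lambda>x. h x - h ?a)\<bar> \<le> e * (?b - ?a)"
  proof -
    have "norm (integral {?a..?b} (\<lambda>x. h x - h ?a)) \<le> e * (?b - ?a)"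
    proof (rule integral_bound[OF ab(2)])
      show "continuous_on {?a..?b} (\<lambda>x. h x - h ?a)"
        using ab by (intro continuous_intros continuous_on_subset[OF c]) auto
      fix t assume t: "t \<in> {?a..?b}"
      have "?b = ?a + w" by (simp add: algebra_simps)
      then have "t \<in> {0..1}" "?a \<in> {0..1}" "\<bar>t - ?a\<bar> \<le> w"
        using t ab by (auto simp del: of_nat_Suc intro: order.trans[OF ab(1)])
      then show "norm (h t - h ?a) \<le> e" using mod by simp
    qed
    then show ?thesis by simp
  qed
  moreover have "integral {?a..?b} (\<lambda>x. h x - h ?a) = integral {?a..?b} h - w * h ?a"
    using ab by (subst Henstock_Kurzweil_Integration.integral_diff[OF int integrable_const_ivl]) (auto simp: algebra_simps)
  ultimately have "\<bar>w * h ?a - integral {?a..?b} h\<bar> \<le> w * e" by (simp add: algebra_simps abs_minus_commute)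
  moreover have "\<bar>(\<Sum>k<n. w * h (real k * w)) - integral {0..?a} h\<bar> \<le> ?a * e"
    using Suc.prems w by (intro Suc.IH) (auto simp: algebra_simps)
  ultimately show ?case unfolding comb by (simp add: algebra_simps abs_le_iff)
qed simp

text \<open>The inner sums cover the whole unit interval and the outer one covers \<open>[0, q *
  w]\<close>, which may fall short of the unit interval; \<open>B * (1 - q * w)\<close> accounts for
  the missing part.\<close>

lemma double_riemann_sum_error:
  fixes H :: "real \<Rightarrow> real \<Rightarrow> real"
  assumes c: "continuous_on ({0..1} \<times> {0..1}) (\<lambda>(x, t). H x t)"
    and B: "\<And>x t. \<bar>H x t\<bar> \<le> B" and m: "m > 0" "real m * w' = w" and w: "w \<ge> 0" and q: "real q * w \<le> 1"
    and mod: "\<And>x y t u. x \<in> {0..1} \<Longrightarrow> y \<in> {0..1} \<Longrightarrow> t \<in> {0..1} \<Longrightarrow> u \<in> {0..1} \<Longrightarrow>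
       \<bar>x - y\<bar> \<le> w \<Longrightarrow> \<bar>t - u\<bar> \<le> 1 / real m \<Longrightarrow> \<bar>H x t - H y u\<bar> \<le> e"
  shows "\<bar>(\<Sum>I<q. \<Sum>k<m. w' * H (real I * w) (real k / real m)) - integral {0..1} (\<lambda>x. integral {0..1} (H x))\<bar>
    \<le> 2 * e + B * (1 - real q * w)"
proof -
  define h where "h x = integral {0..1} (H x)" for x
  have cx: "continuous_on {0..1} (H x)" if "x \<in> {0..1}" for x
    by (rule continuous_on_section[OF c that])
  have ix: "H x integrable_on {0..1}" if "x \<in> {0..1}" for x
    by (rule integrable_continuous_real[OF cx[OF that]])
  have e0: "e \<ge> 0" using mod[of 0 0 0 0] w by simp
  have B0: "B \<ge> 0" using B[of 0 0] by linarith
  have hc: "continuous_on {0..1} h"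
  proof -
    have "continuous_on {0..1} (\<lambda>x. integral (cbox 0 1) (H x))"
      by (rule integral_continuous_on_param) (use c in simp)
    then show ?thesis by (simp add: h_def)
  qed
  have hm: "\<bar>h x - h y\<bar> \<le> e" if "x \<in> {0..1}" "y \<in> {0..1}" "\<bar>x - y\<bar> \<le> w" for x y
  proof -
    have "norm (integral {0..1} (\<lambda>t. H x t - H y t)) \<le> e * (1 - 0)"
      using that mod[of x y] by (intro integral_bound continuous_intros cx) auto
    then show ?thesis unfolding h_def
      by (subst (asm) Henstock_Kurzweil_Integration.integral_diff) (use that ix in auto)
  qed
  have inner: "\<bar>(\<Sum>k<m. w' * H (real I * w) (real k / real m)) - w * h (real I * w)\<bar> \<le> w * e" if I: "I < q" for I
  proof -
    let ?x = "real I * w"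
    have "?x \<le> real q * w" using I w by (intro mult_right_mono) auto
    then have x: "?x \<in> {0..1}" using w q by auto
    have "\<bar>(\<Sum>k<m. 1 / real m * H ?x (real k * (1 / real m))) - integral {0..real m * (1 / real m)} (H ?x)\<bar> \<le> real m * (1 / real m) * e"
      by (rule riemann_sum_error[OF cx[OF x]]) (use m x mod[of ?x ?x] w in auto)
    then have "\<bar>(\<Sum>k<m. 1 / real m * H ?x (real k / real m)) - h ?x\<bar> \<le> e" using m by (simp add: h_def)
    then have "w * \<bar>(\<Sum>k<m. 1 / real m * H ?x (real k / real m)) - h ?x\<bar> \<le> w * e" using w by (rule mult_left_mono)
    moreover have "w * \<bar>(\<Sum>k<m. 1 / real m * H ?x (real k / real m)) - h ?x\<bar>
       = \<bar>w * ((\<Sum>k<m. 1 / real m * H ?x (real k / real m)) - h ?x)\<bar>" using w by (simp add: abs_mult)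
    moreover have "w * (\<Sum>k<m. 1 / real m * H ?x (real k / real m)) = (\<Sum>k<m. w' * H ?x (real k / real m))"
      using m by (simp add: sum_distrib_left m(2)[symmetric])
    ultimately show ?thesis by (simp add: right_diff_distrib)
  qed
  have 1: "\<bar>(\<Sum>I<q. \<Sum>k<m. w' * H (real I * w) (real k / real m)) - (\<Sum>I<q. w * h (real I * w))\<bar> \<le> e"
  proof -
    have "\<bar>(\<Sum>I<q. \<Sum>k<m. w' * H (real I * w) (real k / real m)) - (\<Sum>I<q. w * h (real I * w))\<bar>
      \<le> (\<Sum>I<q. \<bar>(\<Sum>k<m. w' * H (real I * w) (real k / real m)) - w * h (real I * w)\<bar>)"
      unfolding sum_subtractf[symmetric] by (rule sum_abs)
    also have "\<dots> \<le> (\<Sum>I<q. w * e)" by (intro sum_mono inner) auto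
    also have "\<dots> = (real q * w) * e" by simp
    also have "\<dots> \<le> 1 * e" using q e0 by (rule mult_right_mono)
    finally show ?thesis by simp
  qed
  have 2: "\<bar>(\<Sum>I<q. w * h (real I * w)) - integral {0..real q * w} h\<bar> \<le> e"
  proof -
    have "\<bar>(\<Sum>I<q. w * h (real I * w)) - integral {0..real q * w} h\<bar> \<le> real q * w * e"
      by (rule riemann_sum_error[OF hc w q hm])
    also have "\<dots> \<le> 1 * e" using q e0 by (rule mult_right_mono)
    finally show ?thesis by simp
  qed
  have qw: "0 \<le> real q * w" using w by simp
  have 3: "\<bar>integral {0..1} h - integral {0..real q * w} h\<bar> \<le> B * (1 - real q * w)"
  proof -
    have "h integrable_on {0..1}" by (rule integrable_continuous_real[OF hc])
    then have "integral {0..1} h = integral {0..real q * w} h + integral {real q * w..1} h"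
      using qw q by (intro Henstock_Kurzweil_Integration.integral_combine[symmetric]) auto
    moreover have "norm (integral {real q * w..1} h) \<le> B * (1 - real q * w)"
    proof (rule integral_bound[OF q])
      show "continuous_on {real q * w..1} h" using qw by (intro continuous_on_subset[OF hc]) auto
      fix t assume "t \<in> {real q * w..1}"
      then have t: "t \<in> {0..1}" using qw by auto
      have "norm (integral {0..1} (H t)) \<le> B * (1 - 0)" by (intro integral_bound cx t) (use B in auto)
      then show "norm (h t) \<le> B" by (simp add: h_def)
    qed
    ultimately show ?thesis by simp
  qed
  have "integral {0..1} (\<lambda>x. integral {0..1} (H x)) = integral {0..1} h" unfolding h_def[abs_def] ..
  with 1 2 3 show ?thesis by linarith
qed

text \<open>The pairs consisting of the left end of a block and an \<open>m\<close>-th root of unity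
  form a regular grid, so the eigenvalue average is a double Riemann sum, up to the fewer than
  \<open>m\<close> eigenvalues outside complete blocks.\<close>

lemma (in block_structure) node_average_error:
  fixes g :: "complex \<Rightarrow> real"
  defines "H \<equiv> \<lambda>x t. g (\<Sum>l\<le>d. f l x * cis (2 * pi * (real l * t)))"
  assumes c: "continuous_on ({0..1} \<times> {0..1}) (\<lambda>(x, t). H x t)" and B: "\<And>z. \<bar>g z\<bar> \<le> B"
    and mod: "\<And>x y t u. x \<in> {0..1} \<Longrightarrow> y \<in> {0..1} \<Longrightarrow> t \<in> {0..1} \<Longrightarrow> u \<in> {0..1} \<Longrightarrow>
       \<bar>x - y\<bar> \<le> real m / real N \<Longrightarrow> \<bar>t - u\<bar> \<le> 1 / real m \<Longrightarrow> \<bar>H x t - H y u\<bar> \<le> \<eta>"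
  shows "\<bar>(\<Sum>j<N. g (ev j)) / real N - integral {0..1} (\<lambda>x. integral {0..1} (H x))\<bar>
    \<le> 2 * \<eta> + 2 * B * (real m / real N)"
proof -
  have B0: "B \<ge> 0" using B[of 0] by linarith
  let ?w = "real m / real N"
  have qw: "real q * ?w \<le> 1" "1 - real q * ?w \<le> ?w"
  proof -
    have "real (q * m) \<le> real N" "real N \<le> real (q * m) + real m"
      using qm by (simp_all only: of_nat_le_iff of_nat_add[symmetric] less_imp_le)
    then have "real q * ?w * real N \<le> 1 * real N" "(1 - real q * ?w) * real N \<le> ?w * real N"
      using N0 by (simp_all add: algebra_simps)
    then show "real q * ?w \<le> 1" "1 - real q * ?w \<le> ?w"
      using N0 by (meson mult_right_le_imp_le of_nat_0_less_iff)+
  qed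
  have sp: "(\<Sum>j<N. g (ev j)) = (\<Sum>j<q * m. g (ev j)) + (\<Sum>j\<in>{q * m..<N}. g (ev j))"
    using qm(1) by (subst sum.union_disjoint[symmetric]) (auto intro!: sum.cong)
  have "(\<Sum>j<q * m. g (ev j)) = (\<Sum>I<q. \<Sum>j\<in>{I * m..<I * m + m}. g (ev j))"
    by (rule sum.nat_group[symmetric])
  also have "\<dots> = (\<Sum>I<q. \<Sum>k<m. H (real I * ?w) (real k / real m))"
  proof (rule sum.cong[OF refl])
    fix I assume I: "I \<in> {..<q}"
    show "(\<Sum>j\<in>{I * m..<I * m + m}. g (ev j)) = (\<Sum>k<m. H (real I * ?w) (real k / real m))"
    proof (rule sum.reindex_bij_witness[of _ "\<lambda>k. I * m + k" "\<lambda>j. j - I * m"])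
      fix j assume j: "j \<in> {I * m..<I * m + m}"
      then obtain k where k: "j = I * m + k" "k < m" by (metis atLeastLessThan_iff le_iff_add nat_add_left_cancel_less)
      have "j div m = I" "j mod m = k" using k by auto
      moreover from this have "j < q * m" using I by (simp add: div_less_q)
      ultimately show "H (real I * ?w) (real (j - I * m) / real m) = g (ev j)"
        using k by (simp add: H_def ev_def node_def)
    qed auto
  qed
  finally have main: "(\<Sum>j<q * m. g (ev j)) / real N = (\<Sum>I<q. \<Sum>k<m. 1 / real N * H (real I * ?w) (real k / real m))"
    by (simp add: sum_divide_distrib)
  have "\<bar>(\<Sum>I<q. \<Sum>k<m. 1 / real N * H (real I * ?w) (real k / real m)) - integral {0..1} (\<lambda>x. integral {0..1} (H x))\<bar>
    \<le> 2 * \<eta> + B * (1 - real q * ?w)"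
    by (rule double_riemann_sum_error[OF c _ m0 _ _ qw(1) mod]) (auto simp: H_def B)
  moreover have "B * (1 - real q * ?w) \<le> B * ?w" using qw(2) B0 by (rule mult_left_mono)
  moreover have "\<bar>(\<Sum>j\<in>{q * m..<N}. g (ev j)) / real N\<bar> \<le> B * ?w"
  proof -
    have "\<bar>\<Sum>j\<in>{q * m..<N}. g (ev j)\<bar> \<le> (\<Sum>j\<in>{q * m..<N}. B)"
      by (rule order.trans[OF sum_abs]) (intro sum_mono B)
    also have "\<dots> \<le> real m * B" using qm(2) B0 by (simp add: mult_right_mono)
    finally show ?thesis using N0 by (simp add: field_simps)
  qed
  ultimately show ?thesis unfolding sp add_divide_distrib main by linarith
qed

lemma integral_unif01:
  fixes h :: "real \<Rightarrow> real"
  assumes "continuous_on {0..1} h"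
  shows "(\<integral>x. h x \<partial>unif01) = integral {0..1} h"
proof -
  have i: "set_integrable lborel {0..1} h" by (rule borel_integrable_atLeastAtMost'[OF assms])
  have "(\<integral>x. h x \<partial>unif01) = (\<integral>x. indicator {0<..<1} x *\<^sub>R h x \<partial>lborel)"
    unfolding unif01_def by (subst integral_restrict_space) auto
  also have "\<dots> = (\<integral>x. indicator {0..1} x *\<^sub>R h x \<partial>lborel)"
  proof (rule integral_cong_AE)
    have m: "(\<lambda>x. indicator {0..1} x *\<^sub>R h x) \<in> borel_measurable lborel"
      using i by (auto simp: set_integrable_def)
    then show "(\<lambda>x. indicator {0..1} x *\<^sub>R h x) \<in> borel_measurable lborel" .
    have "(\<lambda>x. indicator {0<..<1} x *\<^sub>R h x) = (\<lambda>x. indicator {0<..<1} x *\<^sub>R (indicator {0..1} x *\<^sub>R h x))"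
      by (auto simp: indicator_def fun_eq_iff)
    also have "\<dots> \<in> borel_measurable lborel" using m by measurable
    finally show "(\<lambda>x. indicator {0<..<1} x *\<^sub>R h x) \<in> borel_measurable lborel" .
    have "AE x in lborel. x \<noteq> (0::real)" "AE x in lborel. x \<noteq> (1::real)" by (rule AE_lborel_singleton)+
    then show "AE x in lborel. indicator {0<..<1} x *\<^sub>R h x = indicator {0..1} x *\<^sub>R h x"
      by eventually_elim (auto simp: indicator_def)
  qed
  also have "\<dots> = integral {0..1} h"
    using set_borel_integral_eq_integral(2)[OF i] by (simp add: set_lebesgue_integral_def)
  finally show ?thesis .
qed

lemma prob_space_unif01: "prob_space unif01"
proof
  have "emeasure unif01 (space unif01) = emeasure lborel {0<..<1::real}"
    unfolding unif01_def by (simp add: space_restrict_space emeasure_restrict_space)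
  then show "emeasure unif01 (space unif01) = 1" by simp
qed

text \<open>The substitution \<open>u = cis (2 * pi * t)\<close> expresses the limit law through two
  independent uniform variables on the unit interval.\<close>

lemma integral_limit_law:
  fixes g :: "complex \<Rightarrow> real"
  assumes f: "\<And>l. l \<le> d \<Longrightarrow> continuous_on {0..1} (f l)"
    and g: "continuous_on UNIV g" and B: "\<And>z. \<bar>g z\<bar> \<le> B"
  defines "H \<equiv> \<lambda>x t. g (\<Sum>l\<le>d. f l x * cis (2 * pi * (real l * t)))"
  shows "continuous_on ({0..1} \<times> {0..1}) (\<lambda>(x, t). H x t)"
    and "(\<integral>z. g z \<partial>limit_law d f) = integral {0..1} (\<lambda>x. integral {0..1} (H x))"
proof -
  have [measurable]: "g \<in> borel_measurable borel" using g by (rule borel_measurable_continuous_onI)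
  show c: "continuous_on ({0..1} \<times> {0..1}) (\<lambda>(x, t). H x t)"
  proof -
    have "continuous_on ({0..1} \<times> {0..1}) (\<lambda>p. f l (fst p))" if "l \<le> d" for l
      by (rule continuous_on_compose2[OF f[OF that]]) (auto intro!: continuous_intros)
    then have "continuous_on ({0..1} \<times> {0..1}) (\<lambda>p. \<Sum>l\<le>d. f l (fst p) * cis (2 * pi * (real l * snd p)))"
      by (intro continuous_intros) auto
    then have "continuous_on ({0..1} \<times> {0..1}) (\<lambda>p. g (\<Sum>l\<le>d. f l (fst p) * cis (2 * pi * (real l * snd p))))"
      by (rule continuous_on_compose2[OF g]) auto
    then show ?thesis by (simp add: H_def split_beta')
  qed
  interpret U: prob_space unif01 by (rule prob_space_unif01)
  have cm[measurable]: "(\<lambda>t. cis (2 * pi * t)) \<in> unif01 \<rightarrow>\<^sub>M borel"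
    unfolding unif01_def by (rule measurable_restrict_space1) simp
  interpret C: prob_space unif_circle unfolding unif_circle_def by (rule U.prob_space_distr[OF cm])
  interpret pair_prob_space unif01 unif_circle ..
  have fm[measurable]: "f l \<in> borel_measurable unif01" if "l \<le> d" for l
  proof -
    have "f l \<in> borel_measurable (restrict_space borel {0<..<1})"
      by (rule borel_measurable_continuous_on_restrict) (rule continuous_on_subset[OF f[OF that]], auto)
    moreover have "sets (restrict_space borel {0<..<1}) = sets unif01"
      unfolding unif01_def by (intro sets_restrict_space_cong) simp
    ultimately show ?thesis by (simp cong: measurable_cong_sets)
  qed
  have sC[measurable_cong]: "sets unif_circle = sets borel" by (simp add: unif_circle_def)
  let ?\<phi> = "\<lambda>p. \<Sum>l\<le>d. f l (fst p) * snd p ^ l"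
  have \<phi>: "?\<phi> \<in> borel_measurable (unif01 \<Otimes>\<^sub>M unif_circle)"
  proof (rule borel_measurable_sum)
    fix l assume "l \<in> {..d}"
    then have [measurable]: "f l \<in> borel_measurable unif01" by (intro fm) simp
    show "(\<lambda>p. f l (fst p) * snd p ^ l) \<in> borel_measurable (unif01 \<Otimes>\<^sub>M unif_circle)" by measurable
  qed
  have gm: "(\<lambda>p. g (?\<phi> p)) \<in> borel_measurable (unif01 \<Otimes>\<^sub>M unif_circle)"
    by (rule measurable_compose[OF \<phi>]) simp
  have "(\<integral>z. g z \<partial>limit_law d f) = (\<integral>p. g (?\<phi> p) \<partial>(unif01 \<Otimes>\<^sub>M unif_circle))"
    unfolding limit_law_def using \<phi> by (subst integral_distr) (auto simp: split_beta')
  also have "\<dots> = (\<integral>x. \<integral>u. g (?\<phi> (x, u)) \<partial>unif_circle \<partial>unif01)"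
  proof -
    have "integrable (unif01 \<Otimes>\<^sub>M unif_circle) (\<lambda>p. g (?\<phi> p))"
      by (rule P.integrable_const_bound[of _ B]) (use gm B in auto)
    then show ?thesis by (intro integral_fst'[symmetric])
  qed
  also have "\<dots> = (\<integral>x. integral {0..1} (H x) \<partial>unif01)"
  proof (rule Bochner_Integration.integral_cong[OF refl])
    fix x assume "x \<in> space unif01"
    then have x: "x \<in> {0..1}" by (auto simp: unif01_def space_restrict_space)
    have "(\<integral>u. g (?\<phi> (x, u)) \<partial>unif_circle) = (\<integral>t. g (?\<phi> (x, cis (2 * pi * t))) \<partial>unif01)"
      unfolding unif_circle_def
    proof (rule integral_distr[OF cm])
      show "(\<lambda>u. g (?\<phi> (x, u))) \<in> borel_measurable borel" unfolding fst_conv snd_conv by measurable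
    qed
    also have "\<dots> = (\<integral>t. H x t \<partial>unif01)"
      by (simp add: H_def Complex.DeMoivre mult_ac)
    also have "\<dots> = integral {0..1} (H x)"
      by (rule integral_unif01[OF continuous_on_section[OF c x]])
    finally show "(\<integral>u. g (?\<phi> (x, u)) \<partial>unif_circle) = integral {0..1} (H x)" .
  qed
  also have "\<dots> = integral {0..1} (\<lambda>x. integral {0..1} (H x))"
  proof (rule integral_unif01)
    have "continuous_on {0..1} (\<lambda>x. integral (cbox 0 1) (H x))"
      by (rule integral_continuous_on_param) (use c in simp)
    then show "continuous_on {0..1} (\<lambda>x. integral {0..1} (H x))" by simp
  qed
  finally show "(\<integral>z. g z \<partial>limit_law d f) = integral {0..1} (\<lambda>x. integral {0..1} (H x))" .
qed

section \<open>Potentials of the noisy band matrix\<close>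

lemma shift_mat_power:
  "shift_mat N ^\<^sub>m l \<in> carrier_mat N N"
  "i < N \<Longrightarrow> j < N \<Longrightarrow> (shift_mat N ^\<^sub>m l) $$ (i, j) = (if j = i + l then 1 else 0)"
proof (induction l arbitrary: j)
  case 0
  { case 1 show ?case by (simp add: shift_mat_def) }
  { case 2 then show ?case by (simp add: shift_mat_def) }
next
  case (Suc l)
  have S: "shift_mat N \<in> carrier_mat N N" by (simp add: shift_mat_def)
  { case 1 show ?case unfolding pow_mat.simps by (rule mult_carrier_mat[OF Suc.IH(1) S]) }
  { case 2
    have "(shift_mat N ^\<^sub>m Suc l) $$ (i, j) = (\<Sum>a<N. (shift_mat N ^\<^sub>m l) $$ (i, a) * shift_mat N $$ (a, j))"
      using 2 Suc.IH(1) S by (simp add: scalar_prod_def atLeast0LessThan)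
    also have "\<dots> = (\<Sum>a<N. if a = i + l then (if j = Suc a then 1 else 0) else 0)"
      using 2 Suc.IH(2) by (intro sum.cong refl) (simp add: shift_mat_def)
    also have "\<dots> = (if j = i + Suc l then 1 else 0)" using 2 by (auto simp: sum.delta)
    finally show ?case . }
qed

lemma banded_mat_entry:
  assumes "i < N" "j < N"
  shows "banded_mat d f N $$ (i, j) = (\<Sum>l\<le>d. if j = i + l then f l (real (i + 1) / real N) else 0)"
proof -
  have "(sample_diag N (f l) * shift_mat N ^\<^sub>m l) $$ (i, j) = (if j = i + l then f l (real (i + 1) / real N) else 0)" for l
    unfolding sample_diag_def
    by (subst mat_diag_mult_left[OF shift_mat_power(1)]) (use assms in \<open>simp add: shift_mat_power\<close>)
  then show ?thesis unfolding banded_mat_def using assms by simp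
qed

lemma noisy_banded_carrier:
  assumes "G \<in> carrier_mat N N"
  shows "banded_mat d f N + c \<cdot>\<^sub>m G \<in> carrier_mat N N"
  using assms by (auto simp: banded_mat_def)

lemma noisy_banded_entry:
  assumes "G \<in> carrier_mat N N" "i < N" "j < N"
  shows "(banded_mat d f N + c \<cdot>\<^sub>m G) $$ (i, j)
    = (\<Sum>l\<le>d. if j = i + l then f l (real (i + 1) / real N) else 0) + c * G $$ (i, j)"
  using assms by (simp add: banded_mat_entry)

text \<open>The potential of the characteristic polynomial is the logarithm of a determinant, which
  is a polynomial in the matrix entries and \<open>z\<close>.\<close>

lemma noisy_banded_pot_measurable:
  assumes G: "complex_gaussian_matrix P N G"
  shows "(\<lambda>(\<omega>, z). pot (char_poly (banded_mat d f N + c \<cdot>\<^sub>m G \<omega>)) z) \<in> borel_measurable (P \<Otimes>\<^sub>M borel)"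
proof -
  let ?b = "\<lambda>i j. \<Sum>l\<le>d. if j = i + l then f l (real (i + 1) / real N) else 0"
  have C: "G \<omega> \<in> carrier_mat N N" if "\<omega> \<in> space P" for \<omega>
    using G that by (simp add: complex_gaussian_matrix_def)
  have "(\<lambda>p. ndet N (\<lambda>i j. (if i = j then snd p else 0) - (?b i j + c * G (fst p) $$ (i, j)))) \<in> borel_measurable (P \<Otimes>\<^sub>M borel)"
  proof (rule measurable_ndet)
    fix i j assume "i < N" "j < N"
    note [measurable] = gaussian_entry_measurable[OF G this]
    show "(\<lambda>p. (if i = j then snd p else 0) - (?b i j + c * G (fst p) $$ (i, j))) \<in> borel_measurable (P \<Otimes>\<^sub>M borel)"
    proof (intro borel_measurable_diff borel_measurable_add borel_measurable_times borel_measurable_const)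
      show "(\<lambda>p. if i = j then snd p else 0) \<in> borel_measurable (P \<Otimes>\<^sub>M borel)" by (cases "i = j") simp_all
      show "(\<lambda>p. G (fst p) $$ (i, j)) \<in> borel_measurable (P \<Otimes>\<^sub>M borel)" by measurable
    qed
  qed
  then have "(\<lambda>p. ln (cmod (ndet N (\<lambda>i j. (if i = j then snd p else 0) - (?b i j + c * G (fst p) $$ (i, j)))))) \<in> borel_measurable (P \<Otimes>\<^sub>M borel)"
    by measurable
  also have "?this \<longleftrightarrow> (\<lambda>(\<omega>, z). pot (char_poly (banded_mat d f N + c \<cdot>\<^sub>m G \<omega>)) z) \<in> borel_measurable (P \<Otimes>\<^sub>M borel)"
  proof (rule measurable_cong)
    fix p assume "p \<in> space (P \<Otimes>\<^sub>M (borel :: complex measure))"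
    then have "fst p \<in> space P" by (auto simp: space_pair_measure)
    note C = C[OF this]
    show "ln (cmod (ndet N (\<lambda>i j. (if i = j then snd p else 0) - (?b i j + c * G (fst p) $$ (i, j)))))
      = (case p of (\<omega>, z) \<Rightarrow> pot (char_poly (banded_mat d f N + c \<cdot>\<^sub>m G \<omega>)) z)"
      unfolding split_beta pot_def char_poly_eq_ndet[OF noisy_banded_carrier[OF C]]
      by (rule arg_cong[where f = "\<lambda>x. ln (cmod x)"], rule ndet_cong) (simp add: noisy_banded_entry[OF C])
  qed
  finally show ?thesis .
qed

text \<open>A polynomial with prescribed roots, so that the explicit eigenvalues of the
  block-circulant matrix can be compared with those of a random matrix as root multisets.\<close>

definition root_poly :: "nat \<Rightarrow> (nat \<Rightarrow> complex) \<Rightarrow> complex poly" where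
  "root_poly N \<mu> = (\<Prod>j<N. [:- \<mu> j, 1:])"

lemma proots_root_poly: "proots (root_poly N \<mu>) = image_mset \<mu> (mset_set {..<N})"
proof (induction N)
  case (Suc N)
  have "root_poly N \<mu> \<noteq> 0" by (simp add: root_poly_def)
  then have "proots (root_poly N \<mu> * [:- \<mu> N, 1:]) = proots (root_poly N \<mu>) + {#\<mu> N#}"
    by (subst proots_mult) auto
  with Suc show ?case by (simp add: root_poly_def lessThan_Suc)
qed (simp add: root_poly_def)

lemma lead_coeff_root_poly: "lead_coeff (root_poly N \<mu>) = 1"
  by (simp add: root_poly_def lead_coeff_prod)

lemma pot_root_poly:
  assumes "\<And>j. j < N \<Longrightarrow> z \<noteq> \<mu> j"
  shows "pot (root_poly N \<mu>) z = (\<Sum>j<N. ln (cmod (z - \<mu> j)))"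
proof -
  have "cmod (poly (root_poly N \<mu>) z) = (\<Prod>j<N. cmod (z - \<mu> j))"
    by (simp add: root_poly_def poly_prod prod_norm)
  then show ?thesis unfolding pot_def using assms by (simp only:) (subst ln_prod, auto)
qed

lemma sum_root_poly: "(\<Sum>x\<in>#proots (root_poly N \<mu>). g x) = (\<Sum>j<N. g (\<mu> j))"
  by (simp add: proots_root_poly sum_unfold_sum_mset image_mset.compositionality o_def)

text \<open>Rewrites the bound as \<open>N\<close> times a quantity in which the integers
  \<open>m\<close> and \<open>q\<close> have been replaced by a real scale \<open>M\<close>
  comparable to \<open>m\<close>; \<open>A\<close> bounds the proportion of rows altered by the
  cyclic closure or left over.\<close>

lemma (in block_structure) total_bound_le:
  assumes \<sigma>: "\<sigma> > 0" and \<delta>: "\<delta> > 0" and s: "0 < s" and R: "R \<ge> 0" and M: "0 < M" "real m \<le> M" "M \<le> 2 * real m" and V: "V \<ge> 0"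
  defines "A \<equiv> 2 * real d / M + M / real N"
  shows "4 * sqrt \<sigma> * real N * (V + inv_sqrt_mass)
        + V * (2 * real N * e / s + change_cost R \<delta> * real (d * q + m) + 2 * residual \<sigma> \<delta>)
        + change_cost R \<delta> * real m * real N * (4 * s\<^sup>2)
    \<le> real N * (4 * sqrt \<sigma> * (V + inv_sqrt_mass)
        + V * (2 * (e / s) + change_cost R \<delta> * A + 2 / \<sigma> * (e + 2 * S * sqrt A + 5 * \<delta> * sqrt (real N)))
        + change_cost R \<delta> * M * (4 * s\<^sup>2))"
proof -
  have c0: "change_cost R \<delta> \<ge> 0" by (rule change_cost_nonneg[OF R \<delta>])
  have N: "real N > 0" using N0 by simp
  have mm: "real m > 0" using m0 by simp
  have X: "real (d * q + m) \<le> real N * A"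
  proof -
    have "real q * real m \<le> real N" using qm(1) by (metis of_nat_le_iff of_nat_mult)
    then have "real q * M \<le> real q * (2 * real m)" "real q * (2 * real m) \<le> 2 * real N" using M by (auto intro: mult_left_mono)
    then have "real q * M \<le> 2 * real N" by linarith
    then have "real q \<le> 2 * real N / M" using M by (simp add: pos_le_divide_eq)
    then have "real d * real q \<le> real d * (2 * real N / M)" by (rule mult_left_mono) simp
    moreover have "real N * A = real d * (2 * real N / M) + M" using N by (simp add: A_def field_simps)
    ultimately show ?thesis using M(2) by simp
  qed
  have A0: "A \<ge> 0" using M N by (simp add: A_def)
  have gen: "r / \<sigma> * (r * X + Y) = 1 / \<sigma> * ((r * r) * X + Y * r)" for r X Y :: real
    by (simp add: algebra_simps add_divide_distrib)
  have r: "residual \<sigma> \<delta> \<le> real N * (1 / \<sigma> * (e + 2 * S * sqrt A + 5 * \<delta> * sqrt (real N)))"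
  proof -
    have "sqrt (real N * e\<^sup>2 + real (d * q + m) * (2 * S)\<^sup>2) \<le> sqrt (real N * e\<^sup>2 + (real N * A) * (2 * S)\<^sup>2)"
      by (intro real_sqrt_le_mono add_left_mono mult_right_mono X) simp
    also have "\<dots> \<le> sqrt (real N * e\<^sup>2) + sqrt ((real N * A) * (2 * S)\<^sup>2)"
      using A0 by (intro sqrt_add_le_add_sqrt) auto
    also have "\<dots> = sqrt (real N) * (e + 2 * S * sqrt A)"
      using e0 S0 by (simp add: real_sqrt_mult algebra_simps)
    finally have "residual \<sigma> \<delta> \<le> sqrt (real N) / \<sigma> * (sqrt (real N) * (e + 2 * S * sqrt A) + 5 * \<delta> * real N)"
      unfolding residual_def using \<sigma> by (intro mult_left_mono add_right_mono) auto
    also have "\<dots> = 1 / \<sigma> * ((sqrt (real N) * sqrt (real N)) * (e + 2 * S * sqrt A) + 5 * \<delta> * real N * sqrt (real N))"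
      by (rule gen)
    also have "sqrt (real N) * sqrt (real N) = real N" by simp
    finally show ?thesis by (simp add: algebra_simps)
  qed
  have 1: "V * (2 * real N * e / s + change_cost R \<delta> * real (d * q + m) + 2 * residual \<sigma> \<delta>)
    \<le> V * (2 * real N * e / s + change_cost R \<delta> * (real N * A) + 2 * (real N * (1 / \<sigma> * (e + 2 * S * sqrt A + 5 * \<delta> * sqrt (real N)))))"
    using V c0 X r by (intro mult_left_mono add_mono) auto
  have 2: "change_cost R \<delta> * real m * real N * (4 * s\<^sup>2) \<le> change_cost R \<delta> * M * real N * (4 * s\<^sup>2)"
    using c0 M by (intro mult_right_mono mult_left_mono) auto
  have 3: "real N * (4 * sqrt \<sigma> * (V + inv_sqrt_mass)
        + V * (2 * (e / s) + change_cost R \<delta> * A + 2 / \<sigma> * (e + 2 * S * sqrt A + 5 * \<delta> * sqrt (real N)))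
        + change_cost R \<delta> * M * (4 * s\<^sup>2))
    = 4 * sqrt \<sigma> * real N * (V + inv_sqrt_mass)
      + V * (2 * real N * e / s + change_cost R \<delta> * (real N * A) + 2 * (real N * (1 / \<sigma> * (e + 2 * S * sqrt A + 5 * \<delta> * sqrt (real N)))))
      + change_cost R \<delta> * M * real N * (4 * s\<^sup>2)"
    by (simp add: algebra_simps)
  show ?thesis unfolding 3 using 1 2 by linarith
qed

lemma (in block_structure) potential_deviation:
  fixes P :: "'w measure" and G :: "'w \<Rightarrow> complex mat"
  assumes P: "prob_space P" and G: "complex_gaussian_matrix P N G"
    and \<delta>: "\<delta> > 0" and s: "0 < s" "s \<le> 1" "2 * e \<le> s" and \<sigma>: "\<sigma> > 0" and R: "R \<ge> 0"
    and M: "0 < M" "real m \<le> M" "M \<le> 2 * real m"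
  defines "A \<equiv> 2 * real d / M + M / real N" and "V \<equiv> measure lborel (cball (0::complex) R)"
  shows "(\<integral>\<^sup>+\<omega>. \<integral>\<^sup>+z. ennreal \<bar>pot (char_poly (banded_mat d f N + of_real \<delta> \<cdot>\<^sub>m G \<omega>)) z - pot (root_poly N ev) z\<bar>
       * indicator (cball 0 R) z \<partial>lborel \<partial>P)
    \<le> ennreal (real N * (4 * sqrt \<sigma> * (V + inv_sqrt_mass)
        + V * (2 * (e / s) + change_cost R \<delta> * A + 2 / \<sigma> * (e + 2 * S * sqrt A + 5 * \<delta> * sqrt (real N)))
        + change_cost R \<delta> * M * (4 * s\<^sup>2)))"
proof -
  interpret prob_space P by (rule P)
  interpret PL: pair_sigma_finite P "lborel :: complex measure" ..
  have [measurable]: "cball (0::complex) R \<in> sets borel" by simp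
  let ?p = "\<lambda>\<omega>. char_poly (banded_mat d f N + of_real \<delta> \<cdot>\<^sub>m G \<omega>)"
  note [measurable] = noisy_banded_pot_measurable[OF G, of d f "of_real \<delta>"]
  have "(\<integral>\<^sup>+\<omega>. \<integral>\<^sup>+z. ennreal \<bar>pot (?p \<omega>) z - pot (root_poly N ev) z\<bar> * indicator (cball 0 R) z \<partial>lborel \<partial>P)
    = (\<integral>\<^sup>+z. \<integral>\<^sup>+\<omega>. ennreal \<bar>pot (?p \<omega>) z - pot (root_poly N ev) z\<bar> * indicator (cball 0 R) z \<partial>P \<partial>lborel)"
    by (rule PL.Fubini'[symmetric]) measurable
  also have "\<dots> = (\<integral>\<^sup>+z. (\<integral>\<^sup>+\<omega>. ennreal \<bar>ln (noisy_det \<delta> (\<lambda>i j. G \<omega> $$ (i, j)) z) - ref_pot z\<bar> \<partial>P) * indicator (cball 0 R) z \<partial>lborel)"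
  proof (rule nn_integral_cong_AE)
    have "AE z in lborel. \<forall>j\<in>{..<N}. z \<noteq> ev j"
      by (intro AE_finite_allI AE_lborel_singleton) auto
    then show "AE z in lborel. (\<integral>\<^sup>+\<omega>. ennreal \<bar>pot (?p \<omega>) z - pot (root_poly N ev) z\<bar> * indicator (cball 0 R) z \<partial>P)
      = (\<integral>\<^sup>+\<omega>. ennreal \<bar>ln (noisy_det \<delta> (\<lambda>i j. G \<omega> $$ (i, j)) z) - ref_pot z\<bar> \<partial>P) * indicator (cball 0 R) z"
    proof eventually_elim
      case (elim z)
      have r: "pot (root_poly N ev) z = ref_pot z"
        unfolding ref_pot_def using elim by (intro pot_root_poly) auto
      have p: "pot (?p \<omega>) z = ln (noisy_det \<delta> (\<lambda>i j. G \<omega> $$ (i, j)) z)" if "\<omega> \<in> space P" for \<omega>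
      proof -
        have C: "G \<omega> \<in> carrier_mat N N" using G that by (simp add: complex_gaussian_matrix_def)
        show ?thesis
          unfolding pot_def noisy_det_def char_poly_eq_ndet[OF noisy_banded_carrier[OF C]]
          by (rule arg_cong[where f = "\<lambda>x. ln (cmod x)"], rule ndet_cong)
            (simp only: noisy_banded_entry[OF C] shifted_entry_def band_def pt_def diff_diff_eq)
      qed
      have "(\<integral>\<^sup>+\<omega>. ennreal \<bar>pot (?p \<omega>) z - pot (root_poly N ev) z\<bar> * indicator (cball 0 R) z \<partial>P)
        = (\<integral>\<^sup>+\<omega>. ennreal \<bar>ln (noisy_det \<delta> (\<lambda>i j. G \<omega> $$ (i, j)) z) - ref_pot z\<bar> * indicator (cball 0 R) z \<partial>P)"
        unfolding r by (rule nn_integral_cong) (simp add: p)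
      also have "\<dots> = (\<integral>\<^sup>+\<omega>. ennreal \<bar>ln (noisy_det \<delta> (\<lambda>i j. G \<omega> $$ (i, j)) z) - ref_pot z\<bar> \<partial>P) * indicator (cball 0 R) z"
        by (cases "z \<in> cball 0 R") simp_all
      finally show ?case .
    qed
  qed
  also have "\<dots> \<le> ennreal (4 * sqrt \<sigma> * real N * (V + inv_sqrt_mass)
        + V * (2 * real N * e / s + change_cost R \<delta> * real (d * q + m) + 2 * residual \<sigma> \<delta>)
        + change_cost R \<delta> * real m * real N * (4 * s\<^sup>2))"
    unfolding V_def by (rule log_det_deviation_integrated[OF P G \<delta> s \<sigma> R])
  also have "\<dots> \<le> ennreal (real N * (4 * sqrt \<sigma> * (V + inv_sqrt_mass)
        + V * (2 * (e / s) + change_cost R \<delta> * A + 2 / \<sigma> * (e + 2 * S * sqrt A + 5 * \<delta> * sqrt (real N)))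
        + change_cost R \<delta> * M * (4 * s\<^sup>2)))"
    unfolding A_def by (intro ennreal_leI total_bound_le \<sigma> \<delta> s(1) R M) (simp add: V_def)
  finally show ?thesis .
qed

lemma log_times_power_decay:
  fixes k1 k2 k3 k4 b \<gamma> :: real
  assumes "k2 > 0" "\<gamma> > 0" "b > 0"
  shows "(\<lambda>n. (k1 * (ln (2 + k2 / real n powr (-\<gamma>)) + k3) + k4) * real n powr (-b)) \<longlonglongrightarrow> 0"
  using assms by real_asymp

lemma power_decay: "b > 0 \<Longrightarrow> (\<lambda>n. real n powr (-b)) \<longlonglongrightarrow> 0"
  by real_asymp

text \<open>Finitely many Hoelder functions on a bounded interval share an exponent and a constant:
  take the smallest exponent.\<close>

lemma holder_common:
  fixes d :: nat and \<alpha> :: "nat \<Rightarrow> real"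
  assumes \<alpha>: "\<And>l. l \<le> d \<Longrightarrow> \<alpha> l > 0" and f: "\<And>l. l \<le> d \<Longrightarrow> holder_on (\<alpha> l) {0..1} (f l)"
  obtains a C S where "0 < a" "a \<le> 1" "C \<ge> 0" "S \<ge> 0"
    "\<And>l x y. l \<le> d \<Longrightarrow> x \<in> {0..1} \<Longrightarrow> y \<in> {0..1} \<Longrightarrow> cmod (f l x - f l y) \<le> C * \<bar>x - y\<bar> powr a"
    "\<And>x. x \<in> {0..1} \<Longrightarrow> (\<Sum>l\<le>d. cmod (f l x)) \<le> S"
proof -
  have "\<exists>C\<ge>0. \<forall>x\<in>{0..1}. \<forall>y\<in>{0..1}. cmod (f l x - f l y) \<le> C * \<bar>x - y\<bar> powr \<alpha> l" if "l \<le> d" for l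
    using f[OF that] by (simp add: holder_on_def)
  then obtain K where K: "\<And>l. l \<le> d \<Longrightarrow> K l \<ge> 0"
    "\<And>l x y. l \<le> d \<Longrightarrow> x \<in> {0..1} \<Longrightarrow> y \<in> {0..1} \<Longrightarrow> cmod (f l x - f l y) \<le> K l * \<bar>x - y\<bar> powr \<alpha> l"
    by metis
  define a where "a = Min (insert 1 (\<alpha> ` {..d}))"
  define C where "C = (\<Sum>l\<le>d. K l)"
  define S where "S = (\<Sum>l\<le>d. cmod (f l 0) + C)"
  have a: "0 < a" "a \<le> 1" unfolding a_def using \<alpha> by (auto simp: Min_gr_iff)
  have a\<alpha>: "a \<le> \<alpha> l" if "l \<le> d" for l unfolding a_def by (rule Min_le) (use that in auto)
  have C: "C \<ge> 0" "\<And>l. l \<le> d \<Longrightarrow> K l \<le> C"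
    unfolding C_def using K(1) by (auto intro!: sum_nonneg member_le_sum)
  have H: "cmod (f l x - f l y) \<le> C * \<bar>x - y\<bar> powr a" if "l \<le> d" "x \<in> {0..1}" "y \<in> {0..1}" for l x y
  proof -
    have "\<bar>x - y\<bar> powr \<alpha> l \<le> \<bar>x - y\<bar> powr a" using that a a\<alpha>[OF that(1)] by (intro powr_mono') auto
    then have "K l * \<bar>x - y\<bar> powr \<alpha> l \<le> C * \<bar>x - y\<bar> powr a"
      using C that K(1) by (intro mult_mono) auto
    then show ?thesis using K(2)[OF that] by linarith
  qed
  have "(\<Sum>l\<le>d. cmod (f l x)) \<le> S" if "x \<in> {0..1}" for x
    unfolding S_def
  proof (rule sum_mono)
    fix l assume "l \<in> {..d}"
    then have "cmod (f l x - f l 0) \<le> C * \<bar>x - 0\<bar> powr a" using that by (intro H) auto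
    also have "\<dots> \<le> C * 1" using that C a by (intro mult_left_mono powr_le1) auto
    finally show "cmod (f l x) \<le> cmod (f l 0) + C" using norm_triangle_ineq2[of "f l x" "f l 0"] by linarith
  qed
  moreover have "S \<ge> 0" unfolding S_def using C by (intro sum_nonneg) auto
  ultimately show thesis using that a C(1) H by blast
qed

lemma holder_continuous:
  assumes "a > 0" "\<And>x y. x \<in> {0..1} \<Longrightarrow> y \<in> {0..1} \<Longrightarrow> cmod (f x - f y) \<le> C * \<bar>x - y\<bar> powr a"
  shows "continuous_on {0..1::real} f"
  unfolding continuous_on
proof
  fix x :: real assume x: "x \<in> {0..1}"
  have "((\<lambda>y. C * \<bar>y - x\<bar> powr a) \<longlongrightarrow> C * \<bar>x - x\<bar> powr a) (at x within {0..1})"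
    using assms(1) by (intro tendsto_intros) auto
  then have "((\<lambda>y. C * \<bar>y - x\<bar> powr a) \<longlongrightarrow> 0) (at x within {0..1})" using assms(1) by simp
  then have "((\<lambda>y. f y - f x) \<longlongrightarrow> 0) (at x within {0..1})"
    by (rule Lim_null_comparison[rotated]) (use assms(2) x in \<open>auto simp: eventually_at_filter\<close>)
  then show "(f \<longlongrightarrow> f x) (at x within {0..1})" by (simp add: LIM_zero_iff)
qed

section \<open>Choice of scales and convergence\<close>

definition block_size :: "real \<Rightarrow> nat \<Rightarrow> nat" where
  "block_size \<beta> N = nat \<lfloor>real N powr \<beta>\<rfloor>"

lemma block_size_bounds:
  assumes "0 < \<beta>" "\<beta> < 1"
  shows "\<forall>\<^sub>F N in sequentially. 0 < N \<and> d < block_size \<beta> N \<and> block_size \<beta> N \<le> N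
    \<and> real (block_size \<beta> N) \<le> real N powr \<beta> \<and> real N powr \<beta> \<le> 2 * real (block_size \<beta> N)"
proof -
  have "\<forall>\<^sub>F N in sequentially. real N powr \<beta> \<ge> 2 + real d" using assms by real_asymp
  moreover have "\<forall>\<^sub>F N in sequentially. real N powr \<beta> \<le> real N" using assms by real_asymp
  ultimately show ?thesis using eventually_gt_at_top[of 0]
  proof eventually_elim
    case (elim N)
    have m: "real (block_size \<beta> N) = of_int \<lfloor>real N powr \<beta>\<rfloor>" by (simp add: block_size_def)
    have "real (block_size \<beta> N) \<le> real N powr \<beta>" unfolding m by (rule of_int_floor_le)
    moreover have "real N powr \<beta> < real (block_size \<beta> N) + 1" unfolding m by linarith
    moreover from this have "real d < real (block_size \<beta> N)" "real (block_size \<beta> N) \<ge> 1" using elim by linarith+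
    ultimately show ?case using elim by (auto simp flip: of_nat_less_iff of_nat_le_iff)
  qed
qed

theorem theorem4p1:
  fixes \<gamma> :: real and d :: nat and \<alpha> :: "nat \<Rightarrow> real"
    and f :: "nat \<Rightarrow> real \<Rightarrow> complex"
    and P :: "nat \<Rightarrow> 'w measure" and G :: "nat \<Rightarrow> 'w \<Rightarrow> complex mat"
  assumes "\<gamma> > 1 / 2"
    and "\<alpha> 0 > 1 / 2"
    and "\<And>l. l \<in> {1..d} \<Longrightarrow> 0 < \<alpha> l \<and> \<alpha> l \<le> 1"
    and "\<And>l. l \<le> d \<Longrightarrow> holder_on (\<alpha> l) {0..1} (f l)"
    and "\<And>N. prob_space (P N)"
    and "\<And>N. complex_gaussian_matrix (P N) N (G N)"
  shows "weakly_tendsto_in_prob P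
    (\<lambda>N \<omega>. empirical_measure
       (banded_mat d f N + complex_of_real (real N powr (- \<gamma>)) \<cdot>\<^sub>m G N \<omega>))
    (limit_law d f)"
proof -
  note \<gamma> = assms(1) and P = assms(5) and G = assms(6)
  have "\<alpha> l > 0" if "l \<le> d" for l
    using assms(2) assms(3)[of l] that by (cases "l = 0") auto
  then obtain a C S where a: "0 < a" "a \<le> 1" and C: "C \<ge> 0" and S: "S \<ge> 0"
    and H: "\<And>l x y. l \<le> d \<Longrightarrow> x \<in> {0..1} \<Longrightarrow> y \<in> {0..1} \<Longrightarrow> cmod (f l x - f l y) \<le> C * \<bar>x - y\<bar> powr a"
    and fS: "\<And>x. x \<in> {0..1} \<Longrightarrow> (\<Sum>l\<le>d. cmod (f l x)) \<le> S"
    by (rule holder_common[OF _ assms(4)]) auto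
  have fc: "continuous_on {0..1} (f l)" if "l \<le> d" for l
    by (rule holder_continuous[OF a(1) H[OF that]])
  \<comment> \<open>The blocks have length about \<open>N powr \<beta>\<close> and the exclusion
    radius is \<open>s = N powr (- \<beta>)\<close>. The Hoelder error on a block is of order
    \<open>N powr (- a * (1 - \<beta>))\<close>; it is small compared with \<open>s\<close> if
    \<open>\<kappa> > 0\<close>, which the choice \<open>\<beta> = a / 4\<close> ensures. The
    wrap-around rows and, on average over \<open>z\<close> in a disc, the rows of blocks with an
    eigenvalue near \<open>z\<close> make up a proportion of order \<open>N powr (- \<beta>)\<close>
    of all rows (for the latter it is \<open>m * s\<^sup>2\<close>), which is small even after
    multiplication by their price of order \<open>ln N\<close>.\<close>
  define \<beta> where "\<beta> = a / 4"
  have \<beta>: "0 < \<beta>" "\<beta> < 1" using a by (auto simp: \<beta>_def)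
  define \<kappa> where "\<kappa> = a - a * \<beta> - \<beta>"
  have \<kappa>: "\<kappa> > 0"
  proof -
    have "a * \<beta> \<le> 1 * \<beta>" using a \<beta> by (intro mult_right_mono) auto
    then show ?thesis using a by (simp add: \<kappa>_def \<beta>_def)
  qed
  define m where "m = block_size \<beta>"
  define hc where "hc N = C * (real (m N) / real N) powr a" for N
  \<comment> \<open>For the finitely many \<open>N\<close> for which blocks do not fit,
    \<open>\<mu>\<close> is set to 0; only its boundedness matters there.\<close>
  define adm where "adm N \<longleftrightarrow> d < m N \<and> m N \<le> N" for N
  define \<mu> where "\<mu> N j = (if adm N then block_structure.ev N d (m N) f j else 0)" for N j
  define A where "A N \<omega> = banded_mat d f N + complex_of_real (real N powr (- \<gamma>)) \<cdot>\<^sub>m G N \<omega>" for N \<omega>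
  have ev_m: "\<forall>\<^sub>F N in sequentially. 0 < N \<and> adm N \<and> real (m N) \<le> real N powr \<beta> \<and> real N powr \<beta> \<le> 2 * real (m N)"
    using block_size_bounds[OF \<beta>, of d] unfolding m_def adm_def by eventually_elim auto
  have bs: "block_structure N d (m N) f S (hc N)" if "adm N" for N
  proof
    show "d < m N" "m N \<le> N" using that by (auto simp: adm_def)
    show "(\<Sum>l\<le>d. cmod (f l x)) \<le> S" if "x \<in> {0..1}" for x by (rule fS[OF that])
    show "cmod (f l x - f l y) \<le> hc N" if "l \<le> d" "x \<in> {0..1}" "y \<in> {0..1}" "\<bar>x - y\<bar> \<le> real (m N) / real N" for l x y
    proof -
      have "C * \<bar>x - y\<bar> powr a \<le> hc N"
        unfolding hc_def using that C a by (intro mult_left_mono powr_mono2) auto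
      then show ?thesis using H[OF that(1-3)] by linarith
    qed
  qed
  have \<mu>S: "cmod (\<mu> N j) \<le> S" if "j < N" for N j
    using block_structure.cmod_ev[OF bs that] S by (simp add: \<mu>_def)
  have A_carrier: "A N \<omega> \<in> carrier_mat N N" if "\<omega> \<in> space (P N)" for N \<omega>
    unfolding A_def using G[of N] that by (intro noisy_banded_carrier) (simp add: complex_gaussian_matrix_def)
  have p: "lead_coeff (char_poly (A N \<omega>)) = 1 \<and> size (proots (char_poly (A N \<omega>))) = N" if "\<omega> \<in> space (P N)" for N \<omega>
    using degree_monic_char_poly[OF A_carrier[OF that]] size_eigenvalue_mset[OF A_carrier[OF that]]
    by (simp add: eigenvalue_mset_def)
  have q: "lead_coeff (root_poly N (\<mu> N)) = 1 \<and> size (proots (root_poly N (\<mu> N))) = N" for N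
    by (simp add: lead_coeff_root_poly proots_root_poly)
  have pm: "(\<lambda>(\<omega>, z). pot (char_poly (A N \<omega>)) z) \<in> borel_measurable (P N \<Otimes>\<^sub>M borel)" for N
    unfolding A_def by (rule noisy_banded_pot_measurable[OF G])

  have conv: "\<forall>\<^sub>F N in sequentially.
      (\<integral>\<^sup>+\<omega>. \<integral>\<^sup>+z. ennreal \<bar>pot (char_poly (A N \<omega>)) z - pot (root_poly N (\<mu> N)) z\<bar> * indicator (cball 0 R) z \<partial>lborel \<partial>P N) \<le> ennreal (\<epsilon> * real N)"
    if R: "R > 0" and \<epsilon>: "\<epsilon> > 0" for R \<epsilon>
  proof -
    define V where "V = measure lborel (cball (0::complex) R)"
    have V: "V \<ge> 0" by (simp add: V_def)
    have i0: "inv_sqrt_mass \<ge> 0" by (simp add: inv_sqrt_mass_def)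
    \<comment> \<open>The regularisation error is proportional to \<open>sqrt \<sigma>\<close>; this
      choice makes it at most \<open>\<epsilon> / 2\<close>. All other terms tend to 0 for fixed
      \<open>\<sigma>\<close>.\<close>
    define \<sigma> where "\<sigma> = (\<epsilon> / (8 * (V + inv_sqrt_mass + 1)))\<^sup>2"
    have \<sigma>: "\<sigma> > 0" using \<epsilon> V i0 by (auto simp: \<sigma>_def intro!: divide_pos_pos mult_pos_pos)
    have \<sigma>2: "4 * sqrt \<sigma> * (V + inv_sqrt_mass) \<le> \<epsilon> / 2"
    proof -
      have "sqrt \<sigma> = \<epsilon> / (8 * (V + inv_sqrt_mass + 1))" using \<epsilon> V i0 by (simp add: \<sigma>_def)
      then have "4 * sqrt \<sigma> * (V + inv_sqrt_mass) = \<epsilon> / 2 * ((V + inv_sqrt_mass) / (V + inv_sqrt_mass + 1))"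
        using V i0 by (simp add: field_simps)
      also have "\<dots> \<le> \<epsilon> / 2 * 1" using \<epsilon> V i0 by (intro mult_left_mono) auto
      finally show ?thesis by simp
    qed
    define cc where "cc N = real (2 * d + 3) * (ln (2 + 2 * (R + S + 1) / real N powr (- \<gamma>)) + 2 * inv_sqrt_mass) + (R + S)" for N :: nat
    define E1 where "E1 N = real (d + 1) * C * real N powr (- \<kappa>)" for N :: nat
    define A2 where "A2 N = 2 * real d * real N powr (- \<beta>) + real N powr (- (1 - \<beta>))" for N :: nat
    \<comment> \<open>The terms that vanish in the limit. The summand \<open>N powr (- (\<gamma> -
      1/2))\<close> is \<open>\<delta> * sqrt N\<close>, the noise in the Hadamard bound: it forces
      \<open>\<gamma> > 1/2\<close>.\<close>
    define Z where "Z N = V * (2 * E1 N + (2 * real d * (cc N * real N powr (- \<beta>)) + cc N * real N powr (- (1 - \<beta>)))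
        + 2 / \<sigma> * (E1 N + 2 * S * sqrt (A2 N) + 5 * real N powr (- (\<gamma> - 1/2)))) + 4 * (cc N * real N powr (- \<beta>))" for N
    have "Z \<longlonglongrightarrow> V * (2 * (real (d + 1) * C * 0) + (2 * real d * 0 + 0)
        + 2 / \<sigma> * (real (d + 1) * C * 0 + 2 * S * sqrt (2 * real d * 0 + 0) + 5 * 0)) + 4 * 0"
    proof -
      have k2: "2 * (R + S + 1) > 0" using R S by simp
      have g0: "\<gamma> > 0" using \<gamma> by simp
      have "(\<lambda>N. cc N * real N powr (- b)) \<longlonglongrightarrow> 0" if "b > 0" for b
        unfolding cc_def by (rule log_times_power_decay[OF k2 g0 that])
      then have "(\<lambda>N. cc N * real N powr (- \<beta>)) \<longlonglongrightarrow> 0" "(\<lambda>N. cc N * real N powr (- (1 - \<beta>))) \<longlonglongrightarrow> 0"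
        using \<beta> by (metis, metis diff_gt_0_iff_gt)
      moreover have "(\<lambda>N. real N powr (- \<beta>)) \<longlonglongrightarrow> 0" "(\<lambda>N. real N powr (- (1 - \<beta>))) \<longlonglongrightarrow> 0"
        "(\<lambda>N. real N powr (- \<kappa>)) \<longlonglongrightarrow> 0" "(\<lambda>N. real N powr (- (\<gamma> - 1/2))) \<longlonglongrightarrow> 0"
        by (rule power_decay; use \<beta> \<kappa> \<gamma> in simp)+
      ultimately show ?thesis unfolding Z_def E1_def A2_def by (intro tendsto_intros)
    qed
    then have "Z \<longlonglongrightarrow> 0" by simp
    then have "\<forall>\<^sub>F N in sequentially. Z N < \<epsilon> / 2" by (rule order_tendstoD(2)) (use \<epsilon> in simp)
    moreover have "E1 \<longlonglongrightarrow> real (d + 1) * C * 0"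
      unfolding E1_def by (intro tendsto_intros power_decay \<kappa>)
    then have "\<forall>\<^sub>F N in sequentially. E1 N < 1 / 2" by (rule order_tendstoD(2)) simp
    ultimately show ?thesis using ev_m
    proof eventually_elim
      case (elim N)
      then have N: "real N > 0" and adm: "adm N" and mM: "real (m N) \<le> real N powr \<beta>" "real N powr \<beta> \<le> 2 * real (m N)" by auto
      interpret B: block_structure N d "m N" f S "hc N" by (rule bs[OF adm])
      define M where "M = real N powr \<beta>"
      define s where "s = real N powr (- \<beta>)"
      define \<delta> where "\<delta> = real N powr (- \<gamma>)"
      have M0: "0 < M" using N by (simp add: M_def)
      have "1 \<le> real N powr \<beta>" using N \<beta> by (intro ge_one_powr_ge_zero) auto
      then have s01: "0 < s" "s \<le> 1" using N by (auto simp: s_def powr_minus inverse_le_1_iff)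
      have \<delta>0: "\<delta> > 0" using N by (simp add: \<delta>_def)
      have es: "B.e / s \<le> E1 N"
      proof -
        have "(real (m N) / real N) powr a \<le> (real N powr \<beta> / real N) powr a"
          using a mM N by (intro powr_mono2 divide_right_mono) auto
        also have "real N powr \<beta> / real N = real N powr (\<beta> - 1)" using N by (simp add: powr_diff)
        finally have "hc N \<le> C * real N powr ((\<beta> - 1) * a)"
          unfolding hc_def using C by (intro mult_left_mono) (simp_all add: powr_powr)
        then have "B.e \<le> real (d + 1) * (C * real N powr ((\<beta> - 1) * a))"
          unfolding B.e_def by (intro mult_left_mono) auto
        then have "B.e / s \<le> real (d + 1) * (C * real N powr ((\<beta> - 1) * a)) / s"
          using s01 by (intro divide_right_mono) auto
        also have "\<dots> = real (d + 1) * C * (real N powr ((\<beta> - 1) * a) / s)" by simp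
        also have "real N powr ((\<beta> - 1) * a) / s = real N powr (- \<kappa>)"
          unfolding s_def \<kappa>_def powr_diff[symmetric] by (rule arg_cong[where f = "(powr) (real N)"]) (simp add: algebra_simps)
        finally show ?thesis by (simp add: E1_def)
      qed
      have e1: "B.e \<le> E1 N"
      proof -
        have "B.e * 1 \<le> B.e * (1 / s)" using s01 B.e0 by (intro mult_left_mono) auto
        then show ?thesis using es by simp
      qed
      have "2 * B.e \<le> s"
      proof -
        have "B.e / s \<le> 1 / 2" using es elim by linarith
        then show ?thesis using s01 by (simp add: pos_divide_le_eq)
      qed
      note bound = B.potential_deviation[OF P G \<delta>0 s01 this \<sigma> less_imp_le[OF R] M0 mM[folded M_def]]
      have AA: "2 * real d / M + M / real N = A2 N"
        using N by (simp add: A2_def M_def powr_minus powr_diff divide_inverse)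
      have ccB: "B.change_cost R \<delta> = cc N" by (simp add: B.change_cost_def cc_def \<delta>_def)
      have dN: "\<delta> * sqrt (real N) = real N powr (- (\<gamma> - 1/2))"
        using N by (simp add: \<delta>_def powr_half_sqrt[symmetric] flip: powr_add)
      have Ms: "M * (4 * s\<^sup>2) = 4 * real N powr (- \<beta>)"
        using N by (simp add: M_def s_def powr_minus power2_eq_square field_simps)
      have le: "4 * sqrt \<sigma> * (V + inv_sqrt_mass)
        + V * (2 * (B.e / s) + cc N * A2 N + 2 / \<sigma> * (B.e + 2 * S * sqrt (A2 N) + 5 * \<delta> * sqrt (real N)))
        + cc N * M * (4 * s\<^sup>2) \<le> \<epsilon>"
      proof -
        have 1: "V * (2 * (B.e / s) + cc N * A2 N + 2 / \<sigma> * (B.e + 2 * S * sqrt (A2 N) + 5 * \<delta> * sqrt (real N)))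
          \<le> V * (2 * E1 N + cc N * A2 N + 2 / \<sigma> * (E1 N + 2 * S * sqrt (A2 N) + 5 * \<delta> * sqrt (real N)))"
          using V \<sigma> es e1 by (intro mult_left_mono add_mono order_refl) auto
        have 2: "cc N * A2 N = 2 * real d * (cc N * real N powr (- \<beta>)) + cc N * real N powr (- (1 - \<beta>))"
          by (simp add: A2_def algebra_simps)
        have 3: "cc N * M * (4 * s\<^sup>2) = 4 * (cc N * real N powr (- \<beta>))"
          by (simp only: mult.assoc Ms mult.left_commute)
        have 4: "5 * \<delta> * sqrt (real N) = 5 * real N powr (- (\<gamma> - 1/2))" by (simp only: mult.assoc dN)
        have "V * (2 * E1 N + cc N * A2 N + 2 / \<sigma> * (E1 N + 2 * S * sqrt (A2 N) + 5 * \<delta> * sqrt (real N)))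
          + cc N * M * (4 * s\<^sup>2) = Z N"
          unfolding Z_def 2 3 4 ..
        then show ?thesis using 1 \<sigma>2 elim(1) by linarith
      qed
      have rp: "root_poly N (\<mu> N) = root_poly N B.ev"
        unfolding root_poly_def \<mu>_def using adm by simp
      have "(\<integral>\<^sup>+\<omega>. \<integral>\<^sup>+z. ennreal \<bar>pot (char_poly (A N \<omega>)) z - pot (root_poly N (\<mu> N)) z\<bar> * indicator (cball 0 R) z \<partial>lborel \<partial>P N)
        \<le> ennreal (real N * (4 * sqrt \<sigma> * (V + inv_sqrt_mass)
        + V * (2 * (B.e / s) + cc N * A2 N + 2 / \<sigma> * (B.e + 2 * S * sqrt (A2 N) + 5 * \<delta> * sqrt (real N)))
        + cc N * M * (4 * s\<^sup>2)))"
        using bound unfolding rp A_def \<delta>_def[symmetric] V_def AA ccB .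
      also have "\<dots> \<le> ennreal (\<epsilon> * real N)"
        using mult_left_mono[OF le, of "real N"] by (intro ennreal_leI) (simp only: of_nat_0_le_iff mult.commute)
      finally show ?case .
    qed
  qed

  show ?thesis
    unfolding weakly_tendsto_in_prob_def A_def[symmetric]
  proof (intro allI impI)
    fix g :: "complex \<Rightarrow> real"
    assume g: "continuous_on UNIV g \<and> bounded (range g)"
    then obtain B where B: "\<And>z. \<bar>g z\<bar> \<le> B" by (auto simp: bounded_iff)
    have gc: "continuous_on UNIV g" using g by blast
    have gm: "g \<in> borel_measurable borel" using gc by (rule borel_measurable_continuous_onI)
    have B0: "B \<ge> 0" using B[of 0] by linarith
    let ?y = "\<lambda>N. (\<Sum>j<N. g (\<mu> N j)) / real N"
    have emp: "(\<integral>z. g z \<partial>empirical_measure (A N \<omega>)) = (\<Sum>x\<in>#proots (char_poly (A N \<omega>)). g x) / real N"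
      if "N > 0" "\<omega> \<in> space (P N)" for N \<omega>
      using integral_empirical_measure[OF A_carrier[OF that(2)] that(1) gm] by (simp add: eigenvalue_mset_def)
    show "tendsto_in_prob P (\<lambda>N \<omega>. \<integral>z. g z \<partial>empirical_measure (A N \<omega>)) (\<integral>z. g z \<partial>limit_law d f)"
    proof (rule tendsto_in_prob_of_L1[OF P, where y = ?y])
      \<comment> \<open>For \<open>N = 0\<close> there are no eigenvalues, but the matrix is
        constant and so is the integral.\<close>
      show "(\<lambda>\<omega>. \<integral>z. g z \<partial>empirical_measure (A N \<omega>)) \<in> borel_measurable (P N)" for N
      proof (cases "N = 0")
        case True
        have "A N \<omega> = 0\<^sub>m 0 0" if "\<omega> \<in> space (P N)" for \<omega>
          using A_carrier[OF that] True by (intro eq_matI) auto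
        then have "(\<lambda>\<omega>. \<integral>z. g z \<partial>empirical_measure (A N \<omega>)) \<in> borel_measurable (P N)
           \<longleftrightarrow> (\<lambda>\<omega>. \<integral>z. g z \<partial>empirical_measure (0\<^sub>m 0 0)) \<in> borel_measurable (P N)"
          by (intro measurable_cong) simp
        then show ?thesis by simp
      next
        case False
        have "(\<lambda>\<omega>. \<Sum>x\<in>#proots (char_poly (A N \<omega>)). g x) \<in> borel_measurable (P N)"
          using p by (intro measurable_root_sum pm gc) auto
        then have "(\<lambda>\<omega>. (\<Sum>x\<in>#proots (char_poly (A N \<omega>)). g x) / real N) \<in> borel_measurable (P N)" by measurable
        also have "?this \<longleftrightarrow> ?thesis" using emp False by (intro measurable_cong) auto
        finally show ?thesis .
      qed
      let ?H = "\<lambda>x t. g (\<Sum>l\<le>d. f l x * cis (2 * pi * (real l * t)))"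
      note HC = integral_limit_law(1)[OF fc gc B]
      have HI: "(\<integral>z. g z \<partial>limit_law d f) = integral {0..1} (\<lambda>x. integral {0..1} (?H x))"
        by (rule integral_limit_law(2)[OF fc gc B])
      show "?y \<longlonglongrightarrow> (\<integral>z. g z \<partial>limit_law d f)"
      proof (rule LIMSEQ_I)
        fix \<epsilon> :: real assume \<epsilon>: "\<epsilon> > 0"
        have "uniformly_continuous_on ({0..1} \<times> {0..1}) (\<lambda>(x, t). ?H x t)"
          by (intro compact_uniformly_continuous HC compact_Times) auto
        moreover have "0 < \<epsilon> / 4" using \<epsilon> by simp
        ultimately obtain \<eta> where \<eta>: "\<eta> > 0"
          and uc0: "\<And>p p'. p \<in> {0..1} \<times> {0..1} \<Longrightarrow> p' \<in> {0..1} \<times> {0..1} \<Longrightarrow> dist p' p < \<eta> \<Longrightarrow>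
            dist (case p' of (x, t) \<Rightarrow> ?H x t) (case p of (x, t) \<Rightarrow> ?H x t) < \<epsilon> / 4"
          by (rule uniformly_continuous_onE) blast
        have uc: "\<bar>?H y u - ?H x t\<bar> < \<epsilon> / 4"
          if "x \<in> {0..1}" "y \<in> {0..1}" "t \<in> {0..1}" "u \<in> {0..1}" "dist (y, u) (x, t) < \<eta>" for x t y u
          using uc0[of "(x, t)" "(y, u)"] that unfolding dist_real_def prod.case by blast
        have "\<forall>\<^sub>F N in sequentially. real N powr (- \<beta>) < \<eta> / 4"
          by (rule order_tendstoD(2)[OF power_decay[OF \<beta>(1)]]) (use \<eta> in simp)
        moreover have "\<forall>\<^sub>F N in sequentially. real N powr (- (1 - \<beta>)) < min (\<eta> / 2) (\<epsilon> / (8 * (B + 1)))"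
          by (rule order_tendstoD(2)[OF power_decay]) (use \<eta> \<epsilon> B0 \<beta> in auto)
        ultimately have "\<forall>\<^sub>F N in sequentially. norm (?y N - (\<integral>z. g z \<partial>limit_law d f)) < \<epsilon>"
          using ev_m
        proof eventually_elim
          case (elim N)
          then have N: "real N > 0" and adm: "adm N" and mM: "real (m N) \<le> real N powr \<beta>" "real N powr \<beta> \<le> 2 * real (m N)" by auto
          interpret B: block_structure N d "m N" f S "hc N" by (rule bs[OF adm])
          have "real (m N) / real N \<le> real N powr \<beta> / real N" using mM N by (intro divide_right_mono) auto
          also have "\<dots> = real N powr (- (1 - \<beta>))" using N by (simp add: powr_diff)
          finally have le: "real (m N) / real N \<le> real N powr (- (1 - \<beta>))" .
          have lt: "real N powr (- (1 - \<beta>)) < \<eta> / 2" "real N powr (- (1 - \<beta>)) < \<epsilon> / (8 * (B + 1))"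
            using elim by (simp_all only: min_less_iff_conj)
          note mN = le_less_trans[OF le lt(1)] le_less_trans[OF le lt(2)]
          have "1 / real (m N) \<le> 2 * real N powr (- \<beta>)"
            using mM N B.m0 by (simp add: powr_minus field_simps)
          then have m1: "1 / real (m N) < \<eta> / 2" using elim by linarith
          have "\<bar>(\<Sum>j<N. g (B.ev j)) / real N - integral {0..1} (\<lambda>x. integral {0..1} (?H x))\<bar>
            \<le> 2 * (\<epsilon> / 4) + 2 * B * (real (m N) / real N)"
          proof (rule B.node_average_error[OF HC B])
            fix x y t u :: real
            assume xy: "x \<in> {0..1}" "y \<in> {0..1}" "t \<in> {0..1}" "u \<in> {0..1}"
              and d: "\<bar>x - y\<bar> \<le> real (m N) / real N" "\<bar>t - u\<bar> \<le> 1 / real (m N)"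
            have "dist (x, t) (y, u) \<le> \<bar>x - y\<bar> + \<bar>t - u\<bar>"
              unfolding dist_Pair_Pair dist_real_def using sqrt_sum_squares_le_sum_abs[of "x - y" "t - u"] by simp
            also have "\<dots> < \<eta>" using d mN m1 by linarith
            finally show "\<bar>?H x t - ?H y u\<bar> \<le> \<epsilon> / 4" using uc[OF xy(2,1,4,3)] by simp
          qed
          moreover have "2 * B * (real (m N) / real N) \<le> \<epsilon> / 4"
          proof -
            have "2 * B * (real (m N) / real N) \<le> 2 * B * (\<epsilon> / (8 * (B + 1)))"
              using mN B0 by (intro mult_left_mono) auto
            also have "\<dots> = \<epsilon> / 4 * (B / (B + 1))" using B0 by (simp add: field_simps)
            also have "\<dots> \<le> \<epsilon> / 4 * 1" using \<epsilon> B0 by (intro mult_left_mono) auto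
            finally show ?thesis by simp
          qed
          moreover have "(\<Sum>j<N. g (\<mu> N j)) = (\<Sum>j<N. g (B.ev j))" using adm by (simp add: \<mu>_def)
          ultimately show ?case unfolding HI real_norm_def using \<epsilon> by simp
        qed
        then show "\<exists>no. \<forall>N\<ge>no. norm (?y N - (\<integral>z. g z \<partial>limit_law d f)) < \<epsilon>"
          by (simp add: eventually_sequentially)
      qed
      fix \<epsilon> :: real assume \<epsilon>: "\<epsilon> > 0"
      have "\<forall>\<^sub>F N in sequentially.
        (\<integral>\<^sup>+\<omega>. ennreal \<bar>(\<Sum>x\<in>#proots (char_poly (A N \<omega>)). g x) - (\<Sum>x\<in>#proots (root_poly N (\<mu> N)). g x)\<bar> \<partial>P N) \<le> ennreal (\<epsilon> * real N)"
        by (rule root_sums_close[OF P p q pm conv S _ gc B \<epsilon>]) (auto simp: proots_root_poly \<mu>S)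
      with eventually_gt_at_top[of 0]
      show "\<forall>\<^sub>F N in sequentially. (\<integral>\<^sup>+\<omega>. ennreal \<bar>(\<integral>z. g z \<partial>empirical_measure (A N \<omega>)) - ?y N\<bar> \<partial>P N) \<le> ennreal \<epsilon>"
      proof eventually_elim
        case (elim N)
        let ?d = "\<lambda>\<omega>. \<bar>(\<Sum>x\<in>#proots (char_poly (A N \<omega>)). g x) - (\<Sum>x\<in>#proots (root_poly N (\<mu> N)). g x)\<bar>"
        have dm: "(\<lambda>\<omega>. ennreal (?d \<omega>)) \<in> borel_measurable (P N)"
        proof -
          have [measurable]: "(\<lambda>\<omega>. \<Sum>x\<in>#proots (char_poly (A N \<omega>)). g x) \<in> borel_measurable (P N)"
            using p by (intro measurable_root_sum pm gc) auto
          show ?thesis by measurable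
        qed
        have "(\<integral>\<^sup>+\<omega>. ennreal \<bar>(\<integral>z. g z \<partial>empirical_measure (A N \<omega>)) - ?y N\<bar> \<partial>P N)
          = (\<integral>\<^sup>+\<omega>. ennreal (1 / real N) * ennreal (?d \<omega>) \<partial>P N)"
        proof (rule nn_integral_cong)
          fix \<omega> assume \<omega>: "\<omega> \<in> space (P N)"
          have "(\<integral>z. g z \<partial>empirical_measure (A N \<omega>)) - ?y N
            = (1 / real N) * ((\<Sum>x\<in>#proots (char_poly (A N \<omega>)). g x) - (\<Sum>x\<in>#proots (root_poly N (\<mu> N)). g x))"
            unfolding emp[OF elim(1) \<omega>] sum_root_poly by (simp add: diff_divide_distrib)
          then show "ennreal \<bar>(\<integral>z. g z \<partial>empirical_measure (A N \<omega>)) - ?y N\<bar> = ennreal (1 / real N) * ennreal (?d \<omega>)"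
            by (simp only: abs_mult, subst ennreal_mult[symmetric]) auto
        qed
        also have "\<dots> = ennreal (1 / real N) * (\<integral>\<^sup>+\<omega>. ennreal (?d \<omega>) \<partial>P N)"
          by (rule nn_integral_cmult[OF dm])
        also have "\<dots> \<le> ennreal (1 / real N) * ennreal (\<epsilon> * real N)"
          by (intro mult_left_mono elim) auto
        also have "\<dots> = ennreal \<epsilon>" using elim(1) \<epsilon> by (simp flip: ennreal_mult)
        finally show ?case .
      qed
    qed
  qed
qed

end
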